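(* Let $P$, $F$ and $G$ be as in the context, with the feedback interconnection $[\![P,-F]\!]$ stable, and let $$G(s)=\begin{bmatrix} C_z\\ C_v\end{bmatrix}(sI-A)^{-1}\begin{bmatrix} B_d & B_w\end{bmatrix}+\begin{bmatrix} D_{zd}& D_{zw}\\ D_{vd}& D_{vw}\end{bmatrix}$$ be any state-space realization of $G$ with $A$ Hurwitz. Given $h>0$ and $\delta\ge0$, let $$\beta=\Big(\tfrac{2(1+\delta)h}{\pi}+\sqrt{(1+\delta)h^2\cdot\min\{\delta,1\}}\Big)^2,\qquad \eta=h\cdot\min\{\delta,1\}.$$ If there exist real numbers $X\ge0$, $Y\ge0$ and a real symmetric matrix $Q=Q^\top$ such that $$\begin{bmatrix} A & B_w\\ I&0\end{bmatrix}^\top\begin{bmatrix}0&Q\\ Q&0\end{bmatrix}\begin{bmatrix} A & B_w\\ I&0\end{bmatrix}+\begin{bmatrix} C_v& D_{vw}\\ 0& I\end{bmatrix}^\top\begin{bmatrix}\beta X+\eta Y& Y\\ Y&-X\end{bmatrix}\begin{bmatrix} C_v& D_{vw}\\ 0& I\end{bmatrix}\prec0,$$ then the feedback interconnection $[\![P,-\mathscr{H}_{T^\star}\mathscr{S}_{T^\star}\mathscr{H}_{T'}\mathscr{S}_{T'}F]\!]$ is stable for all admissible event sequences $T'$ and $T^\star$ that satisfy the bounds (B) given in the context with $$\tau'=h,\quad \tau^\star=(1+\delta)h,\quad \tau^\circ=\delta h,\quad \tau^\natural=h\cdot\min\{\delta,1\}.$$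
   Context: Signals are scalar. $\mathbf{L}_2$ is the space of square integrable functions $\mathbb{R}_{\ge 0}\to\mathbb{R}$. $\mathbf{L}_{2e}$ is the set of functions $f:\mathbb{R}_{\ge0}\to\mathbb{R}$ with $P_\tau f\in\mathbf{L}_2$ for every $\tau>0$, where $(P_\tau f)(t)=f(t)$ for $t\le\tau$ and $0$ otherwise. An operator $M$ on $\mathbf{L}_{2e}$ is causal if $P_\tau MP_\tau=P_\tau M$ for all $\tau>0$; bounded if it maps $\mathbf{L}_2$ into $\mathbf{L}_2$ with finite induced norm $\|M\|=\sup_{u\in\mathbf{L}_2}\|Mu\|_{\mathbf{L}_2}/\|u\|_{\mathbf{L}_2}$; stable if causal and bounded. For symmetric $M$, $M\succ0$ means positive definite and $M\prec0$ means $-M\succ0$. $\mathsf{id}$ is the identity operator. Feedback interconnection: for causal $G_1,\Delta_1:\mathbf{L}_{2e}\to\mathbf{L}_{2e}$, consider $w=\Delta_1v+d_w$, $v=G_1w+d_v$. The interconnection is well-posed if for every $(d_w,d_v)\in\mathbf{L}_{2e}\times\mathbf{L}_{2e}$ there exist unique $(w,v)\in\mathbf{L}_{2e}\times\mathbf{L}_{2e}$ satisfying these equations and the closed-loop map $[\![G_1,\Delta_1]\!]:(d_w,d_v)\mapsto(w,v)$ is causal. It is stable if in addition the restriction of $[\![G_1,\Delta_1]\!]$ to $\mathbf{L}_2\times\mathbf{L}_2$ has finite induced norm. Systems: $P$ is a causal linear time-invariant system on $\mathbf{L}_{2e}$ given by a transfer function $P(s)$. $F$ is a stable low-pass linear time-invariant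 system (strictly proper transfer function $F(s)$ with no poles in the closed right-half plane). It is assumed throughout that $[\![P,-F]\!]$ is stable. The performance weight is $W=F$. $\mathscr{I}^\dagger$ denotes differentiation, so $\mathscr{I}^\dagger F$ is the stable system with transfer function $sF(s)$. Define $$G=\begin{bmatrix}G_{zd}&G_{zw}\\ G_{vd}&G_{vw}\end{bmatrix}=\begin{bmatrix}W&0\\0&\mathscr{I}^\dagger F\end{bmatrix}[\![P,-F]\!]\begin{bmatrix}\mathsf{id}&\mathsf{id}\\0&0\end{bmatrix};$$ that is, $G$ maps $(d,w)$ to $(z,v)$ with $u=d+w-Fy$, $y=Pu$, $z=Wu$, $v=\mathscr{I}^\dagger Fy$. Admissible event sequence: $T=(t_k)_{k\in\mathbb{N}_0}\subset\mathbb{R}_{\ge0}$ with $t_0=0$, $t_{k+1}-t_k>0$, $\lim_{k\to\infty}t_k=+\infty$ (also identified with its set of values). The sampling operator $\mathscr{S}_T$ maps a right-continuous signal $v$ in $\mathbf{L}_{2e}$ to the sequence $(v(t_k))_{k\in\mathbb{N}_0}$; the hold operator $\mathscr{H}_T$ maps a sequence $(\tilde v_k)_{k\in\mathbb{N}_0}$ to the signal equal to $\tilde v_k$ on $[t_k,t_{k+1})$, $k\in\mathbb{N}_0$. Bounds (B): with $T'=(t'_k)$, $T^\star=(t^\star_k)$ and $\phi_k=\min\{t : t\in T^\star\cap[t'_k,+\infty)\}$, for all $k\in\mathbb{N}_0$: $0<t'_{k+1}-t'_k\le\tau'$; $0<t^\star_{k+1}-t^\star_k\le\tau^\star$; $\phi_k-t'_k\le\tau^\circ\le\tau^\star$;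 and $\phi_k-\max\{t : t\in T'\cap[0,\phi_k]\}\le\tau^\natural\le\min\{\tau^\circ,\tau'\}$. *)

theory Defs
  imports "HOL-Analysis.Analysis" "HOL-Computational_Algebra.Polynomial"
begin

section \<open>Signals\<close>

text \<open>A signal on \<open>[0,\<infinity>)\<close> is a function \<open>real \<Rightarrow> real\<close> whose values at negative times are never
  inspected. Signals that agree almost everywhere on \<open>[0,\<infinity>)\<close> are identified: equality
  of signals is \<open>sig_eq\<close>, and every operator is required to respect it.\<close>

type_synonym signal = "real \<Rightarrow> real"

abbreviation halfline :: "real measure" where
  "halfline \<equiv> lebesgue_on {0..}"

definition sig_eq :: "signal \<Rightarrow> signal \<Rightarrow> bool" (infix "=\<^sub>a\<^sub>e" 50) where
  "f =\<^sub>a\<^sub>e g \<longleftrightarrow> (AE t in halfline. f t = g t)"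

definition L2 :: "signal set" where
  "L2 = {f. f \<in> borel_measurable halfline \<and> integrable halfline (\<lambda>t. (f t)\<^sup>2)}"

definition L2_norm :: "signal \<Rightarrow> real" where
  "L2_norm f = sqrt (LINT t|halfline. (f t)\<^sup>2)"

definition trunc :: "real \<Rightarrow> signal \<Rightarrow> signal" where
  "trunc \<tau> f = (\<lambda>t. if t \<le> \<tau> then f t else 0)"

definition L2e :: "signal set" where
  "L2e = {f. \<forall>\<tau>>0. trunc \<tau> f \<in> L2}"

section \<open>Operators\<close>

type_synonym sys = "signal \<Rightarrow> signal"

definition operator_on_L2e :: "sys \<Rightarrow> bool" where
  "operator_on_L2e M \<longleftrightarrow>
     (\<forall>u\<in>L2e. M u \<in> L2e) \<and> (\<forall>u\<in>L2e. \<forall>u'\<in>L2e. u =\<^sub>a\<^sub>e u' \<longrightarrow> M u =\<^sub>a\<^sub>e M u')"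

definition causal :: "sys \<Rightarrow> bool" where
  "causal M \<longleftrightarrow> operator_on_L2e M \<and>
     (\<forall>\<tau>>0. \<forall>u\<in>L2e. trunc \<tau> (M (trunc \<tau> u)) =\<^sub>a\<^sub>e trunc \<tau> (M u))"

definition bounded_sys :: "sys \<Rightarrow> bool" where
  "bounded_sys M \<longleftrightarrow> (\<exists>c. \<forall>u\<in>L2. M u \<in> L2 \<and> L2_norm (M u) \<le> c * L2_norm u)"

definition stable_sys :: "sys \<Rightarrow> bool" where
  "stable_sys M \<longleftrightarrow> causal M \<and> bounded_sys M"

definition linear_sys :: "sys \<Rightarrow> bool" where
  "linear_sys M \<longleftrightarrow> (\<forall>u\<in>L2e. \<forall>v\<in>L2e. \<forall>a b.
     M (\<lambda>t. a * u t + b * v t) =\<^sub>a\<^sub>e (\<lambda>t. a * M u t + b * M v t))"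

definition delay :: "real \<Rightarrow> signal \<Rightarrow> signal" where
  "delay \<theta> u = (\<lambda>t. if \<theta> \<le> t then u (t - \<theta>) else 0)"

definition time_invariant :: "sys \<Rightarrow> bool" where
  "time_invariant M \<longleftrightarrow> (\<forall>u\<in>L2e. \<forall>\<theta>\<ge>0. M (delay \<theta> u) =\<^sub>a\<^sub>e delay \<theta> (M u))"

definition causal_LTI :: "sys \<Rightarrow> bool" where
  "causal_LTI M \<longleftrightarrow> causal M \<and> linear_sys M \<and> time_invariant M"

definition neg_sys :: "sys \<Rightarrow> sys" where
  "neg_sys M = (\<lambda>u t. - M u t)"

section \<open>Transfer functions\<close>

definition laplace_integrand :: "signal \<Rightarrow> complex \<Rightarrow> real \<Rightarrow> complex" where
  "laplace_integrand f s = (\<lambda>t. exp (- s * complex_of_real t) * complex_of_real (f t))"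

definition laplace :: "signal \<Rightarrow> complex \<Rightarrow> complex" where
  "laplace f s = (LINT t|halfline. laplace_integrand f s t)"

text \<open>The system may be unstable, so the transform of the output is only required to converge on
  some right half-plane. The transform of an input in \<open>L2\<close> converges for \<open>Re s > 0\<close>.\<close>

definition has_transfer_function :: "sys \<Rightarrow> (complex \<Rightarrow> complex) \<Rightarrow> bool" where
  "has_transfer_function M H \<longleftrightarrow> (\<exists>\<sigma>\<ge>0. \<forall>u\<in>L2. \<forall>s. Re s > \<sigma> \<longrightarrow>
     integrable halfline (laplace_integrand (M u) s) \<and> laplace (M u) s = H s * laplace u s)"

text \<open>A common factor of \<open>p\<close> and \<open>q\<close> is harmless: its roots are in the open left half-plane,
  so the requirement on \<open>q\<close> holds iff it holds in lowest terms.\<close>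

definition strictly_proper_stable_rational :: "(complex \<Rightarrow> complex) \<Rightarrow> bool" where
  "strictly_proper_stable_rational H \<longleftrightarrow> (\<exists>p q :: real poly.
     degree p < degree q \<and>
     (\<forall>s. poly (map_poly complex_of_real q) s = 0 \<longrightarrow> Re s < 0) \<and>
     (\<forall>s. H s = poly (map_poly complex_of_real p) s / poly (map_poly complex_of_real q) s))"

definition stable_low_pass :: "sys \<Rightarrow> (complex \<Rightarrow> complex) \<Rightarrow> bool" where
  "stable_low_pass M H \<longleftrightarrow> causal_LTI M \<and> stable_sys M \<and>
     has_transfer_function M H \<and> strictly_proper_stable_rational H"

text \<open>Weak derivative on \<open>[0,\<infinity>)\<close>: \<open>f\<close> agrees almost everywhere with an antiderivative of it.
  It is unique up to \<open>sig_eq\<close>, and arbitrary if \<open>f\<close> has none.\<close>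

definition diff_sys :: sys where
  "diff_sys f = (SOME g. g \<in> L2e \<and>
     (\<exists>c. AE t in halfline. f t = c + (LINT x:{0..t}|lebesgue. g x)))"

section \<open>Feedback interconnection\<close>

definition loop_solution ::
  "sys \<Rightarrow> sys \<Rightarrow> signal \<times> signal \<Rightarrow> signal \<times> signal \<Rightarrow> bool" where
  "loop_solution G \<Delta> d x \<longleftrightarrow> fst x \<in> L2e \<and> snd x \<in> L2e \<and>
     fst x =\<^sub>a\<^sub>e (\<lambda>t. \<Delta> (snd x) t + fst d t) \<and>
     snd x =\<^sub>a\<^sub>e (\<lambda>t. G (fst x) t + snd d t)"

definition closed_loop :: "sys \<Rightarrow> sys \<Rightarrow> signal \<times> signal \<Rightarrow> signal \<times> signal" where
  "closed_loop G \<Delta> d = (SOME x. loop_solution G \<Delta> d x)"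

definition well_posed :: "sys \<Rightarrow> sys \<Rightarrow> bool" where
  "well_posed G \<Delta> \<longleftrightarrow> causal G \<and> causal \<Delta> \<and>
     (\<forall>d\<in>L2e \<times> L2e. (\<exists>x. loop_solution G \<Delta> d x) \<and>
        (\<forall>x y. loop_solution G \<Delta> d x \<and> loop_solution G \<Delta> d y \<longrightarrow>
           fst x =\<^sub>a\<^sub>e fst y \<and> snd x =\<^sub>a\<^sub>e snd y)) \<and>
     (\<forall>\<tau>>0. \<forall>d\<in>L2e \<times> L2e.
        let x = closed_loop G \<Delta> (trunc \<tau> (fst d), trunc \<tau> (snd d)); y = closed_loop G \<Delta> d
        in trunc \<tau> (fst x) =\<^sub>a\<^sub>e trunc \<tau> (fst y) \<and> trunc \<tau> (snd x) =\<^sub>a\<^sub>e trunc \<tau> (snd y))"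

definition pair_norm :: "signal \<times> signal \<Rightarrow> real" where
  "pair_norm x = sqrt ((L2_norm (fst x))\<^sup>2 + (L2_norm (snd x))\<^sup>2)"

definition stable_interconnection :: "sys \<Rightarrow> sys \<Rightarrow> bool" where
  "stable_interconnection G \<Delta> \<longleftrightarrow> well_posed G \<Delta> \<and>
     (\<exists>c. \<forall>d\<in>L2 \<times> L2. closed_loop G \<Delta> d \<in> L2 \<times> L2 \<and>
        pair_norm (closed_loop G \<Delta> d) \<le> c * pair_norm d)"

text \<open>The map \<open>(d,w) \<mapsto> (z,v)\<close> with \<open>u = d + w - F y\<close>, \<open>y = P u\<close>, \<open>z = W u\<close> and \<open>v\<close> the derivative
  of \<open>F y\<close>.\<close>

definition generalized_plant :: "sys \<Rightarrow> sys \<Rightarrow> sys \<Rightarrow> signal \<times> signal \<Rightarrow> signal \<times> signal" where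
  "generalized_plant W P F dw =
     (let (u, y) = closed_loop P (neg_sys F) (\<lambda>t. fst dw t + snd dw t, \<lambda>t. 0)
      in (W u, diff_sys (F y)))"

section \<open>Matrices and state-space realizations\<close>

definition above :: "'a^'n^'p \<Rightarrow> 'a^'n^'q \<Rightarrow> 'a^'n^('p + 'q)" where
  "above A B = (\<chi> i. case i of Inl p \<Rightarrow> A $ p | Inr q \<Rightarrow> B $ q)"

definition beside :: "'a^'m^'p \<Rightarrow> 'a^'n^'p \<Rightarrow> 'a^('m + 'n)^'p" where
  "beside A B = (\<chi> i j. case j of Inl m \<Rightarrow> A $ i $ m | Inr n \<Rightarrow> B $ i $ n)"

definition block_matrix ::
  "'a^'m^'p \<Rightarrow> 'a^'n^'p \<Rightarrow> 'a^'m^'q \<Rightarrow> 'a^'n^'q \<Rightarrow> 'a^('m + 'n)^('p + 'q)" where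
  "block_matrix A B C D = above (beside A B) (beside C D)"

definition pos_definite :: "real^'n^'n \<Rightarrow> bool" where
  "pos_definite M \<longleftrightarrow> transpose M = M \<and> (\<forall>x. x \<noteq> 0 \<longrightarrow> x \<bullet> (M *v x) > 0)"

definition neg_definite :: "real^'n^'n \<Rightarrow> bool" where
  "neg_definite M \<longleftrightarrow> pos_definite (- M)"

abbreviation complex_matrix :: "real^'n^'m \<Rightarrow> complex^'n^'m" where
  "complex_matrix \<equiv> map_matrix complex_of_real"

definition hurwitz :: "real^'n^'n \<Rightarrow> bool" where
  "hurwitz A \<longleftrightarrow> (\<forall>l x. x \<noteq> 0 \<and> complex_matrix A *v x = l *s x \<longrightarrow> Re l < 0)"

definition state_space ::
  "real^'n^'n \<Rightarrow> real^'m^'n \<Rightarrow> real^'n^'p \<Rightarrow> real^'m^'p \<Rightarrow> complex \<Rightarrow> complex^'m^'p" where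
  "state_space A B C D s =
     complex_matrix C ** matrix_inv (mat s - complex_matrix A) ** complex_matrix B
       + complex_matrix D"

definition laplace_pair :: "signal \<times> signal \<Rightarrow> complex \<Rightarrow> complex^(1 + 1)" where
  "laplace_pair f s = (\<chi> i. case i of Inl _ \<Rightarrow> laplace (fst f) s | Inr _ \<Rightarrow> laplace (snd f) s)"

definition has_transfer_matrix ::
  "(signal \<times> signal \<Rightarrow> signal \<times> signal) \<Rightarrow> (complex \<Rightarrow> complex^(1 + 1)^(1 + 1)) \<Rightarrow> bool" where
  "has_transfer_matrix M H \<longleftrightarrow> (\<exists>\<sigma>\<ge>0. \<forall>f\<in>L2 \<times> L2. \<forall>s. Re s > \<sigma> \<longrightarrow>
     integrable halfline (laplace_integrand (fst (M f)) s) \<and>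
     integrable halfline (laplace_integrand (snd (M f)) s) \<and>
     laplace_pair (M f) s = H s *v laplace_pair f s)"

section \<open>Sampling and hold\<close>

definition admissible :: "(nat \<Rightarrow> real) \<Rightarrow> bool" where
  "admissible T \<longleftrightarrow> T 0 = 0 \<and> (\<forall>k. T (Suc k) - T k > 0) \<and> filterlim T at_top sequentially"

definition right_continuous :: "signal \<Rightarrow> bool" where
  "right_continuous f \<longleftrightarrow> (\<forall>t\<ge>0. continuous (at_right t) f)"

text \<open>Signals are taken up to equality almost everywhere, so what is sampled is the right-continuous
  representative; its values on \<open>[0,\<infinity>)\<close> are unique if it exists.\<close>

definition right_cont_rep :: "signal \<Rightarrow> signal" where
  "right_cont_rep v = (SOME g. right_continuous g \<and> g =\<^sub>a\<^sub>e v)"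

definition sample :: "(nat \<Rightarrow> real) \<Rightarrow> signal \<Rightarrow> nat \<Rightarrow> real" where
  "sample T v = (\<lambda>k. right_cont_rep v (T k))"

definition hold :: "(nat \<Rightarrow> real) \<Rightarrow> (nat \<Rightarrow> real) \<Rightarrow> signal" where
  "hold T a = (\<lambda>t. a (THE k. T k \<le> t \<and> t < T (Suc k)))"

lemma right_continuous_eq:
  assumes "right_continuous f" "right_continuous g" "f =\<^sub>a\<^sub>e g" "t \<ge> 0"
  shows "f t = g t"
proof (rule ccontr)
  assume ne: "f t \<noteq> g t"
  have "((\<lambda>x. f x - g x) \<longlongrightarrow> f t - g t) (at_right t)"
    using assms(1,2,4) unfolding right_continuous_def continuous_within
    by (intro tendsto_diff) auto
  then have "eventually (\<lambda>x. f x - g x \<noteq> 0) (at_right t)"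
    using ne by (intro tendsto_imp_eventually_ne) auto
  then obtain b where b: "b > t" "\<And>y. t < y \<Longrightarrow> y < b \<Longrightarrow> f y \<noteq> g y"
    unfolding eventually_at_right_field by auto
  have "AE x in lebesgue. x \<in> {0..} \<longrightarrow> f x = g x"
    using assms(3) unfolding sig_eq_def by (subst (asm) AE_restrict_space_iff) auto
  then have "AE x in lebesgue. x \<notin> {t<..<b}"
    by (rule AE_mp) (use b assms(4) in \<open>auto intro!: AE_I2\<close>)
  then have "emeasure lebesgue {t<..<b} = 0"
    by (subst (asm) AE_iff_measurable[where N = "{t<..<b}"]) auto
  then show False using b(1) by simp
qed

lemma sample_right_continuous:
  assumes "right_continuous v" "T k \<ge> 0"
  shows "sample T v k = v (T k)"
proof -
  have "right_continuous v \<and> v =\<^sub>a\<^sub>e v" using assms by (simp add: sig_eq_def)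
  then have "right_continuous (right_cont_rep v) \<and> right_cont_rep v =\<^sub>a\<^sub>e v"
    unfolding right_cont_rep_def
    by (rule someI[of "\<lambda>g. right_continuous g \<and> g =\<^sub>a\<^sub>e v"])
  then show ?thesis
    using right_continuous_eq[of "right_cont_rep v" v "T k"] assms by (simp add: sample_def)
qed

definition first_event_from :: "(nat \<Rightarrow> real) \<Rightarrow> real \<Rightarrow> real" where
  "first_event_from T a = (LEAST t. t \<in> range T \<inter> {a..})"

definition last_event_until :: "(nat \<Rightarrow> real) \<Rightarrow> real \<Rightarrow> real" where
  "last_event_until T b = Max (range T \<inter> {0..b})"

definition timing_bounds ::
  "(nat \<Rightarrow> real) \<Rightarrow> (nat \<Rightarrow> real) \<Rightarrow> real \<Rightarrow> real \<Rightarrow> real \<Rightarrow> real \<Rightarrow> bool" where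
  "timing_bounds T' Ts \<tau>' \<tau>s \<tau>o \<tau>n \<longleftrightarrow> \<tau>o \<le> \<tau>s \<and> \<tau>n \<le> min \<tau>o \<tau>' \<and>
     (\<forall>k. 0 < T' (Suc k) - T' k \<and> T' (Suc k) - T' k \<le> \<tau>' \<and>
          0 < Ts (Suc k) - Ts k \<and> Ts (Suc k) - Ts k \<le> \<tau>s \<and>
          (let \<phi> = first_event_from Ts (T' k)
           in \<phi> - T' k \<le> \<tau>o \<and> \<phi> - last_event_until T' \<phi> \<le> \<tau>n))"

end

theory Submission
  imports Defs "HOL-Computational_Algebra.Fundamental_Theorem_Algebra"
begin

text \<open>Write \<open>w\<close> for the difference between \<open>F y\<close> and its resampled version and \<open>v\<close> for the derivative of
  \<open>F y\<close>. If \<open>\<phi>\<^sub>j\<close> is the first event of \<open>T\<^sup>\<star>\<close> after \<open>t'\<^sub>j\<close>, the held value on \<open>[\<phi>\<^sub>j, \<phi>\<^sub>j\<^sub>+\<^sub>1)\<close> is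
  \<open>(F y)(t'\<^sub>j)\<close>, so \<open>w(t)\<close> is the integral of \<open>v\<close> over \<open>[t'\<^sub>j, t]\<close> there. Wirtinger's inequality bounds
  the energy of \<open>w\<close> by \<open>\<beta>\<close> times that of \<open>v\<close>, and integrating \<open>2 v w = (w\<^sup>2)'\<close> gives
  \<open>2 \<integral> v w + \<eta> \<integral> v\<^sup>2 \<ge> 0\<close>, both up to every finite time. The matrix inequality is a dissipation
  inequality for the realization with storage \<open>x \<bullet> Q x\<close>, which is nonnegative because \<open>A\<close> is Hurwitz;
  with the two integral inequalities it bounds the energy of \<open>w\<close> in the closed loop. The equation
  \<open>w = E (H w + v\<^sub>0)\<close> of the loop is of Volterra type, which gives existence and uniqueness. Injectivity
  of the Laplace transform links the transfer functions to the time domain.\<close>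

section \<open>Locally square integrable signals\<close>

text \<open>Before stability is known, the signals of the sampled loop are only in
  \<open>L2e\<close>; hence every estimate is an energy inequality on \<open>[0, T]\<close> with a
  constant independent of \<open>T\<close>. The loop is linear, so its gain bound, applied to the
  difference of two solutions, also gives uniqueness and causality. Origin of \<beta>: consecutive
  \<phi>'s are at most \<open>L = h + \<delta> h\<close> apart, and the integral of \<open>v\<close>
  over \<open>[t'_j, t]\<close> is split at \<phi>_j. The part after \<phi>_j starts from zero, and
  Wirtinger's inequality gives it the gain \<open>2 L / pi\<close>. The part before is constant
  during a hold of length at most \<open>L\<close>; Cauchy-Schwarz over
  \<open>[t'_j, \<phi>_j]\<close>, of length at most \<eta>, gives it the gain
  \<open>sqrt (L \<eta>)\<close>. Minkowski's inequality adds the two. Two obstacles shape the rest.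
  \<open>P\<close>, \<open>F\<close> and \<open>G\<close> are given as operators that merely possess
  transfer functions, so the derivative of \<open>F y\<close> has to be built from the poles of
  \<open>F\<close> and then identified with the output of an arbitrary realization. Nonnegativity of
  \<open>Q\<close> is shown by linear algebra on invariant subspaces, without matrix
  exponentials.\<close>

lemma halfline_measurable_Icc:
  "f \<in> borel_measurable halfline \<Longrightarrow> 0 \<le> a \<Longrightarrow> f \<in> borel_measurable (lebesgue_on {a..b})"
  by (rule measurable_restrict_mono) auto

text \<open>Links two notions of null set: \<open>sig_eq\<close> speaks of the measure, whereas the
  spike lemmas for gauge integrals speak of \<open>negligible\<close> sets.\<close>

lemma AE_halfline_iff:
  "(AE t in halfline. P t) \<longleftrightarrow> negligible {t. 0 \<le> t \<and> \<not> P t}"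
proof -
  have "(AE t in halfline. P t) \<longleftrightarrow> (AE t in lebesgue. t \<in> {0..} \<longrightarrow> P t)"
    by (subst AE_restrict_space_iff) auto
  also have "\<dots> \<longleftrightarrow> negligible {t. \<not> (t \<in> {0..} \<longrightarrow> P t)}"
    by (simp add: negligible_iff_null_sets completion.AE_iff_null_sets)
  finally show ?thesis by (simp add: conj_commute)
qed

text \<open>The extended space in a form suited to gauge integrals, with values in any Euclidean
  space because states and complex signals occur as well. For real signals it is \<open>L2e\<close>,
  see \<open>L2e_eq_loc_L2\<close>.\<close>

definition loc_L2 :: "(real \<Rightarrow> 'a::euclidean_space) set" where
  "loc_L2 = {f. f \<in> borel_measurable halfline \<and> (\<forall>T. (\<lambda>t. (norm (f t))\<^sup>2) integrable_on {0..T})}"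

definition energy :: "(real \<Rightarrow> 'a::euclidean_space) \<Rightarrow> real \<Rightarrow> real" where
  "energy f T = integral {0..T} (\<lambda>t. (norm (f t))\<^sup>2)"

lemma loc_L2_measurable: "f \<in> loc_L2 \<Longrightarrow> f \<in> borel_measurable halfline"
  by (simp add: loc_L2_def)

lemma loc_L2_measurable_Icc:
  "f \<in> loc_L2 \<Longrightarrow> 0 \<le> a \<Longrightarrow> f \<in> borel_measurable (lebesgue_on {a..b})"
  by (simp add: loc_L2_def halfline_measurable_Icc)

lemma loc_L2_square_integrable:
  assumes "f \<in> loc_L2" "0 \<le> a"
  shows "(\<lambda>t. (norm (f t))\<^sup>2) integrable_on {a..b}"
  using assms integrable_on_subinterval[of "\<lambda>t. (norm (f t))\<^sup>2" "{0..b}" a b]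
  by (auto simp: loc_L2_def)

lemma loc_L2_I:
  assumes "f \<in> borel_measurable halfline"
    and "\<And>T. 0 \<le> T \<Longrightarrow> \<exists>g. g integrable_on {0..T} \<and> (\<forall>t\<in>{0..T}. (norm (f t))\<^sup>2 \<le> g t)"
  shows "f \<in> loc_L2"
  unfolding loc_L2_def
proof (safe intro!: assms(1))
  fix T :: real
  show "(\<lambda>t. (norm (f t))\<^sup>2) integrable_on {0..T}"
  proof (cases "0 \<le> T")
    case True
    then obtain g where g: "g integrable_on {0..T}" "\<forall>t\<in>{0..T}. (norm (f t))\<^sup>2 \<le> g t"
      using assms(2) by blast
    have "(\<lambda>t. (norm (f t))\<^sup>2) \<in> borel_measurable (lebesgue_on {0..T})"
      using halfline_measurable_Icc[OF assms(1), of 0 T] by measurable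
    then show ?thesis
      by (rule measurable_bounded_by_integrable_imp_integrable_real) (use g in auto)
  qed (auto simp: integrable_on_empty)
qed

lemma loc_L2_inner_absolutely_integrable:
  assumes "f \<in> loc_L2" "g \<in> loc_L2" "0 \<le> a"
  shows "(\<lambda>t. f t \<bullet> g t) absolutely_integrable_on {a..b}"
proof (rule measurable_bounded_by_integrable_imp_absolutely_integrable)
  show "(\<lambda>t. f t \<bullet> g t) \<in> borel_measurable (lebesgue_on {a..b})"
    using loc_L2_measurable_Icc[OF assms(1,3)] loc_L2_measurable_Icc[OF assms(2,3)] by measurable
  show "(\<lambda>t. (norm (f t))\<^sup>2 + (norm (g t))\<^sup>2) integrable_on {a..b}"
    using assms by (intro integrable_add loc_L2_square_integrable)
  fix t
  have "norm (f t \<bullet> g t) \<le> norm (f t) * norm (g t)"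
    by (simp add: Cauchy_Schwarz_ineq2)
  also have "\<dots> \<le> (norm (f t))\<^sup>2 + (norm (g t))\<^sup>2"
    using sum_squares_bound[of "norm (f t)" "norm (g t)"] zero_le_power2[of "norm (f t)"]
      zero_le_power2[of "norm (g t)"] by linarith
  finally show "norm (f t \<bullet> g t) \<le> (norm (f t))\<^sup>2 + (norm (g t))\<^sup>2" .
qed auto

lemma loc_L2_inner_integrable:
  "f \<in> loc_L2 \<Longrightarrow> g \<in> loc_L2 \<Longrightarrow> 0 \<le> a \<Longrightarrow> (\<lambda>t. f t \<bullet> g t) integrable_on {a..b}"
  using loc_L2_inner_absolutely_integrable absolutely_integrable_on_def by blast

lemma loc_L2_absolutely_integrable:
  assumes "f \<in> loc_L2" "0 \<le> a"
  shows "f absolutely_integrable_on {a..b}"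
proof (rule measurable_bounded_by_integrable_imp_absolutely_integrable)
  show "f \<in> borel_measurable (lebesgue_on {a..b})"
    using loc_L2_measurable_Icc[OF assms] .
  show "(\<lambda>t. 1 + (norm (f t))\<^sup>2) integrable_on {a..b}"
    using assms by (intro integrable_add loc_L2_square_integrable) auto
  fix t
  show "norm (f t) \<le> 1 + (norm (f t))\<^sup>2"
    using sum_squares_bound[of "norm (f t)" 1] norm_ge_zero[of "f t"]
    by (simp del: norm_ge_zero)
qed auto

lemma loc_L2_integrable: "f \<in> loc_L2 \<Longrightarrow> 0 \<le> a \<Longrightarrow> f integrable_on {a..b}"
  using loc_L2_absolutely_integrable absolutely_integrable_on_def by blast

lemma loc_L2_linear_image:
  fixes f :: "real \<Rightarrow> 'a::euclidean_space" and L :: "'a \<Rightarrow> 'b::euclidean_space"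
  assumes "f \<in> loc_L2" "linear L"
  shows "(\<lambda>t. L (f t)) \<in> loc_L2"
proof (rule loc_L2_I)
  have bl: "bounded_linear L" using assms(2) by (simp add: linear_conv_bounded_linear)
  then have "L \<in> borel_measurable borel"
    by (intro borel_measurable_continuous_onI linear_continuous_on)
  then show "(\<lambda>t. L (f t)) \<in> borel_measurable halfline"
    using loc_L2_measurable[OF assms(1)] by measurable
  obtain K where K: "\<And>x. norm (L x) \<le> norm x * K"
    using bounded_linear.bounded[OF bl] by blast
  fix T :: real
  have "(norm (L (f t)))\<^sup>2 \<le> K\<^sup>2 * (norm (f t))\<^sup>2" for t
    using power_mono[OF K[of "f t"] norm_ge_zero, of 2] by (simp add: power_mult_distrib mult.commute)
  then show "\<exists>g. g integrable_on {0..T} \<and> (\<forall>t\<in>{0..T}. (norm (L (f t)))\<^sup>2 \<le> g t)"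
    using loc_L2_square_integrable[OF assms(1), of 0 T]
    by (intro exI[of _ "\<lambda>t. K\<^sup>2 * (norm (f t))\<^sup>2"]) (auto intro: integrable_on_mult_right)
qed

lemma norm_add_square_le: "(norm (a + b))\<^sup>2 \<le> 2 * (norm a)\<^sup>2 + 2 * (norm (b::'a::real_inner))\<^sup>2"
proof -
  have "(norm (a + b))\<^sup>2 + (norm (a - b))\<^sup>2 = 2 * (norm a)\<^sup>2 + 2 * (norm b)\<^sup>2"
    by (simp add: power2_norm_eq_inner algebra_simps inner_commute)
  then show ?thesis using zero_le_power2[of "norm (a - b)"] by linarith
qed

lemma loc_L2_add:
  assumes "f \<in> loc_L2" "g \<in> loc_L2"
  shows "(\<lambda>t. f t + g t) \<in> loc_L2"
proof (rule loc_L2_I)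
  show "(\<lambda>t. f t + g t) \<in> borel_measurable halfline"
    using assms[THEN loc_L2_measurable] by measurable
  fix T :: real
  show "\<exists>h. h integrable_on {0..T} \<and> (\<forall>t\<in>{0..T}. (norm (f t + g t))\<^sup>2 \<le> h t)"
    using assms[THEN loc_L2_square_integrable, of 0 T] norm_add_square_le
    by (intro exI[of _ "\<lambda>t. 2 * (norm (f t))\<^sup>2 + 2 * (norm (g t))\<^sup>2"])
       (auto intro!: integrable_add integrable_on_mult_right)
qed

lemma loc_L2_scaleR: "f \<in> loc_L2 \<Longrightarrow> (\<lambda>t. c *\<^sub>R f t) \<in> loc_L2"
  by (rule loc_L2_linear_image) (auto intro: linearI simp: algebra_simps)

lemma loc_L2_cmult: "f \<in> loc_L2 \<Longrightarrow> (\<lambda>t. c * f t :: real) \<in> loc_L2"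
  using loc_L2_scaleR[of f c] by simp

lemma loc_L2_minus: "f \<in> loc_L2 \<Longrightarrow> (\<lambda>t. - f t) \<in> loc_L2"
  using loc_L2_scaleR[of f "-1"] by simp

lemma loc_L2_diff: "f \<in> loc_L2 \<Longrightarrow> g \<in> loc_L2 \<Longrightarrow> (\<lambda>t. f t - g t) \<in> loc_L2"
  using loc_L2_add[OF _ loc_L2_minus, of f g] by simp

lemma loc_L2_bounded:
  assumes "f \<in> borel_measurable halfline" "\<And>T. 0 \<le> T \<Longrightarrow> \<exists>B. \<forall>t\<in>{0..T}. norm (f t) \<le> B"
  shows "f \<in> loc_L2"
proof (rule loc_L2_I[OF assms(1)])
  fix T :: real assume "0 \<le> T"
  then obtain B where B: "\<forall>t\<in>{0..T}. norm (f t) \<le> B" using assms(2) by blast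
  then have "\<forall>t\<in>{0..T}. (norm (f t))\<^sup>2 \<le> B\<^sup>2" by (simp add: power_mono)
  then show "\<exists>g. g integrable_on {0..T} \<and> (\<forall>t\<in>{0..T}. (norm (f t))\<^sup>2 \<le> g t)"
    by (intro exI[of _ "\<lambda>_. B\<^sup>2"]) auto
qed

lemma continuous_halfline_measurable:
  fixes f :: "real \<Rightarrow> 'a::euclidean_space"
  shows "continuous_on {0..} f \<Longrightarrow> f \<in> borel_measurable halfline"
  by (simp add: continuous_imp_measurable_on_sets_lebesgue)

lemma loc_L2_continuous:
  fixes f :: "real \<Rightarrow> 'a::euclidean_space"
  assumes "continuous_on {0..} f"
  shows "f \<in> loc_L2"
proof (rule loc_L2_bounded[OF continuous_halfline_measurable[OF assms]])
  fix T :: real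
  have "continuous_on {0..T} f" by (rule continuous_on_subset[OF assms]) auto
  then have "bounded (f ` {0..T})"
    by (intro compact_imp_bounded compact_continuous_image) auto
  then show "\<exists>B. \<forall>t\<in>{0..T}. norm (f t) \<le> B" by (auto simp: bounded_iff)
qed

lemma loc_L2_zero: "(\<lambda>t. 0) \<in> loc_L2"
  by (rule loc_L2_continuous) simp

lemma loc_L2_norm: "f \<in> loc_L2 \<Longrightarrow> (\<lambda>t. norm (f t)) \<in> loc_L2"
  unfolding loc_L2_def by (auto intro: borel_measurable_norm)

section \<open>Invariance under equality almost everywhere\<close>

lemma halfline_measurable_AE:
  fixes f :: "real \<Rightarrow> 'a::euclidean_space"
  assumes "f \<in> borel_measurable halfline" "AE t in halfline. f t = g t"
  shows "g \<in> borel_measurable halfline"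
proof -
  have "f measurable_on {0..}"
    using assms(1) by (simp add: measurable_on_iff_borel_measurable)
  then have "g measurable_on {0..}"
    using assms(2) unfolding AE_halfline_iff
    by (rule_tac measurable_on_spike[where f=f]) auto
  then show ?thesis by (simp add: measurable_on_iff_borel_measurable)
qed

lemma integral_AE_cong:
  assumes "AE t in halfline. f t = g t" "0 \<le> a"
  shows "integral {a..b} f = integral {a..b} g"
  using assms unfolding AE_halfline_iff
  by (intro integral_spike[where S = "{t. 0 \<le> t \<and> f t \<noteq> g t}"]) auto

lemma integrable_AE_cong:
  assumes "AE t in halfline. f t = g t" "0 \<le> a" "f integrable_on {a..b}"
  shows "g integrable_on {a..b}"
proof (rule integrable_spike[OF assms(3)])
  show "negligible {t. 0 \<le> t \<and> f t \<noteq> g t}" using assms(1) by (simp add: AE_halfline_iff)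
qed (use assms(2) in auto)

lemma loc_L2_AE:
  assumes "f \<in> loc_L2" "AE t in halfline. f t = g t"
  shows "g \<in> loc_L2"
proof -
  have *: "AE t in halfline. (norm (f t))\<^sup>2 = (norm (g t))\<^sup>2"
    using assms(2) by (rule eventually_mono) simp
  show ?thesis
    unfolding loc_L2_def mem_Collect_eq
    using halfline_measurable_AE[OF loc_L2_measurable[OF assms(1)] assms(2)]
      integrable_AE_cong[OF * order_refl loc_L2_square_integrable[OF assms(1) order_refl]]
    by (intro conjI allI)
qed

lemma energy_AE_cong:
  assumes "AE t in halfline. f t = g t"
  shows "energy f T = energy g T"
proof -
  have *: "AE t in halfline. (norm (f t))\<^sup>2 = (norm (g t))\<^sup>2"
    using assms by (rule eventually_mono) simp
  show ?thesis unfolding energy_def by (rule integral_AE_cong[OF *]) simp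
qed

section \<open>Cauchy-Schwarz and the calculus of energies\<close>

text \<open>The integral of the square of \<open>r f - g\<close> is nonnegative for every real
  \<open>r\<close>; the best choice is \<open>r = P / A\<close>. Integrability is assumed on
  \<open>S\<close> alone because the proof of Wirtinger's inequality uses weights that behave well
  on a single interval only.\<close>

lemma integral_Cauchy_Schwarz_general:
  assumes f2: "(\<lambda>t. (norm (f t))\<^sup>2) integrable_on S"
    and g2: "(\<lambda>t. (norm (g t))\<^sup>2) integrable_on S"
    and fg: "(\<lambda>t. f t \<bullet> g t) integrable_on S"
  shows "(integral S (\<lambda>t. f t \<bullet> g t))\<^sup>2
    \<le> integral S (\<lambda>t. (norm (f t))\<^sup>2) * integral S (\<lambda>t. (norm (g t))\<^sup>2)"
    (is "?P\<^sup>2 \<le> ?A * ?B")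
proof -
  have *: "2 * r * ?P \<le> r\<^sup>2 * ?A + ?B" for r :: real
  proof -
    have "2 * r * ?P = integral S (\<lambda>t. 2 * r * (f t \<bullet> g t))" by simp
    also have "\<dots> \<le> integral S (\<lambda>t. r\<^sup>2 * (norm (f t))\<^sup>2 + (norm (g t))\<^sup>2)"
    proof (rule integral_le)
      show "(\<lambda>t. 2 * r * (f t \<bullet> g t)) integrable_on S" by (rule integrable_on_mult_right[OF fg])
      show "(\<lambda>t. r\<^sup>2 * (norm (f t))\<^sup>2 + (norm (g t))\<^sup>2) integrable_on S"
        by (rule integrable_add[OF integrable_on_mult_right[OF f2] g2])
      fix t
      have "0 \<le> (norm (r *\<^sub>R f t - g t))\<^sup>2" by simp
      also have "\<dots> = r\<^sup>2 * (norm (f t))\<^sup>2 + (norm (g t))\<^sup>2 - 2 * r * (f t \<bullet> g t)"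
        unfolding power2_norm_eq_inner
        by (simp add: inner_diff_left inner_diff_right inner_commute algebra_simps power2_eq_square[of r])
      finally show "2 * r * (f t \<bullet> g t) \<le> r\<^sup>2 * (norm (f t))\<^sup>2 + (norm (g t))\<^sup>2" by simp
    qed
    also have "\<dots> = r\<^sup>2 * ?A + ?B"
      using f2 g2 by (subst integral_add) (auto intro: integrable_on_mult_right)
    finally show ?thesis .
  qed
  have A: "?A \<ge> 0" and B: "?B \<ge> 0"
    using f2 g2 by (auto intro: integral_nonneg)
  show ?thesis
  proof (cases "?A = 0")
    case True
    have "?P = 0"
    proof (rule ccontr)
      assume "?P \<noteq> 0"
      \<comment> \<open>With \<open>?A = 0\<close> the inequality \<open>*\<close> bounds a linear
        function of \<open>r\<close> by \<open>?B\<close>; this \<open>r\<close> gives it the value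
        \<open>?B + 1\<close>.\<close>
      then have "2 * ((?B + 1) / (2 * ?P)) * ?P = ?B + 1" by simp
      then show False using *[of "(?B + 1) / (2 * ?P)"] True by simp
    qed
    then show ?thesis using A B by simp
  next
    case False
    then have "?A > 0" using A by simp
    then show ?thesis using *[of "?P / ?A"] by (simp add: field_simps power2_eq_square)
  qed
qed

lemma integral_cauchy_schwarz:
  assumes "f \<in> loc_L2" "g \<in> loc_L2" "0 \<le> a"
  shows "(integral {a..b} (\<lambda>t. f t \<bullet> g t))\<^sup>2
    \<le> integral {a..b} (\<lambda>t. (norm (f t))\<^sup>2) * integral {a..b} (\<lambda>t. (norm (g t))\<^sup>2)"
  by (intro integral_Cauchy_Schwarz_general loc_L2_square_integrable loc_L2_inner_integrable assms)

lemma integral_square_le: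
  assumes "f \<in> loc_L2" "0 \<le> a" "a \<le> b"
  shows "(norm (integral {a..b} f))\<^sup>2 \<le> (b - a) * integral {a..b} (\<lambda>t. (norm (f t))\<^sup>2)"
proof -
  have "(norm (integral {a..b} f)) \<le> integral {a..b} (\<lambda>t. norm (f t) \<bullet> 1)"
    using loc_L2_absolutely_integrable[OF assms(1,2), of b]
    by (simp add: absolutely_integrable_on_def integral_norm_bound_integral)
  then have "(norm (integral {a..b} f))\<^sup>2 \<le> (integral {a..b} (\<lambda>t. norm (f t) \<bullet> 1))\<^sup>2"
    by (rule power_mono) simp
  also have "\<dots> \<le> integral {a..b} (\<lambda>t. (norm (norm (f t)))\<^sup>2) * integral {a..b} (\<lambda>t. (norm (1::real))\<^sup>2)"
    by (rule integral_cauchy_schwarz) (use assms in \<open>auto intro: loc_L2_norm loc_L2_continuous\<close>)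
  also have "\<dots> = (b - a) * integral {a..b} (\<lambda>t. (norm (f t))\<^sup>2)"
    using assms by simp
  finally show ?thesis .
qed

lemma energy_nonneg: "f \<in> loc_L2 \<Longrightarrow> energy f T \<ge> 0"
  unfolding energy_def by (intro integral_nonneg loc_L2_square_integrable) auto

lemma energy_mono: "f \<in> loc_L2 \<Longrightarrow> S \<le> T \<Longrightarrow> energy f S \<le> energy f T"
  unfolding energy_def
  by (intro integral_subset_le loc_L2_square_integrable) auto

lemma energy_split:
  "f \<in> loc_L2 \<Longrightarrow> 0 \<le> S \<Longrightarrow> S \<le> T
    \<Longrightarrow> energy f T = energy f S + integral {S..T} (\<lambda>t. (norm (f t))\<^sup>2)"
  unfolding energy_def
  by (intro Henstock_Kurzweil_Integration.integral_combine[symmetric] loc_L2_square_integrable) auto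

lemma energy_add_le:
  assumes "f \<in> loc_L2" "g \<in> loc_L2"
  shows "energy (\<lambda>t. f t + g t) T \<le> 2 * energy f T + 2 * energy g T"
proof -
  have "energy (\<lambda>t. f t + g t) T
    \<le> integral {0..T} (\<lambda>t. 2 * (norm (f t))\<^sup>2 + 2 * (norm (g t))\<^sup>2)"
    unfolding energy_def
    by (intro integral_le loc_L2_square_integrable loc_L2_add integrable_add
        integrable_on_mult_right assms norm_add_square_le) auto
  also have "\<dots> = 2 * energy f T + 2 * energy g T"
    unfolding energy_def
    using assms loc_L2_square_integrable[of f 0 T] loc_L2_square_integrable[of g 0 T]
    by (subst integral_add) (auto intro: integrable_on_mult_right)
  finally show ?thesis .
qed

lemma energy_linear_le:
  fixes f :: "real \<Rightarrow> 'a::euclidean_space" and L :: "'a \<Rightarrow> 'b::euclidean_space"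
  assumes "f \<in> loc_L2" "linear L" "\<And>x. norm (L x) \<le> K * norm x"
  shows "energy (\<lambda>t. L (f t)) T \<le> K\<^sup>2 * energy f T"
proof -
  have "energy (\<lambda>t. L (f t)) T \<le> integral {0..T} (\<lambda>t. K\<^sup>2 * (norm (f t))\<^sup>2)"
    unfolding energy_def
  proof (rule integral_le)
    show "(\<lambda>t. (norm (L (f t)))\<^sup>2) integrable_on {0..T}"
      using loc_L2_square_integrable[OF loc_L2_linear_image[OF assms(1,2)]] by simp
    show "(\<lambda>t. K\<^sup>2 * (norm (f t))\<^sup>2) integrable_on {0..T}"
      using loc_L2_square_integrable[OF assms(1), of 0 T] by (simp add: integrable_on_mult_right)
    fix t show "(norm (L (f t)))\<^sup>2 \<le> K\<^sup>2 * (norm (f t))\<^sup>2"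
      using power_mono[OF assms(3)[of "f t"] norm_ge_zero, of 2] by (simp add: power_mult_distrib)
  qed
  also have "\<dots> = K\<^sup>2 * energy f T"
    unfolding energy_def by (rule integral_mult_right)
  finally show ?thesis .
qed

lemma energy_minus: "energy (\<lambda>t. - f t) T = energy f T"
  unfolding energy_def norm_minus_cancel ..

lemma energy_eq_0_imp_AE:
  assumes "f \<in> loc_L2" "energy f T \<le> 0"
  shows "negligible {t \<in> {0..T}. f t \<noteq> 0}"
proof -
  let ?g = "\<lambda>t. (norm (f t))\<^sup>2"
  have int: "integrable (lebesgue_on {0..T}) ?g"
    by (intro absolutely_integrable_imp_integrable nonnegative_absolutely_integrable_1
        loc_L2_square_integrable assms) auto
  have "integral\<^sup>L (lebesgue_on {0..T}) ?g = 0"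
    using assms energy_nonneg[OF assms(1), of T] lebesgue_integral_eq_integral[OF int]
    by (simp add: energy_def)
  then have "AE t in lebesgue_on {0..T}. ?g t = 0"
    using integral_nonneg_eq_0_iff_AE[OF int] by simp
  then have "AE t in lebesgue. t \<in> {0..T} \<longrightarrow> f t = 0"
    by (subst (asm) AE_restrict_space_iff) auto
  then show ?thesis
    by (simp add: negligible_iff_null_sets completion.AE_iff_null_sets)
qed

lemma AE_from_negligible_Icc:
  assumes "\<And>n::nat. negligible {t \<in> {0..real n}. \<not> P t}"
  shows "AE t in halfline. P t"
proof -
  have "negligible (\<Union>n::nat. {t \<in> {0..real n}. \<not> P t})"
    by (rule negligible_countable_Union) (use assms in auto)
  moreover have "{t. 0 \<le> t \<and> \<not> P t} \<subseteq> (\<Union>n::nat. {t \<in> {0..real n}. \<not> P t})"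
  proof
    fix t assume "t \<in> {t. 0 \<le> t \<and> \<not> P t}"
    then have "t \<in> {t \<in> {0..real (nat \<lceil>t\<rceil>)}. \<not> P t}" by (simp add: real_nat_ceiling_ge)
    then show "t \<in> (\<Union>n::nat. {t \<in> {0..real n}. \<not> P t})" by blast
  qed
  ultimately show ?thesis unfolding AE_halfline_iff by (rule negligible_subset)
qed


section \<open>Calculus of indefinite integrals\<close>

text \<open>Integration by parts for factors that are merely integrable, so that no pointwise
  derivative is available. By Fubini, the integral of \<open>f s * g t\<close> over the square is
  the product of the integrals; cutting the square along the diagonal gives the two summands, each
  integrated first in the variable whose range is cut.\<close>

lemma integral_product_rule_real:
  fixes f g :: "real \<Rightarrow> real"
  assumes f: "f absolutely_integrable_on {a..b}" and g: "g absolutely_integrable_on {a..b}"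
  shows "integral {a..b} (\<lambda>t. integral {a..t} f * g t) + integral {a..b} (\<lambda>t. f t * integral {a..t} g)
    = integral {a..b} f * integral {a..b} g"
    and "(\<lambda>t. integral {a..t} f * g t) absolutely_integrable_on {a..b}"
proof -
  define M where "M = lebesgue_on {a..b}"
  interpret M: finite_measure M
    unfolding M_def by (rule finite_measure_lebesgue_on) simp
  interpret pair_sigma_finite M M ..
  have fi: "integrable M f" and gi: "integrable M g"
    using f g by (auto simp: M_def intro: absolutely_integrable_imp_integrable)
  have [measurable]: "f \<in> borel_measurable M" "g \<in> borel_measurable M"
    using fi gi by auto
  have id [measurable]: "(\<lambda>x. x) \<in> borel_measurable M"
    unfolding M_def by (intro measurable_restrict_space1 measurable_completion) auto
  have [simp]: "space M = {a..b}" by (simp add: M_def)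
  have L: "integral\<^sup>L M k = integral {a..b} k" "k integrable_on {a..b}" if "integrable M k" for k :: "real \<Rightarrow> real"
    using that unfolding M_def
    by (auto intro: lebesgue_integral_eq_integral integrable_on_lebesgue_on)
  have hi: "integrable (M \<Otimes>\<^sub>M M) (\<lambda>(s, t). f s * g t)"
  proof (rule Fubini_integrable)
    show "integrable M (\<lambda>x. \<integral>y. norm (case (x, y) of (s, t) \<Rightarrow> f s * g t) \<partial>M)"
      using fi gi by (simp add: abs_mult)
    show "AE x in M. integrable M (\<lambda>y. case (x, y) of (s, t) \<Rightarrow> f s * g t)"
      using gi by simp
  qed measurable
  define h1 where "h1 = (\<lambda>p. if fst p \<le> snd p then f (fst p) * g (snd p) else 0)"
  define h2 where "h2 = (\<lambda>p. if fst p \<le> snd p then 0 else f (fst p) * g (snd p))"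
  have m [measurable]: "h1 \<in> borel_measurable (M \<Otimes>\<^sub>M M)" "h2 \<in> borel_measurable (M \<Otimes>\<^sub>M M)"
    unfolding h1_def h2_def by measurable
  have h1: "integrable (M \<Otimes>\<^sub>M M) h1" and h2: "integrable (M \<Otimes>\<^sub>M M) h2"
    by (rule Bochner_Integration.integrable_bound[OF hi]; auto simp: h1_def h2_def)+
  have 1: "(\<integral>s. h1 (s, t) \<partial>M) = integral {a..t} f * g t" if "t \<in> {a..b}" for t
  proof -
    have "integrable M (\<lambda>s. (if s \<le> t then f s else 0))"
      by (rule Bochner_Integration.integrable_bound[OF fi]) auto
    then have "(\<integral>s. (if s \<le> t then f s else 0) \<partial>M) = integral {a..b} (\<lambda>s. if s \<in> {..t} then f s else 0)"
      using L(1) by simp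
    also have "\<dots> = integral {a..t} f"
      using that by (subst integral_restrict_Int) (auto intro!: arg_cong[where f = "\<lambda>S. integral S f"])
    finally have *: "(\<integral>s. (if s \<le> t then f s else 0) \<partial>M) = integral {a..t} f" .
    have "(\<integral>s. h1 (s, t) \<partial>M) = (\<integral>s. (if s \<le> t then f s else 0) * g t \<partial>M)"
      by (rule Bochner_Integration.integral_cong) (auto simp: h1_def)
    then show ?thesis by (simp only: integral_mult_left_zero *)
  qed
  have 2: "(\<integral>t. h2 (s, t) \<partial>M) = f s * integral {a..s} g" if "s \<in> {a..b}" for s
  proof -
    have "integrable M (\<lambda>t. (if s \<le> t then 0 else g t))"
      by (rule Bochner_Integration.integrable_bound[OF gi]) auto
    then have "(\<integral>t. (if s \<le> t then 0 else g t) \<partial>M) = integral {a..b} (\<lambda>t. if s \<le> t then 0 else g t)"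
      using L(1) by simp
    \<comment> \<open>The diagonal belongs to the other half of the square; the two integrands
      differ only at \<open>t = s\<close>.\<close>
    also have "\<dots> = integral {a..b} (\<lambda>t. if t \<in> {..s} then g t else 0)"
      by (rule integral_spike[where S = "{s}"]) auto
    also have "\<dots> = integral {a..s} g"
      using that by (subst integral_restrict_Int) (auto intro!: arg_cong[where f = "\<lambda>S. integral S g"])
    finally have *: "(\<integral>t. (if s \<le> t then 0 else g t) \<partial>M) = integral {a..s} g" .
    have "(\<integral>t. h2 (s, t) \<partial>M) = (\<integral>t. f s * (if s \<le> t then 0 else g t) \<partial>M)"
      by (rule Bochner_Integration.integral_cong) (auto simp: h2_def)
    then show ?thesis by (simp only: integral_mult_right_zero *)
  qed
  have i1: "integrable M (\<lambda>t. \<integral>s. h1 (s, t) \<partial>M)"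
    using integrable_snd[of "\<lambda>s t. h1 (s, t)"] h1 by simp
  have i2: "integrable M (\<lambda>s. \<integral>t. h2 (s, t) \<partial>M)"
    using integrable_fst'[OF h2] by simp
  have i1': "integrable M (\<lambda>t. integral {a..t} f * g t)"
    using i1 by (rule Bochner_Integration.integrable_cong[THEN iffD1, OF refl, rotated]) (simp add: 1)
  have i2': "integrable M (\<lambda>t. f t * integral {a..t} g)"
    using i2 by (rule Bochner_Integration.integrable_cong[THEN iffD1, OF refl, rotated]) (simp add: 2)
  have "integral\<^sup>L (M \<Otimes>\<^sub>M M) h1 = (\<integral>t. (\<integral>s. h1 (s, t) \<partial>M) \<partial>M)"
    using integral_snd[of "\<lambda>s t. h1 (s, t)"] h1 by simp
  also have "\<dots> = (\<integral>t. integral {a..t} f * g t \<partial>M)"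
    by (rule Bochner_Integration.integral_cong) (simp_all add: 1)
  also have "\<dots> = integral {a..b} (\<lambda>t. integral {a..t} f * g t)"
    by (rule L(1)[OF i1'])
  finally have e1: "integral\<^sup>L (M \<Otimes>\<^sub>M M) h1 = integral {a..b} (\<lambda>t. integral {a..t} f * g t)" .
  have "integral\<^sup>L (M \<Otimes>\<^sub>M M) h2 = (\<integral>s. (\<integral>t. h2 (s, t) \<partial>M) \<partial>M)"
    using integral_fst'[OF h2] by simp
  also have "\<dots> = (\<integral>t. f t * integral {a..t} g \<partial>M)"
    by (rule Bochner_Integration.integral_cong) (simp_all add: 2)
  also have "\<dots> = integral {a..b} (\<lambda>t. f t * integral {a..t} g)"
    by (rule L(1)[OF i2'])
  finally have e2: "integral\<^sup>L (M \<Otimes>\<^sub>M M) h2 = integral {a..b} (\<lambda>t. f t * integral {a..t} g)" .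
  have "integral\<^sup>L (M \<Otimes>\<^sub>M M) h1 + integral\<^sup>L (M \<Otimes>\<^sub>M M) h2 = integral\<^sup>L (M \<Otimes>\<^sub>M M) (\<lambda>p. h1 p + h2 p)"
    using h1 h2 by simp
  also have "\<dots> = integral\<^sup>L (M \<Otimes>\<^sub>M M) (\<lambda>(s, t). f s * g t)"
    by (rule Bochner_Integration.integral_cong) (auto simp: h1_def h2_def)
  also have "\<dots> = (\<integral>s. (\<integral>t. f s * g t \<partial>M) \<partial>M)"
    using integral_fst'[OF hi] by simp
  also have "\<dots> = integral\<^sup>L M f * integral\<^sup>L M g"
    by simp
  finally show "integral {a..b} (\<lambda>t. integral {a..t} f * g t) + integral {a..b} (\<lambda>t. f t * integral {a..t} g)
    = integral {a..b} f * integral {a..b} g"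
    using e1 e2 L(1)[OF fi] L(1)[OF gi] by simp
  show "(\<lambda>t. integral {a..t} f * g t) absolutely_integrable_on {a..b}"
    using i1' unfolding M_def set_integrable_def
    by (simp add: integrable_restrict_space)
qed

lemma integral_inner_const:
  fixes f :: "real \<Rightarrow> 'a::euclidean_space"
  shows "f integrable_on S \<Longrightarrow> integral S (\<lambda>t. f t \<bullet> c) = integral S f \<bullet> c"
  using integral_linear[OF _ bounded_linear_inner_left, of f S c] by (simp add: o_def)

lemma integral_inner_product_rule:
  fixes f g :: "real \<Rightarrow> 'a::euclidean_space"
  assumes f: "f absolutely_integrable_on {a..b}" and g: "g absolutely_integrable_on {a..b}"
  shows "integral {a..b} (\<lambda>t. integral {a..t} f \<bullet> g t) + integral {a..b} (\<lambda>t. f t \<bullet> integral {a..t} g)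
    = integral {a..b} f \<bullet> integral {a..b} g"
proof -
  have fi: "(\<lambda>t. f t \<bullet> i) absolutely_integrable_on {a..b}"
    and gi: "(\<lambda>t. g t \<bullet> i) absolutely_integrable_on {a..b}" if "i \<in> Basis" for i
    by (rule absolutely_integrable_component[OF f], rule absolutely_integrable_component[OF g])
  have comp: "integral {a..t} k \<bullet> i = integral {a..t} (\<lambda>t. k t \<bullet> i)"
    if "k absolutely_integrable_on {a..b}" "t \<in> {a..b}" for k :: "real \<Rightarrow> 'a" and t i
    by (rule integral_inner_const[symmetric], rule integrable_on_subinterval[of k "{a..b}"])
      (use that in \<open>auto simp: absolutely_integrable_on_def\<close>)
  note P = integral_product_rule_real[OF fi gi] integral_product_rule_real[OF gi fi]
  have i1: "(\<lambda>t. integral {a..t} (\<lambda>t. f t \<bullet> i) * (g t \<bullet> i)) integrable_on {a..b}"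
    and i2: "(\<lambda>t. (f t \<bullet> i) * integral {a..t} (\<lambda>t. g t \<bullet> i)) integrable_on {a..b}" if "i \<in> Basis" for i
    using set_lebesgue_integral_eq_integral(1)[OF P(2)[OF that that]]
      set_lebesgue_integral_eq_integral(1)[OF P(4)[OF that that]]
    by (simp_all only: mult.commute)
  have "integral {a..b} (\<lambda>t. integral {a..t} f \<bullet> g t)
    = integral {a..b} (\<lambda>t. \<Sum>i\<in>Basis. integral {a..t} (\<lambda>t. f t \<bullet> i) * (g t \<bullet> i))"
    by (rule integral_cong, subst euclidean_inner) (simp add: comp[OF f])
  moreover have "integral {a..b} (\<lambda>t. f t \<bullet> integral {a..t} g)
    = integral {a..b} (\<lambda>t. \<Sum>i\<in>Basis. (f t \<bullet> i) * integral {a..t} (\<lambda>t. g t \<bullet> i))"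
    by (rule integral_cong, subst euclidean_inner) (simp add: comp[OF g])
  moreover have "integral {a..b} f \<bullet> integral {a..b} g
    = (\<Sum>i\<in>Basis. integral {a..b} (\<lambda>t. f t \<bullet> i) * integral {a..b} (\<lambda>t. g t \<bullet> i))"
  proof (cases "a \<le> b")
    case True
    then show ?thesis by (subst euclidean_inner) (simp add: comp[OF f] comp[OF g])
  qed auto
  ultimately show ?thesis
    by (simp only: integral_sum[OF finite_Basis i1] integral_sum[OF finite_Basis i2]
        sum.distrib[symmetric]) (rule sum.cong[OF refl P(1)])
qed

lemma continuous_on_halfline_I:
  fixes f :: "real \<Rightarrow> 'a::topological_space"
  assumes "\<And>b. continuous_on {a..b} f"
  shows "continuous_on {a..} f"
  unfolding continuous_on_eq_continuous_within
proof
  fix t assume "t \<in> {a..}"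
  then have "continuous (at t within {a..t + 1}) f"
    using assms[of "t + 1"] by (simp add: continuous_on_eq_continuous_within)
  moreover have "at t within {a..} = at t within {a..t + 1}"
    by (rule at_within_nhd[of _ "{..<t + 1}"]) auto
  ultimately show "continuous (at t within {a..}) f" by simp
qed

lemma indefinite_integral_continuous_halfline:
  fixes f :: "real \<Rightarrow> 'a::euclidean_space"
  assumes "f \<in> loc_L2"
  shows "continuous_on {0..} (\<lambda>t. integral {0..t} f)"
  by (intro continuous_on_halfline_I indefinite_integral_continuous_1 loc_L2_integrable assms order_refl)

lemma indefinite_integral_loc_L2:
  fixes f :: "real \<Rightarrow> 'a::euclidean_space"
  shows "f \<in> loc_L2 \<Longrightarrow> (\<lambda>t. integral {0..t} f) \<in> loc_L2"
  by (rule loc_L2_continuous[OF indefinite_integral_continuous_halfline])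

text \<open>The integrated form of the rate of the storage \<open>x \<bullet> Q x\<close> along
  \<open>x' = g\<close>. Since \<open>x\<close> is only an indefinite integral, integration by parts
  replaces the chain rule.\<close>

lemma quadratic_form_rate:
  fixes g :: "real \<Rightarrow> 'a::euclidean_space"
  assumes g: "g \<in> loc_L2" and Q: "linear Q" "\<And>x y. Q x \<bullet> y = x \<bullet> Q y"
    and x: "\<And>t. 0 \<le> t \<Longrightarrow> x t = integral {0..t} g" and "0 \<le> T"
  shows "x T \<bullet> Q (x T) = integral {0..T} (\<lambda>t. 2 * (Q (x t) \<bullet> g t))"
proof -
  have blQ: "bounded_linear Q" using Q(1) by (simp add: linear_conv_bounded_linear)
  have Qg: "(\<lambda>t. Q (g t)) \<in> loc_L2" by (rule loc_L2_linear_image[OF g Q(1)])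
  have Qx: "integral {0..t} (\<lambda>t. Q (g t)) = Q (x t)" if "0 \<le> t" for t
    using integral_linear[OF loc_L2_integrable[OF g order_refl] blQ, of t] x[OF that] by (simp add: o_def)
  have "x T \<bullet> Q (x T) = integral {0..T} (\<lambda>t. integral {0..t} g \<bullet> Q (g t))
     + integral {0..T} (\<lambda>t. g t \<bullet> integral {0..t} (\<lambda>t. Q (g t)))"
    using integral_inner_product_rule[OF loc_L2_absolutely_integrable[OF g order_refl]
        loc_L2_absolutely_integrable[OF Qg order_refl], of T] Qx x \<open>0 \<le> T\<close> by simp
  also have "integral {0..T} (\<lambda>t. integral {0..t} g \<bullet> Q (g t)) = integral {0..T} (\<lambda>t. Q (x t) \<bullet> g t)"
    by (rule integral_cong) (simp add: x Q(2))
  also have "integral {0..T} (\<lambda>t. g t \<bullet> integral {0..t} (\<lambda>t. Q (g t))) = integral {0..T} (\<lambda>t. Q (x t) \<bullet> g t)"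
    by (rule integral_cong) (simp add: Qx inner_commute)
  finally show ?thesis by simp
qed

section \<open>Picard iteration for Volterra equations\<close>

text \<open>The value at time \<open>t\<close> is controlled by the energy up to that same
  \<open>t\<close>. Measured against the growing weight \<open>exp (4 C t)\<close>, the squared
  difference of successive iterates therefore shrinks by the factor 4, whatever the size of
  \<open>C\<close>, and the iteration converges uniformly on every bounded interval without any
  smallness of the horizon.\<close>

lemma volterra_fixed_point:
  fixes \<Phi> :: "(real \<Rightarrow> 'a::euclidean_space) \<Rightarrow> (real \<Rightarrow> 'a)"
  assumes into: "\<And>w. w \<in> loc_L2 \<Longrightarrow> \<Phi> w \<in> loc_L2"
    and lip: "\<And>T. 0 \<le> T \<Longrightarrow> \<exists>C>0. \<forall>w\<in>loc_L2. \<forall>w'\<in>loc_L2. \<forall>t\<in>{0..T}.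
      (norm (\<Phi> w t - \<Phi> w' t))\<^sup>2 \<le> C * energy (\<lambda>s. w s - w' s) t"
  obtains w where "w \<in> loc_L2" "\<And>t. 0 \<le> t \<Longrightarrow> w t = \<Phi> w t"
proof -
  define W where "W = (\<lambda>n. (\<Phi> ^^ n) (\<lambda>t. 0))"
  have W0: "W n \<in> loc_L2" for n
    unfolding W_def by (induction n) (auto intro: into loc_L2_zero)
  have WS: "W (Suc n) = \<Phi> (W n)" for n by (simp add: W_def)
  have key: "\<exists>K\<ge>0. \<forall>n. \<forall>t\<in>{0..T}. norm (W (Suc (Suc n)) t - W (Suc n) t) \<le> K * (1/2) ^ n"
    if T: "0 \<le> T" for T
  proof -
    obtain C where C: "C > 0" "\<And>w w' t. w \<in> loc_L2 \<Longrightarrow> w' \<in> loc_L2 \<Longrightarrow> t \<in> {0..T} \<Longrightarrow>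
      (norm (\<Phi> w t - \<Phi> w' t))\<^sup>2 \<le> C * energy (\<lambda>s. w s - w' s) t"
      using lip[OF T] by blast
    \<comment> \<open>The first difference is known in energy only, as its values may be unbounded;
      pointwise bounds begin one iterate later, hence the shifted indices below.\<close>
    define M where "M = C * energy (\<lambda>s. W 1 s - W 0 s) T"
    have M: "M \<ge> 0" unfolding M_def using C(1) by (intro mult_nonneg_nonneg energy_nonneg loc_L2_diff W0) auto
    have ind: "(norm (W (Suc (Suc n)) t - W (Suc n) t))\<^sup>2 \<le> M * exp (4 * C * t) / 4 ^ n"
      if "t \<in> {0..T}" for n t
      using that
    proof (induction n arbitrary: t)
      case 0
      have "(norm (W (Suc (Suc 0)) t - W (Suc 0) t))\<^sup>2 \<le> C * energy (\<lambda>s. W 1 s - W 0 s) t"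
        unfolding WS[of "Suc 0"] WS[of 0] using C(2)[OF W0[of 1] W0[of 0] 0] by (simp add: WS)
      also have "\<dots> \<le> M * 1"
        unfolding M_def using 0 C(1) by (auto intro!: energy_mono loc_L2_diff W0)
      also have "\<dots> \<le> M * exp (4 * C * t)"
        using 0 C(1) M by (intro mult_left_mono) auto
      finally show ?case by simp
    next
      case (Suc n)
      have "(norm (W (Suc (Suc (Suc n))) t - W (Suc (Suc n)) t))\<^sup>2
         \<le> C * energy (\<lambda>s. W (Suc (Suc n)) s - W (Suc n) s) t"
        using C(2)[OF W0 W0 Suc.prems, of "Suc (Suc n)" "Suc n"] by (simp only: WS)
      also have "energy (\<lambda>s. W (Suc (Suc n)) s - W (Suc n) s) t \<le> integral {0..t} (\<lambda>s. M * exp (4 * C * s) / 4 ^ n)"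
        unfolding energy_def
      proof (rule integral_le)
        show "(\<lambda>s. (norm (W (Suc (Suc n)) s - W (Suc n) s))\<^sup>2) integrable_on {0..t}"
          by (rule loc_L2_square_integrable[OF loc_L2_diff[OF W0 W0] order_refl])
        show "(\<lambda>s. M * exp (4 * C * s) / 4 ^ n) integrable_on {0..t}"
          by (intro integrable_continuous_real continuous_intros) auto
      qed (use Suc in auto)
      \<comment> \<open>Integrating the weight produces \<open>1 / (4 C)\<close>; times the constant
        \<open>C\<close> of the hypothesis this is the gain of \<open>1 / 4\<close> per
        iteration.\<close>
      also have "integral {0..t} (\<lambda>s. M * exp (4 * C * s) / 4 ^ n)
          = M * exp (4 * C * t) / (4 ^ n * (4 * C)) - M * exp (4 * C * 0) / (4 ^ n * (4 * C))"
        by (rule integral_unique, rule fundamental_theorem_of_calculus)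
          (use Suc.prems C(1) in \<open>auto intro!: derivative_eq_intros
            simp: has_real_derivative_iff_has_vector_derivative[symmetric] field_simps\<close>)
      also have "\<dots> \<le> M * exp (4 * C * t) / (4 ^ n * (4 * C))"
        using M C(1) by simp
      finally show ?case using C(1) by (simp add: field_simps)
    qed
    show ?thesis
    proof (intro exI[of _ "sqrt (M * exp (4 * C * T))"] conjI allI ballI)
      show "0 \<le> sqrt (M * exp (4 * C * T))" using M by simp
      fix n t assume t: "t \<in> {0..T}"
      have "(norm (W (Suc (Suc n)) t - W (Suc n) t))\<^sup>2 \<le> M * exp (4 * C * t) / 4 ^ n" by (rule ind[OF t])
      also have "\<dots> \<le> M * exp (4 * C * T) / 4 ^ n"
        using t M C(1) by (intro divide_right_mono mult_left_mono) auto
      also have "\<dots> = (sqrt (M * exp (4 * C * T)) * (1/2) ^ n)\<^sup>2"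
        using M by (simp add: power_mult_distrib power_divide power2_eq_square flip: power_mult_distrib)
      finally show "norm (W (Suc (Suc n)) t - W (Suc n) t) \<le> sqrt (M * exp (4 * C * T)) * (1/2) ^ n"
        by (rule power2_le_imp_le) (use M in auto)
    qed
  qed
  have tail: "\<exists>K\<ge>0. \<forall>n m. \<forall>t\<in>{0..T}. norm (W (Suc (n + m)) t - W (Suc n) t) \<le> K * (1/2) ^ n"
    if T: "0 \<le> T" for T
  proof -
    obtain K where K: "K \<ge> 0" "\<And>n t. t \<in> {0..T} \<Longrightarrow> norm (W (Suc (Suc n)) t - W (Suc n) t) \<le> K * (1/2) ^ n"
      using key[OF T] by blast
    have "norm (W (Suc (n + m)) t - W (Suc n) t) \<le> 2 * K * (1/2) ^ n - 2 * K * (1/2) ^ (n + m)"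
      if t: "t \<in> {0..T}" for n m t
    proof (induction m)
      case (Suc m)
      have "norm (W (Suc (n + Suc m)) t - W (Suc n) t)
        \<le> norm (W (Suc (Suc (n + m))) t - W (Suc (n + m)) t) + norm (W (Suc (n + m)) t - W (Suc n) t)"
        using norm_triangle_ineq[of "W (Suc (Suc (n + m))) t - W (Suc (n + m)) t" "W (Suc (n + m)) t - W (Suc n) t"]
        by simp
      also have "\<dots> \<le> K * (1/2) ^ (n + m) + (2 * K * (1/2) ^ n - 2 * K * (1/2) ^ (n + m))"
        by (intro add_mono K(2) Suc t)
      finally show ?case by simp
    qed simp
    moreover have "2 * K * (1/2) ^ n - 2 * K * (1/2) ^ (n + m) \<le> (2 * K) * (1/2) ^ n" for n m
      using K(1) by simp
    ultimately have "norm (W (Suc (n + m)) t - W (Suc n) t) \<le> (2 * K) * (1/2) ^ n" if "t \<in> {0..T}" for n m t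
      using that order_trans by blast
    then show ?thesis using K(1) by (intro exI[of _ "2 * K"]) auto
  qed
  have conv: "convergent (\<lambda>n. W n t)" if t: "0 \<le> t" for t
  proof -
    obtain K where K': "\<forall>n m. \<forall>s\<in>{0..t}. norm (W (Suc (n + m)) s - W (Suc n) s) \<le> K * (1/2) ^ n"
      using tail[OF t] by blast
    have K: "norm (W (Suc (n + m)) t - W (Suc n) t) \<le> K * (1/2) ^ n" for n m
      using K' t by simp
    have "(\<lambda>n. K * (1/2) ^ n) \<longlonglongrightarrow> 0"
      by (intro tendsto_mult_right_zero LIMSEQ_realpow_zero) auto
    then have small: "\<forall>\<^sub>F n in sequentially. K * (1/2) ^ n < e" if "e > 0" for e
      using order_tendstoD(2) that by blast
    have "Cauchy (\<lambda>n. W (Suc n) t)"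
      unfolding Cauchy_altdef2
    proof safe
      fix e :: real assume "e > 0"
      then obtain N where N: "K * (1/2) ^ N < e"
        using small[of e] by (auto simp: eventually_sequentially)
      have "dist (W (Suc n) t) (W (Suc N) t) < e" if "n \<ge> N" for n
        using K[of N "n - N"] N that by (simp add: dist_norm)
      then show "\<exists>N. \<forall>n\<ge>N. dist (W (Suc n) t) (W (Suc N) t) < e" by blast
    qed
    then have "convergent (\<lambda>n. W (Suc n) t)" by (simp add: Cauchy_convergent_iff)
    then show ?thesis by (subst (asm) convergent_Suc_iff)
  qed
  define w where "w = (\<lambda>t. lim (\<lambda>n. W n t))"
  have lim: "(\<lambda>n. W n t) \<longlonglongrightarrow> w t" if "0 \<le> t" for t
    using conv[OF that] by (simp add: w_def convergent_LIMSEQ_iff)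
  have unif: "\<exists>K\<ge>0. \<forall>n. \<forall>t\<in>{0..T}. norm (w t - W (Suc n) t) \<le> K * (1/2) ^ n" if T: "0 \<le> T" for T
  proof -
    obtain K where K: "K \<ge> 0" "\<And>n m t. t \<in> {0..T} \<Longrightarrow> norm (W (Suc (n + m)) t - W (Suc n) t) \<le> K * (1/2) ^ n"
      using tail[OF T] by blast
    have "norm (w t - W (Suc n) t) \<le> K * (1/2) ^ n" if t: "t \<in> {0..T}" for n t
    proof (rule LIMSEQ_le_const2)
      have "(\<lambda>m. W (m + Suc n) t) \<longlonglongrightarrow> w t" using lim t by (intro LIMSEQ_ignore_initial_segment) auto
      then show "(\<lambda>m. norm (W (Suc (n + m)) t - W (Suc n) t)) \<longlonglongrightarrow> norm (w t - W (Suc n) t)"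
        by (intro tendsto_norm tendsto_diff tendsto_const) (simp add: add.commute)
    qed (use K(2)[OF t] in auto)
    then show ?thesis using K(1) by blast
  qed
  have wl: "w \<in> loc_L2"
  proof (rule loc_L2_I)
    show "w \<in> borel_measurable halfline"
      by (rule borel_measurable_LIMSEQ_metric[of W]) (use lim loc_L2_measurable[OF W0] in auto)
    fix T :: real assume "0 \<le> T"
    then obtain K where K: "\<And>t. t \<in> {0..T} \<Longrightarrow> norm (w t - W (Suc 0) t) \<le> K * (1/2) ^ 0"
      using unif by blast
    have "(norm (w t))\<^sup>2 \<le> 2 * K\<^sup>2 + 2 * (norm (W (Suc 0) t))\<^sup>2" if "t \<in> {0..T}" for t
      using norm_add_square_le[of "w t - W (Suc 0) t" "W (Suc 0) t"] power_mono[OF K[OF that] norm_ge_zero, of 2]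
      by simp
    then show "\<exists>g. g integrable_on {0..T} \<and> (\<forall>t\<in>{0..T}. (norm (w t))\<^sup>2 \<le> g t)"
      by (intro exI[of _ "\<lambda>t. 2 * K\<^sup>2 + 2 * (norm (W (Suc 0) t))\<^sup>2"])
        (auto intro!: integrable_add integrable_on_mult_right loc_L2_square_integrable W0)
  qed
  have "w t = \<Phi> w t" if t: "0 \<le> t" for t
  proof -
    obtain K where K: "K \<ge> 0" "\<And>n s. s \<in> {0..t} \<Longrightarrow> norm (w s - W (Suc n) s) \<le> K * (1/2) ^ n"
      using unif[OF t] by blast
    obtain C where C: "C > 0" "\<And>w w' s. w \<in> loc_L2 \<Longrightarrow> w' \<in> loc_L2 \<Longrightarrow> s \<in> {0..t} \<Longrightarrow>
      (norm (\<Phi> w s - \<Phi> w' s))\<^sup>2 \<le> C * energy (\<lambda>r. w r - w' r) s"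
      using lip[OF t] by blast
    \<comment> \<open>Compares \<open>\<Phi> w\<close> with the next iterate
      \<open>\<Phi> (W (Suc n))\<close>; the uniform bound on \<open>w - W (Suc n)\<close> makes the
      difference vanish in the limit.\<close>
    have b: "(norm (\<Phi> w t - W (Suc (Suc n)) t))\<^sup>2 \<le> C * (t * (K * (1/2) ^ n)\<^sup>2)" for n
    proof -
      have "(norm (\<Phi> w t - W (Suc (Suc n)) t))\<^sup>2 \<le> C * energy (\<lambda>r. w r - W (Suc n) r) t"
        using C(2)[OF wl W0[of "Suc n"], of t] t by (simp only: WS) simp
      also have "energy (\<lambda>r. w r - W (Suc n) r) t \<le> integral {0..t} (\<lambda>r. (K * (1/2) ^ n)\<^sup>2)"
        unfolding energy_def
        by (intro integral_le loc_L2_square_integrable loc_L2_diff wl W0 power_mono K(2)) auto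
      finally show ?thesis using C(1) t by simp
    qed
    have "(\<lambda>n. C * (t * (K * (1/2) ^ n)\<^sup>2)) \<longlonglongrightarrow> C * (t * (K * 0)\<^sup>2)"
      by (intro tendsto_intros LIMSEQ_realpow_zero) auto
    moreover have "(\<lambda>n. (norm (\<Phi> w t - W (n + 2) t))\<^sup>2) \<longlonglongrightarrow> (norm (\<Phi> w t - w t))\<^sup>2"
      by (intro tendsto_intros LIMSEQ_ignore_initial_segment lim t)
    ultimately have "(norm (\<Phi> w t - w t))\<^sup>2 \<le> C * (t * (K * 0)\<^sup>2)"
      by (intro LIMSEQ_le[where Y = "\<lambda>n. C * (t * (K * (1/2) ^ n)\<^sup>2)"]) (use b in auto)
    then show ?thesis by simp
  qed
  with wl show ?thesis by (rule that)
qed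


section \<open>Square integrability and the real Laplace transform\<close>

definition sq_integrable :: "(real \<Rightarrow> 'a::euclidean_space) set" where
  "sq_integrable = {f. f \<in> borel_measurable halfline \<and> integrable halfline (\<lambda>t. (norm (f t))\<^sup>2)}"

lemma L2_eq_sq_integrable: "L2 = sq_integrable"
  by (simp add: L2_def sq_integrable_def)

lemma truncated_halfline_integral:
  fixes h :: "real \<Rightarrow> 'a::euclidean_space"
  assumes "integrable halfline h"
  shows "integrable halfline (\<lambda>t. indicator {..T} t *\<^sub>R h t)"
    and "(LINT t|halfline. indicator {..T} t *\<^sub>R h t) = integral {0..T} h"
proof -
  show i: "integrable halfline (\<lambda>t. indicator {..T} t *\<^sub>R h t)"
  proof (rule Bochner_Integration.integrable_bound[OF assms])
    have [measurable]: "h \<in> borel_measurable halfline" using assms by auto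
    have [measurable]: "(\<lambda>t. indicat_real {..T} t) \<in> borel_measurable halfline"
      by (intro measurable_restrict_space1 measurable_completion) auto
    show "(\<lambda>t. indicator {..T} t *\<^sub>R h t) \<in> borel_measurable halfline" by measurable
  qed (auto simp: indicator_def)
  have "(LINT t|halfline. indicator {..T} t *\<^sub>R h t) = integral {0..} (\<lambda>t. indicator {..T} t *\<^sub>R h t)"
    by (rule lebesgue_integral_eq_integral[OF i]) simp
  also have "\<dots> = integral {0..} (\<lambda>t. if t \<in> {..T} then h t else 0)"
    by (rule integral_cong) (auto simp: indicator_def)
  also have "\<dots> = integral ({..T} \<inter> {0..}) h"
    by (rule integral_restrict_Int)
  also have "{..T} \<inter> {0..} = {0..T}" by auto
  finally show "(LINT t|halfline. indicator {..T} t *\<^sub>R h t) = integral {0..T} h" .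
qed

lemma halfline_integral_limit:
  fixes h :: "real \<Rightarrow> 'a::euclidean_space"
  assumes "integrable halfline h"
  shows "(\<lambda>n. integral {0..real n} h) \<longlonglongrightarrow> (LINT t|halfline. h t)"
proof -
  have "(\<lambda>n. LINT t|halfline. indicator {..real n} t *\<^sub>R h t) \<longlonglongrightarrow> (LINT t|halfline. h t)"
  proof (rule integral_dominated_convergence[where w = "\<lambda>t. norm (h t)"])
    show "AE t in halfline. (\<lambda>n. indicator {..real n} t *\<^sub>R h t) \<longlonglongrightarrow> h t"
    proof (rule AE_I2)
      fix t :: real
      have "\<forall>\<^sub>F n in sequentially. t \<le> real n"
        using filterlim_real_sequentially by (simp add: filterlim_at_top)
      then have "\<forall>\<^sub>F n in sequentially. indicator {..real n} t *\<^sub>R h t = h t"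
        by (rule eventually_mono) auto
      then show "(\<lambda>n. indicator {..real n} t *\<^sub>R h t) \<longlonglongrightarrow> h t" by (rule tendsto_eventually)
    qed
    show "(\<lambda>t. indicator {..real n} t *\<^sub>R h t) \<in> borel_measurable halfline" for n
      using truncated_halfline_integral(1)[OF assms] by auto
  qed (use assms in \<open>auto simp: indicator_def\<close>)
  then show ?thesis by (simp add: truncated_halfline_integral(2)[OF assms])
qed

lemma sq_integrable_loc_L2:
  assumes "f \<in> sq_integrable"
  shows "f \<in> loc_L2" and "energy f T \<le> (LINT t|halfline. (norm (f t))\<^sup>2)"
proof -
  have m: "f \<in> borel_measurable halfline" and i: "integrable halfline (\<lambda>t. (norm (f t))\<^sup>2)"
    using assms by (auto simp: sq_integrable_def)
  have h: "(\<lambda>t. (norm (f t))\<^sup>2) integrable_on {0..}"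
    by (rule integrable_on_lebesgue_on[OF i]) simp
  have "(\<lambda>t. (norm (f t))\<^sup>2) integrable_on {0..T}" for T
    by (rule integrable_on_subinterval[OF h]) auto
  then show f: "f \<in> loc_L2" using m by (simp add: loc_L2_def)
  have "energy f T \<le> integral {0..} (\<lambda>t. (norm (f t))\<^sup>2)"
    unfolding energy_def by (intro integral_subset_le h loc_L2_square_integrable f) auto
  then show "energy f T \<le> (LINT t|halfline. (norm (f t))\<^sup>2)"
    by (simp add: lebesgue_integral_eq_integral[OF i])
qed

text \<open>Monotone convergence along integer horizons: the way in which an energy bound uniform in
  \<open>T\<close> becomes a statement about \<open>L2\<close> and its norm.\<close>

lemma sq_integrable_I:
  assumes f: "f \<in> loc_L2" and B: "\<And>T. 0 \<le> T \<Longrightarrow> energy f T \<le> B"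
  shows "f \<in> sq_integrable" and "(LINT t|halfline. (norm (f t))\<^sup>2) \<le> B"
proof -
  let ?g = "\<lambda>t. (norm (f t))\<^sup>2"
  have [measurable]: "f \<in> borel_measurable halfline" by (rule loc_L2_measurable[OF f])
  have g: "integrable halfline (\<lambda>t. indicator {..T} t *\<^sub>R ?g t)"
    and gi: "(LINT t|halfline. indicator {..T} t *\<^sub>R ?g t) = energy f T" for T
  proof -
    have "?g absolutely_integrable_on {0..T}"
      by (intro nonnegative_absolutely_integrable_1 loc_L2_square_integrable f) auto
    moreover have "indicat_real {0..T} x = indicat_real {0..} x * indicator {..T} x" for x
      by (auto simp: indicator_def)
    ultimately show i: "integrable halfline (\<lambda>t. indicator {..T} t *\<^sub>R ?g t)"
      by (simp add: integrable_restrict_space set_integrable_def mult.assoc)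
    have "(LINT t|halfline. indicator {..T} t *\<^sub>R ?g t) = integral {0..T} (\<lambda>t. indicator {..T} t *\<^sub>R ?g t)"
    proof -
      have "(\<lambda>t. indicator {..T} t *\<^sub>R (indicator {..T} t *\<^sub>R ?g t)) = (\<lambda>t. indicator {..T} t *\<^sub>R ?g t)"
        by (auto simp: indicator_def)
      then show ?thesis using truncated_halfline_integral(2)[OF i, of T] by simp
    qed
    also have "\<dots> = energy f T"
      unfolding energy_def by (rule integral_cong) auto
    finally show "(LINT t|halfline. indicator {..T} t *\<^sub>R ?g t) = energy f T" .
  qed
  have mono: "mono (\<lambda>n. energy f (real n))"
    by (rule monoI) (simp add: energy_mono[OF f])
  have "bdd_above (range (\<lambda>n. energy f (real n)))" using B by (intro bdd_aboveI2[where M = B]) auto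
  then obtain L where L: "(\<lambda>n. energy f (real n)) \<longlonglongrightarrow> L"
    using LIMSEQ_incseq_SUP[OF _ mono] by blast
  have LB: "L \<le> B" by (rule LIMSEQ_le_const2[OF L]) (use B in auto)
  have *: "integrable halfline ?g" "integral\<^sup>L halfline ?g = L"
  proof (rule_tac [!] integral_monotone_convergence_nonneg[where f = "\<lambda>n t. indicator {..real n} t *\<^sub>R ?g t"])
    have lim: "(\<lambda>n. indicator {..real n} t *\<^sub>R ?g t) \<longlonglongrightarrow> ?g t" for t
    proof (rule tendsto_eventually)
      have "\<forall>\<^sub>F n in sequentially. t \<le> real n"
        using filterlim_real_sequentially by (simp add: filterlim_at_top)
      then show "\<forall>\<^sub>F n in sequentially. indicator {..real n} t *\<^sub>R ?g t = ?g t"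
        by (rule eventually_mono) auto
    qed
    then show "AE t in halfline. (\<lambda>n. indicator {..real n} t *\<^sub>R ?g t) \<longlonglongrightarrow> ?g t"
      and "AE t in halfline. (\<lambda>n. indicator {..real n} t *\<^sub>R ?g t) \<longlonglongrightarrow> ?g t" by auto
    show "AE t in halfline. mono (\<lambda>n. indicator {..real n} t *\<^sub>R ?g t)"
      and "AE t in halfline. mono (\<lambda>n. indicator {..real n} t *\<^sub>R ?g t)"
      by (auto simp: mono_def indicator_def)
  qed (use g gi L in auto)
  show "f \<in> sq_integrable" using *(1) by (simp add: sq_integrable_def)
  show "(LINT t|halfline. ?g t) \<le> B" using *(2) LB by simp
qed

section \<open>The Laplace transform on the real axis\<close>

text \<open>Restricted to real arguments, which suffice for injectivity. The transform of a real
  state vector then remains a real vector, and it commutes with real linear maps.\<close>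

definition lap :: "(real \<Rightarrow> 'a::euclidean_space) \<Rightarrow> real \<Rightarrow> 'a" where
  "lap f s = (LINT t|halfline. exp (- s * t) *\<^sub>R f t)"

lemma laplace_integrand_of_real:
  "laplace_integrand f (of_real s) = (\<lambda>t. complex_of_real (exp (- s * t) *\<^sub>R f t))"
  by (rule ext) (simp add: laplace_integrand_def exp_of_real[symmetric])

lemma laplace_of_real_integrable:
  "integrable halfline (laplace_integrand f (of_real s)) \<Longrightarrow> integrable halfline (\<lambda>t. exp (- s * t) *\<^sub>R f t)"
  unfolding laplace_integrand_of_real by (subst (asm) complex_of_real_integrable_eq)

lemma laplace_eq_lap: "laplace f (of_real s) = of_real (lap f s)"
  unfolding laplace_def lap_def laplace_integrand_of_real by (rule integral_complex_of_real)
lemma exp_measurable_halfline [measurable]: "(\<lambda>t. exp (s * t) :: real) \<in> borel_measurable halfline"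
  by (intro continuous_halfline_measurable continuous_intros)

lemma sq_integrable_exp_integrable:
  assumes f: "f \<in> sq_integrable" and s: "s > 0"
  shows "integrable halfline (\<lambda>t. exp (- s * t) *\<^sub>R f t)"
proof (rule Bochner_Integration.integrable_bound)
  have [measurable]: "f \<in> borel_measurable halfline" and i: "integrable halfline (\<lambda>t. (norm (f t))\<^sup>2)"
    using f by (auto simp: sq_integrable_def)
  show "(\<lambda>t. exp (- s * t) *\<^sub>R f t) \<in> borel_measurable halfline" by measurable
  have "(\<lambda>t. exp (- (2 * s) * t)) absolutely_integrable_on {0..}"
    using s by (intro nonnegative_absolutely_integrable_1 integrable_on_exp_minus_to_infinity) auto
  then have "integrable halfline (\<lambda>t. exp (- (2 * s) * t))"
    by (rule absolutely_integrable_imp_integrable) simp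
  then show "integrable halfline (\<lambda>t. exp (- (2 * s) * t) + (norm (f t))\<^sup>2)"
    using i by (rule Bochner_Integration.integrable_add)
  show "AE t in halfline. norm (exp (- s * t) *\<^sub>R f t) \<le> norm (exp (- (2 * s) * t) + (norm (f t))\<^sup>2)"
  proof (rule AE_I2)
    fix t
    have e: "exp (- (2 * s) * t) = (exp (- s * t))\<^sup>2" by (simp add: power2_eq_square flip: exp_add)
    have "exp (- s * t) * norm (f t) \<le> (exp (- s * t))\<^sup>2 + (norm (f t))\<^sup>2"
      using sum_squares_bound[of "exp (- s * t)" "norm (f t)"] mult_nonneg_nonneg[of "exp (- s * t)" "norm (f t)"]
      by (simp del: mult_nonneg_nonneg)
    then show "norm (exp (- s * t) *\<^sub>R f t) \<le> norm (exp (- (2 * s) * t) + (norm (f t))\<^sup>2)"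
      unfolding e by simp
  qed
qed

lemma sq_integrable_linear_image:
  fixes f :: "real \<Rightarrow> 'a::euclidean_space" and L :: "'a \<Rightarrow> 'b::euclidean_space"
  assumes f: "f \<in> sq_integrable" and L: "linear L"
  shows "(\<lambda>t. L (f t)) \<in> sq_integrable"
proof -
  obtain K where K: "\<And>x. norm (L x) \<le> K * norm x"
    using linear_bounded[OF L] by blast
  note f' = sq_integrable_loc_L2[OF f]
  show ?thesis
  proof (rule sq_integrable_I(1)[OF loc_L2_linear_image[OF f'(1) L]])
    fix T :: real
    have "energy (\<lambda>t. L (f t)) T \<le> K\<^sup>2 * energy f T" by (rule energy_linear_le[OF f'(1) L K])
    also have "\<dots> \<le> K\<^sup>2 * (LINT t|halfline. (norm (f t))\<^sup>2)" by (intro mult_left_mono f'(2)) auto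
    finally show "energy (\<lambda>t. L (f t)) T \<le> K\<^sup>2 * (LINT t|halfline. (norm (f t))\<^sup>2)" .
  qed
qed

lemma sq_integrable_add:
  fixes f g :: "real \<Rightarrow> 'a::euclidean_space"
  assumes f: "f \<in> sq_integrable" and g: "g \<in> sq_integrable"
  shows "(\<lambda>t. f t + g t) \<in> sq_integrable"
proof -
  note f' = sq_integrable_loc_L2[OF f] and g' = sq_integrable_loc_L2[OF g]
  show ?thesis
  proof (rule sq_integrable_I(1)[OF loc_L2_add[OF f'(1) g'(1)]])
    fix T :: real
    show "energy (\<lambda>t. f t + g t) T \<le> 2 * (LINT t|halfline. (norm (f t))\<^sup>2) + 2 * (LINT t|halfline. (norm (g t))\<^sup>2)"
      using energy_add_le[OF f'(1) g'(1), of T] f'(2)[of T] g'(2)[of T] by linarith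
  qed
qed

lemma lap_linear_image:
  fixes f :: "real \<Rightarrow> 'a::euclidean_space" and L :: "'a \<Rightarrow> 'b::euclidean_space"
  assumes "integrable halfline (\<lambda>t. exp (- s * t) *\<^sub>R f t)" "linear L"
  shows "lap (\<lambda>t. L (f t)) s = L (lap f s)"
proof -
  have bl: "bounded_linear L" using assms(2) by (simp add: linear_conv_bounded_linear)
  show ?thesis
    unfolding lap_def using integral_bounded_linear[OF bl assms(1)]
    by (simp add: linear_cmul[OF assms(2)])
qed

lemma lap_add:
  fixes f g :: "real \<Rightarrow> 'a::euclidean_space"
  assumes "integrable halfline (\<lambda>t. exp (- s * t) *\<^sub>R f t)" "integrable halfline (\<lambda>t. exp (- s * t) *\<^sub>R g t)"
  shows "lap (\<lambda>t. f t + g t) s = lap f s + lap g s"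
  unfolding lap_def using assms by (simp add: scaleR_add_right)

lemma exp_integral_by_parts:
  fixes g :: "real \<Rightarrow> real"
  assumes g: "g \<in> loc_L2" and s: "s \<noteq> 0" and T: "0 \<le> T"
  shows "s * integral {0..T} (\<lambda>t. exp (- s * t) * integral {0..t} g)
     = integral {0..T} (\<lambda>t. exp (- s * t) * g t) - exp (- s * T) * integral {0..T} g"
proof -
  let ?k = "\<lambda>t. exp (- s * t)"
  have ki: "?k absolutely_integrable_on {0..T}"
    by (intro absolutely_integrable_continuous_real continuous_intros)
  have K: "integral {0..t} ?k = (1 - exp (- s * t)) / s" if "0 \<le> t" for t
  proof -
    have "(?k has_integral (- exp (- s * t) / s) - (- exp (- s * 0) / s)) {0..t}"
      using that s by (intro fundamental_theorem_of_calculus)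
        (auto intro!: derivative_eq_intros simp: has_real_derivative_iff_has_vector_derivative[symmetric])
    then show ?thesis using s by (simp add: integral_unique diff_divide_distrib)
  qed
  note P = integral_product_rule_real(1)[OF loc_L2_absolutely_integrable[OF g order_refl] ki]
  have gk: "(\<lambda>t. exp (- s * t) * g t) integrable_on {0..T}"
    using loc_L2_inner_integrable[OF loc_L2_continuous g order_refl, of ?k T]
    by (simp add: continuous_intros)
  have "integral {0..T} (\<lambda>t. g t * integral {0..t} ?k) = integral {0..T} (\<lambda>t. (1 / s) * (g t - exp (- s * t) * g t))"
    using s by (intro integral_cong) (simp only: K atLeastAtMost_iff, simp add: field_simps)
  also have "\<dots> = (1 / s) * (integral {0..T} g - integral {0..T} (\<lambda>t. exp (- s * t) * g t))"
    using gk loc_L2_integrable[OF g order_refl] by (simp only: integral_mult_right integral_diff)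
  finally have "integral {0..T} (\<lambda>t. exp (- s * t) * integral {0..t} g)
     + (1 / s) * (integral {0..T} g - integral {0..T} (\<lambda>t. exp (- s * t) * g t))
     = integral {0..T} g * ((1 - exp (- s * T)) / s)"
    using P K[OF T] by (simp add: mult.commute)
  then show ?thesis using s by (simp add: field_simps)
qed

text \<open>Integration by parts on \<open>[0, n]\<close> leaves the boundary term
  \<open>exp (- s n)\<close> times the integral of \<open>g\<close>. By Cauchy-Schwarz that integral
  grows at most like the square root of \<open>n\<close>, so the term vanishes as \<open>n\<close>
  tends to infinity.\<close>

lemma lap_indefinite_integral_real:
  fixes g :: "real \<Rightarrow> real"
  assumes g: "g \<in> sq_integrable" and x: "x \<in> sq_integrable" and s: "s > 0"
    and xg: "\<And>t. 0 \<le> t \<Longrightarrow> x t = integral {0..t} g"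
  shows "s * lap x s = lap g s"
proof -
  have gl: "g \<in> loc_L2" by (rule sq_integrable_loc_L2(1)[OF g])
  define B where "B = (LINT t|halfline. (norm (g t))\<^sup>2)"
  have B: "B \<ge> 0" unfolding B_def by simp
  have lx: "(\<lambda>n. integral {0..real n} (\<lambda>t. exp (- s * t) * x t)) \<longlonglongrightarrow> lap x s"
    using halfline_integral_limit[OF sq_integrable_exp_integrable[OF x s]] by (simp add: lap_def)
  have lg: "(\<lambda>n. integral {0..real n} (\<lambda>t. exp (- s * t) * g t)) \<longlonglongrightarrow> lap g s"
    using halfline_integral_limit[OF sq_integrable_exp_integrable[OF g s]] by (simp add: lap_def)
  have "(\<lambda>n. exp (- s * real n) * integral {0..real n} g) \<longlonglongrightarrow> 0"
  proof (rule tendsto_0_le[where K = 1])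
    have e: "exp (- s * real n) = exp (- s) ^ n" for n
      by (metis exp_of_nat_mult mult.commute)
    have "(\<lambda>n. exp (- s) ^ n + B * (real n * exp (- s) ^ n)) \<longlonglongrightarrow> 0 + B * 0"
      using s by (intro tendsto_intros LIMSEQ_realpow_zero powser_times_n_limit_0) auto
    then show "(\<lambda>n. exp (- s * real n) * (1 + real n * B)) \<longlonglongrightarrow> 0"
      unfolding e by (simp add: algebra_simps)
    show "\<forall>\<^sub>F n in sequentially. norm (exp (- s * real n) * integral {0..real n} g)
        \<le> norm (exp (- s * real n) * (1 + real n * B)) * 1"
    proof (intro always_eventually allI)
      fix n
      have "(norm (integral {0..real n} g))\<^sup>2 \<le> real n * B"
        using integral_square_le[OF gl order_refl, of "real n"]
          mult_left_mono[OF sq_integrable_loc_L2(2)[OF g, of "real n"], of "real n"]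
        unfolding energy_def B_def[symmetric] by simp
      \<comment> \<open>Replaces the square root of \<open>real n * B\<close> by the cruder
        \<open>1 + real n * B\<close>, which keeps the majorant polynomial in
        \<open>n\<close>.\<close>
      also have "\<dots> \<le> (1 + real n * B)\<^sup>2"
        using B by (auto simp: power2_sum intro!: add_nonneg_nonneg)
      finally have "norm (integral {0..real n} g) \<le> 1 + real n * B"
        by (rule power2_le_imp_le) (use B in auto)
      then show "norm (exp (- s * real n) * integral {0..real n} g)
        \<le> norm (exp (- s * real n) * (1 + real n * B)) * 1"
        using B by (simp add: abs_mult)
    qed
  qed
  then have "(\<lambda>n. integral {0..real n} (\<lambda>t. exp (- s * t) * g t) - exp (- s * real n) * integral {0..real n} g)
     \<longlonglongrightarrow> lap g s - 0" by (intro tendsto_diff lg)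
  moreover have "s * integral {0..real n} (\<lambda>t. exp (- s * t) * x t)
     = integral {0..real n} (\<lambda>t. exp (- s * t) * g t) - exp (- s * real n) * integral {0..real n} g" for n
  proof -
    have "integral {0..real n} (\<lambda>t. exp (- s * t) * x t)
      = integral {0..real n} (\<lambda>t. exp (- s * t) * integral {0..t} g)"
      by (rule integral_cong) (simp add: xg)
    moreover have "s * integral {0..real n} (\<lambda>t. exp (- s * t) * integral {0..t} g)
      = integral {0..real n} (\<lambda>t. exp (- s * t) * g t) - exp (- s * real n) * integral {0..real n} g"
      by (rule exp_integral_by_parts[OF gl]) (use s in auto)
    ultimately show ?thesis by (simp only:)
  qed
  ultimately have "(\<lambda>n. s * integral {0..real n} (\<lambda>t. exp (- s * t) * x t)) \<longlonglongrightarrow> lap g s" by simp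
  then show ?thesis
    using LIMSEQ_unique tendsto_mult_left[OF lx, of s] by blast
qed

lemma lap_indefinite_integral:
  fixes g :: "real \<Rightarrow> 'a::euclidean_space"
  assumes g: "g \<in> sq_integrable" and x: "x \<in> sq_integrable" and s: "s > 0"
    and xg: "\<And>t. 0 \<le> t \<Longrightarrow> x t = integral {0..t} g"
  shows "s *\<^sub>R lap x s = lap g s"
proof (rule euclidean_eqI)
  fix i :: 'a assume "i \<in> Basis"
  have lin: "linear (\<lambda>y. y \<bullet> i)" by (rule bounded_linear.linear[OF bounded_linear_inner_left])
  have "s * lap (\<lambda>t. x t \<bullet> i) s = lap (\<lambda>t. g t \<bullet> i) s"
    using g x s xg integral_inner_const[OF loc_L2_integrable[OF sq_integrable_loc_L2(1)[OF g] order_refl], of _ i]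
    by (intro lap_indefinite_integral_real sq_integrable_linear_image[OF _ lin]) auto
  then show "(s *\<^sub>R lap x s) \<bullet> i = lap g s \<bullet> i"
    using lap_linear_image[OF sq_integrable_exp_integrable[OF x s] lin]
      lap_linear_image[OF sq_integrable_exp_integrable[OF g s] lin] by simp
qed

section \<open>Uniqueness of weak derivatives and of Laplace transforms\<close>

text \<open>Lebesgue's differentiation theorem: almost every value of \<open>h\<close> is a limit of
  its means over short intervals, and all these means vanish. The function is extended by zero
  because the theorem is applied on the whole line.\<close>

lemma AE_zero_if_indefinite_integral_zero:
  fixes h :: "real \<Rightarrow> 'a::euclidean_space"
  assumes int: "\<And>b. h integrable_on {0..b}" and zero: "\<And>b. 0 \<le> b \<Longrightarrow> integral {0..b} h = 0"
  shows "AE t in halfline. h t = 0"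
proof -
  let ?h = "\<lambda>t. if t \<in> {0..} then h t else 0"
  have "?h integrable_on cbox a b" for a b
  proof -
    have "h integrable_on {max 0 a..b}" by (rule integrable_on_subinterval[OF int[of b]]) auto
    moreover have "{0..} \<inter> {a..b} = {max 0 a..b}" by auto
    ultimately show ?thesis by (simp only: integrable_restrict_Int cbox_interval)
  qed
  then obtain N where N: "negligible N"
    "\<And>x e. x \<notin> N \<Longrightarrow> 0 < e \<Longrightarrow> \<exists>d>0. \<forall>r. 0 < r \<and> r < d \<longrightarrow>
       norm (integral (cbox x (x + r *\<^sub>R One)) ?h /\<^sub>R r ^ DIM(real) - ?h x) < e"
    using integrable_ccontinuous_explicit[of ?h] by blast
  have "h t = 0" if t: "0 \<le> t" "t \<notin> N" for t
  proof (rule ccontr)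
    assume "h t \<noteq> 0"
    then obtain d where d: "d > 0" "\<And>r. 0 < r \<Longrightarrow> r < d \<Longrightarrow>
        norm (integral (cbox t (t + r *\<^sub>R One)) ?h /\<^sub>R r ^ DIM(real) - ?h t) < norm (h t)"
      using N(2)[OF t(2), of "norm (h t)"] by auto
    define r where "r = d / 2"
    have r: "0 < r" "r < d" using d(1) by (auto simp: r_def)
    have "integral {0..t} h + integral {t..t + r} h = integral {0..t + r} h"
      using t r by (intro Henstock_Kurzweil_Integration.integral_combine int) auto
    then have "integral {t..t + r} h = 0" using zero t r by simp
    moreover have "integral {t..t + r} ?h = integral {t..t + r} h"
      using t by (intro integral_cong) auto
    ultimately show False using d(2)[OF r] t by simp
  qed
  then have "{t. 0 \<le> t \<and> h t \<noteq> 0} \<subseteq> N" by blast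
  then show ?thesis unfolding AE_halfline_iff using N(1) negligible_subset by blast
qed

text \<open>Both antiderivatives are continuous, so equality almost everywhere is equality
  everywhere; time zero identifies the constants. Hence the choice made in \<open>diff_sys\<close>
  is determined up to \<open>sig_eq\<close>.\<close>

lemma weak_derivative_unique:
  fixes g g' :: "real \<Rightarrow> real"
  assumes g: "g \<in> loc_L2" and g': "g' \<in> loc_L2"
    and ae: "AE t in halfline. c + integral {0..t} g = c' + integral {0..t} g'"
  shows "AE t in halfline. g t = g' t"
proof -
  let ?f = "\<lambda>t. c + integral {0..t} g" and ?f' = "\<lambda>t. c' + integral {0..t} g'"
  have cont: "continuous_on {0..} ?f" "continuous_on {0..} ?f'"
    by (intro continuous_intros indefinite_integral_continuous_halfline g g')+
  have rc: "right_continuous k" if "continuous_on {0..} k" for k :: "real \<Rightarrow> real"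
    unfolding right_continuous_def
  proof (intro allI impI)
    fix t :: real assume "0 \<le> t"
    then have "continuous (at t within {0..}) k" using that by (simp add: continuous_on_eq_continuous_within)
    then show "continuous (at_right t) k" by (rule continuous_within_subset) (use \<open>0 \<le> t\<close> in auto)
  qed
  have eq: "?f t = ?f' t" if "0 \<le> t" for t
    using right_continuous_eq[OF rc[OF cont(1)] rc[OF cont(2)] _ that] ae by (simp add: sig_eq_def)
  have cc: "c = c'" using eq[of 0] by simp
  have "AE t in halfline. g t - g' t = 0"
  proof (rule AE_zero_if_indefinite_integral_zero)
    show "(\<lambda>t. g t - g' t) integrable_on {0..b}" for b
      by (intro loc_L2_integrable loc_L2_diff g g' order_refl)
    fix b :: real assume "0 \<le> b"
    then show "integral {0..b} (\<lambda>t. g t - g' t) = 0"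
      using eq[of b] cc loc_L2_integrable[OF g order_refl] loc_L2_integrable[OF g' order_refl]
      by (simp add: integral_diff)
  qed
  then show ?thesis by simp
qed


text \<open>The polynomials \<open>(1 - e\<^sup>-\<^sup>n\<^sup>t)\<^sup>m\<close> in \<open>e\<^sup>-\<^sup>t\<close> with \<open>m = \<lfloor>e\<^sup>b\<^sup>n\<rfloor>\<close> converge to the indicator of
  \<open>t > b\<close>, so a vanishing transform forces all tail integrals to vanish.\<close>

lemma one_minus_exp_power_limit:
  fixes t b :: real
  assumes t: "0 \<le> t" "t \<noteq> b" and b: "0 \<le> b"
  shows "(\<lambda>n. (1 - exp (- (real n * t))) ^ nat \<lfloor>exp (b * real n)\<rfloor>) \<longlonglongrightarrow> (if b < t then 1 else 0)"
proof -
  define m where "m = (\<lambda>n. nat \<lfloor>exp (b * real n)\<rfloor>)"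
  have m: "real (m n) \<le> exp (b * real n)" "exp (b * real n) - 1 \<le> real (m n)" for n
    unfolding m_def by (auto simp: of_nat_nat; linarith)+
  have y01: "0 \<le> 1 - exp (- (real n * t))" "1 - exp (- (real n * t)) \<le> 1" for n
    using t by auto
  show ?thesis
  proof (cases "b < t")
    case True
    have lim: "(\<lambda>n. 1 - exp (- (t - b)) ^ n) \<longlonglongrightarrow> 1 - 0"
      using True by (intro tendsto_diff tendsto_const LIMSEQ_realpow_zero) auto
    \<comment> \<open>Bernoulli's inequality; \<open>m n * exp (- (n t))\<close> is at most
      \<open>exp (- (t - b)) ^ n\<close>.\<close>
    have lo: "1 - exp (- (t - b)) ^ n \<le> (1 - exp (- (real n * t))) ^ m n" for n
    proof -
      have "exp (- (t - b)) ^ n = exp (b * real n) * exp (- (real n * t))"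
        unfolding exp_of_nat_mult[symmetric] exp_add[symmetric] by (simp add: algebra_simps)
      then have "real (m n) * exp (- (real n * t)) \<le> exp (- (t - b)) ^ n"
        using m(1)[of n] by simp
      moreover have "1 + real (m n) * (- exp (- (real n * t))) \<le> (1 + - exp (- (real n * t))) ^ m n"
        by (rule Bernoulli_inequality) (use t in auto)
      ultimately show ?thesis by simp
    qed
    have up: "(1 - exp (- (real n * t))) ^ m n \<le> 1" for n
      using y01[of n] by (intro power_le_one)
    have "(\<lambda>n. (1 - exp (- (real n * t))) ^ m n) \<longlonglongrightarrow> 1"
      by (rule tendsto_sandwich[OF _ _ lim[unfolded diff_zero] tendsto_const])
        (use lo up in \<open>auto intro: always_eventually\<close>)
    then show ?thesis using True by (simp add: m_def)
  next
    case False
    then have tb: "t < b" using t by simp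
    have lim: "(\<lambda>n. exp 1 * exp (- (b - t)) ^ n) \<longlonglongrightarrow> exp 1 * 0"
      using tb by (intro tendsto_mult tendsto_const LIMSEQ_realpow_zero) auto
    have lo: "0 \<le> (1 - exp (- (real n * t))) ^ m n" for n using y01[of n] by simp
    \<comment> \<open>Here \<open>1 - y \<le> exp (- y)\<close> with
      \<open>y = exp (- (n t))\<close>, and \<open>m n * y\<close> is at least
      \<open>(b - t) * n\<close>, which yields geometric decay.\<close>
    have up: "(1 - exp (- (real n * t))) ^ m n \<le> exp 1 * exp (- (b - t)) ^ n" for n
    proof -
      let ?y = "exp (- (real n * t))"
      have "(1 - ?y) ^ m n \<le> exp (- ?y) ^ m n"
        using y01[of n] exp_ge_add_one_self[of "- ?y"] by (intro power_mono) auto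
      also have "\<dots> = exp (real (m n) * (- ?y))" by (rule exp_of_nat_mult[symmetric])
      also have "\<dots> \<le> exp (1 + real n * (- (b - t)))"
      proof -
        have "(exp (b * real n) - 1) * ?y \<le> real (m n) * ?y"
          using m(2)[of n] by (intro mult_right_mono) auto
        moreover have "(exp (b * real n) - 1) * ?y = exp ((b - t) * real n) - ?y"
          unfolding left_diff_distrib exp_add[symmetric] by (simp add: algebra_simps)
        moreover have "?y \<le> 1" using t by simp
        moreover have "1 + (b - t) * real n \<le> exp ((b - t) * real n)" by (rule exp_ge_add_one_self)
        moreover have "real (m n) * (- ?y) = - (real (m n) * ?y)"
          "real n * (- (b - t)) = - ((b - t) * real n)" by (simp_all add: algebra_simps)
        ultimately have "real (m n) * (- ?y) \<le> 1 + real n * (- (b - t))" by linarith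
        then show ?thesis by (simp only: exp_le_cancel_iff)
      qed
      also have "\<dots> = exp 1 * exp (- (b - t)) ^ n"
        unfolding exp_of_nat_mult[symmetric] exp_add ..
      finally show ?thesis .
    qed
    have "(\<lambda>n. (1 - exp (- (real n * t))) ^ m n) \<longlonglongrightarrow> 0"
      by (rule tendsto_sandwich[OF _ _ tendsto_const lim[unfolded mult_zero_right]])
        (use lo up in \<open>auto intro: always_eventually\<close>)
    then show ?thesis using False by (simp add: m_def)
  qed
qed

text \<open>Only the arguments \<open>\<sigma> + 1 + j\<close> with natural \<open>j\<close> enter:
  they say that \<open>k\<close> integrates to zero against every polynomial in
  \<open>exp (- t)\<close>. Dominated convergence, with majorant \<open>norm (k t)\<close>, passes
  to indicators of tails, and differentiation of the vanishing integrals gives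
  \<open>k = 0\<close>.\<close>

lemma laplace_injective_real:
  fixes f :: "real \<Rightarrow> real"
  assumes int: "\<And>s. s > \<sigma> \<Longrightarrow> integrable halfline (\<lambda>t. exp (- s * t) *\<^sub>R f t)"
    and zero: "\<And>s. s > \<sigma> \<Longrightarrow> lap f s = 0"
  shows "AE t in halfline. f t = 0"
proof -
  \<comment> \<open>The shift by one beyond \<sigma> makes the argument for \<open>j = 0\<close>
    admissible, so that \<open>k\<close> itself is integrable.\<close>
  define k where "k = (\<lambda>t. exp (- (\<sigma> + 1) * t) *\<^sub>R f t)"
  have kexp: "exp (- (real j * t)) * k t = exp (- (\<sigma> + 1 + real j) * t) *\<^sub>R f t" for j t
  proof -
    have "- (real j * t) + - (\<sigma> + 1) * t = - (\<sigma> + 1 + real j) * t" by (simp add: algebra_simps)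
    then show ?thesis unfolding k_def by (metis exp_add mult.assoc real_scaleR_def)
  qed
  have kj: "integrable halfline (\<lambda>t. exp (- (real j * t)) * k t)"
    "(LINT t|halfline. exp (- (real j * t)) * k t) = 0" for j
    unfolding kexp using int[of "\<sigma> + 1 + real j"] zero[of "\<sigma> + 1 + real j"] by (auto simp: lap_def)
  have ki: "integrable halfline k" using kj(1)[of 0] by simp
  have k0: "(LINT t|halfline. k t) = 0" using kj(2)[of 0] by simp
  have [measurable]: "k \<in> borel_measurable halfline" using ki by auto
  have vanish: "(LINT t|halfline. (1 - exp (- (real n * t))) ^ m * k t) = 0" for n m
  proof -
    have eq: "(1 - exp (- (real n * t))) ^ m * k t
      = (\<Sum>i\<le>m. (real (m choose i) * (- 1) ^ i) * (exp (- (real (n * i) * t)) * k t))" for t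
    proof -
      have "(1 - exp (- (real n * t))) ^ m = (- exp (- (real n * t)) + 1) ^ m" by simp
      also have "\<dots> = (\<Sum>i\<le>m. real (m choose i) * (- exp (- (real n * t))) ^ i * 1 ^ (m - i))"
        by (rule binomial_ring)
      also have "\<dots> = (\<Sum>i\<le>m. (real (m choose i) * (- 1) ^ i) * exp (- (real (n * i) * t)))"
      proof (rule sum.cong[OF refl])
        fix i
        have "(- exp (- (real n * t))) ^ i = (- 1) ^ i * exp (- (real n * t)) ^ i" by (rule power_minus)
        also have "exp (- (real n * t)) ^ i = exp (- (real (n * i) * t))"
          unfolding exp_of_nat_mult[symmetric] by (simp add: algebra_simps)
        finally show "real (m choose i) * (- exp (- (real n * t))) ^ i * 1 ^ (m - i)
          = (real (m choose i) * (- 1) ^ i) * exp (- (real (n * i) * t))" by simp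
      qed
      finally show ?thesis by (simp add: sum_distrib_right mult.assoc)
    qed
    have "(LINT t|halfline. (1 - exp (- (real n * t))) ^ m * k t)
      = (\<Sum>i\<le>m. LINT t|halfline. (real (m choose i) * (- 1) ^ i) * (exp (- (real (n * i) * t)) * k t))"
      unfolding eq
      by (rule Bochner_Integration.integral_sum, rule Bochner_Integration.integrable_mult_right, rule kj(1))
    then show ?thesis by (simp only: integral_mult_right_zero kj(2)) simp
  qed
  have tail: "(LINT t|halfline. (if b < t then 1 else 0) * k t) = 0" if b: "0 \<le> b" for b
  proof -
    have "(\<lambda>n. LINT t|halfline. (1 - exp (- (real n * t))) ^ nat \<lfloor>exp (b * real n)\<rfloor> * k t)
      \<longlonglongrightarrow> (LINT t|halfline. (if b < t then 1 else 0) * k t)"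
    proof (rule integral_dominated_convergence[where w = "\<lambda>t. norm (k t)"])
      have [measurable]: "(\<lambda>t. t) \<in> borel_measurable halfline"
        by (intro measurable_restrict_space1 measurable_completion) auto
      show "(\<lambda>t. (if b < t then 1 else 0) * k t) \<in> borel_measurable halfline" by measurable
      show "(\<lambda>t. (1 - exp (- (real n * t))) ^ nat \<lfloor>exp (b * real n)\<rfloor> * k t) \<in> borel_measurable halfline" for n
        by measurable
      have "AE t in halfline. t \<noteq> b"
        unfolding AE_halfline_iff by (rule negligible_subset[of "{b}"]) auto
      moreover have "AE t in halfline. 0 \<le> t" by (rule AE_I2) (simp add: space_restrict_space)
      ultimately show "AE t in halfline. (\<lambda>n. (1 - exp (- (real n * t))) ^ nat \<lfloor>exp (b * real n)\<rfloor> * k t)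
        \<longlonglongrightarrow> (if b < t then 1 else 0) * k t"
        by eventually_elim (intro tendsto_mult tendsto_const one_minus_exp_power_limit b)
      show "AE t in halfline. norm ((1 - exp (- (real n * t))) ^ nat \<lfloor>exp (b * real n)\<rfloor> * k t) \<le> norm (k t)" for n
      proof (rule AE_I2)
        fix t assume "t \<in> space halfline"
        then have "0 \<le> t" by (simp add: space_restrict_space)
        then have "\<bar>(1 - exp (- (real n * t))) ^ nat \<lfloor>exp (b * real n)\<rfloor>\<bar> \<le> 1"
          unfolding power_abs by (intro power_le_one) auto
        then show "norm ((1 - exp (- (real n * t))) ^ nat \<lfloor>exp (b * real n)\<rfloor> * k t) \<le> norm (k t)"
          unfolding real_norm_def abs_mult by (intro mult_left_le_one_le abs_ge_zero)
      qed
    qed (use ki in auto)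
    then show ?thesis unfolding vanish using LIMSEQ_unique tendsto_const by blast
  qed
  have "AE t in halfline. k t = 0"
  proof (rule AE_zero_if_indefinite_integral_zero)
    show "k integrable_on {0..b}" for b
      using integrable_on_subinterval[OF integrable_on_lebesgue_on[OF ki]] by auto
    fix b :: real assume b: "0 \<le> b"
    have "integral {0..b} k = (LINT t|halfline. indicator {..b} t *\<^sub>R k t)"
      by (rule truncated_halfline_integral(2)[OF ki, symmetric])
    also have "\<dots> = (LINT t|halfline. k t - (if b < t then 1 else 0) * k t)"
      by (rule Bochner_Integration.integral_cong) (auto simp: indicator_def)
    also have "\<dots> = 0"
    proof -
      have "integrable halfline (\<lambda>t. k t - indicator {..b} t *\<^sub>R k t)"
        by (intro Bochner_Integration.integrable_diff ki truncated_halfline_integral(1))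
      then have "integrable halfline (\<lambda>t. (if b < t then 1 else 0) * k t)"
        by (rule Bochner_Integration.integrable_cong[THEN iffD1, OF refl, rotated]) (auto simp: indicator_def)
      then show ?thesis using ki k0 tail[OF b] by simp
    qed
    finally show "integral {0..b} k = 0" .
  qed
  then show ?thesis by (rule eventually_mono) (simp add: k_def)
qed

lemma laplace_injective_complex:
  fixes f :: "real \<Rightarrow> complex"
  assumes int: "\<And>s. s > \<sigma> \<Longrightarrow> integrable halfline (\<lambda>t. exp (- s * t) *\<^sub>R f t)"
    and zero: "\<And>s. s > \<sigma> \<Longrightarrow> lap f s = 0"
  shows "AE t in halfline. f t = 0"
proof -
  have lin: "linear Re" "linear Im"
    by (auto intro: bounded_linear.linear bounded_linear_Re bounded_linear_Im)
  have "AE t in halfline. Re (f t) = 0"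
  proof (rule laplace_injective_real)
    fix s assume s: "s > \<sigma>"
    show "integrable halfline (\<lambda>t. exp (- s * t) *\<^sub>R Re (f t))"
      using integrable_Re[OF int[OF s]] by simp
    show "lap (\<lambda>t. Re (f t)) s = 0"
      using lap_linear_image[OF int[OF s] lin(1)] zero[OF s] by simp
  qed
  moreover have "AE t in halfline. Im (f t) = 0"
  proof (rule laplace_injective_real)
    fix s assume s: "s > \<sigma>"
    show "integrable halfline (\<lambda>t. exp (- s * t) *\<^sub>R Im (f t))"
      using integrable_Im[OF int[OF s]] by simp
    show "lap (\<lambda>t. Im (f t)) s = 0"
      using lap_linear_image[OF int[OF s] lin(2)] zero[OF s] by simp
  qed
  ultimately show ?thesis by eventually_elim (simp add: complex_eq_iff)
qed

section \<open>Linear differential equations\<close>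

text \<open>Solutions are meant in the integral sense, as the input is only locally square
  integrable. Cauchy-Schwarz bounds the squared difference of two right-hand integrals by
  \<open>t * K^2\<close> times an energy, which is the condition required for Picard
  iteration.\<close>

lemma linear_ode_exists:
  fixes A :: "'a::euclidean_space \<Rightarrow> 'a"
  assumes A: "linear A" and u: "u \<in> loc_L2"
  obtains x where "continuous_on {0..} x" "\<And>t. 0 \<le> t \<Longrightarrow> x t = integral {0..t} (\<lambda>s. A (x s) + u s)"
proof -
  define \<Phi> where "\<Phi> = (\<lambda>w t. integral {0..t} (\<lambda>s. A (w s) + u s))"
  obtain K where K: "\<And>x. norm (A x) \<le> K * norm x" using linear_bounded[OF A] by blast
  have in_L2: "(\<lambda>s. A (w s) + u s) \<in> loc_L2" if "w \<in> loc_L2" for w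
    by (rule loc_L2_add[OF loc_L2_linear_image[OF that A] u])
  obtain x where x: "x \<in> loc_L2" "\<And>t. 0 \<le> t \<Longrightarrow> x t = \<Phi> x t"
  proof (rule volterra_fixed_point[of \<Phi>])
    show "\<Phi> w \<in> loc_L2" if "w \<in> loc_L2" for w
      unfolding \<Phi>_def by (rule indefinite_integral_loc_L2[OF in_L2[OF that]])
    fix T :: real assume T: "0 \<le> T"
    show "\<exists>C>0. \<forall>w\<in>loc_L2. \<forall>w'\<in>loc_L2. \<forall>t\<in>{0..T}.
      (norm (\<Phi> w t - \<Phi> w' t))\<^sup>2 \<le> C * energy (\<lambda>s. w s - w' s) t"
    proof (intro exI[of _ "T * K\<^sup>2 + 1"] conjI ballI)
      show "0 < T * K\<^sup>2 + 1" using T by (intro add_nonneg_pos) auto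
      fix w w' :: "real \<Rightarrow> 'a" and t assume w: "w \<in> loc_L2" "w' \<in> loc_L2" and t: "t \<in> {0..T}"
      have d: "(\<lambda>s. w s - w' s) \<in> loc_L2" by (rule loc_L2_diff[OF w])
      have Ad: "(\<lambda>s. A (w s - w' s)) \<in> loc_L2" by (rule loc_L2_linear_image[OF d A])
      have "\<Phi> w t - \<Phi> w' t = integral {0..t} (\<lambda>s. (A (w s) + u s) - (A (w' s) + u s))"
        unfolding \<Phi>_def
        by (rule integral_diff[symmetric]) (intro loc_L2_integrable in_L2 w order_refl)+
      also have "\<dots> = integral {0..t} (\<lambda>s. A (w s - w' s))"
        by (simp add: linear_diff[OF A])
      finally have "(norm (\<Phi> w t - \<Phi> w' t))\<^sup>2 \<le> t * energy (\<lambda>s. A (w s - w' s)) t"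
        using integral_square_le[OF Ad order_refl, of t] t by (simp add: energy_def)
      also have "\<dots> \<le> T * (K\<^sup>2 * energy (\<lambda>s. w s - w' s) t)"
        using t by (intro mult_mono energy_linear_le[OF d A K] energy_nonneg[OF Ad]) auto
      also have "\<dots> \<le> (T * K\<^sup>2 + 1) * energy (\<lambda>s. w s - w' s) t"
        using energy_nonneg[OF d, of t] by (simp add: algebra_simps)
      finally show "(norm (\<Phi> w t - \<Phi> w' t))\<^sup>2 \<le> (T * K\<^sup>2 + 1) * energy (\<lambda>s. w s - w' s) t" .
    qed
  qed blast
  have "continuous_on {0..} (\<Phi> x)"
    unfolding \<Phi>_def by (rule indefinite_integral_continuous_halfline[OF in_L2[OF x(1)]])
  then have "continuous_on {0..} x"
    by (rule continuous_on_eq) (use x(2) in auto)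
  then show ?thesis using that x(2) unfolding \<Phi>_def by blast
qed

text \<open>With storage \<open>x \<bullet> Q x\<close>, dissipation supplies
  \<open>- 2 e |x|^2\<close>. Completing the square in the input term spends half of it and costs
  \<open>K^2 / e\<close> times \<open>|u|^2\<close>; the storage starts at zero and is nonnegative
  at \<open>T\<close>.\<close>

lemma lyapunov_energy_bound:
  fixes A Q :: "'a::euclidean_space \<Rightarrow> 'a"
  assumes A: "linear A" and Q: "linear Q" "\<And>x y. Q x \<bullet> y = x \<bullet> Q y"
    and Qpos: "\<And>x. 0 \<le> x \<bullet> Q x" and e: "e > 0" "\<And>x. Q x \<bullet> A x \<le> - e * (norm x)\<^sup>2"
    and K: "\<And>x. norm (Q x) \<le> K * norm x"
    and u: "u \<in> loc_L2" and x: "x \<in> loc_L2" "\<And>t. 0 \<le> t \<Longrightarrow> x t = integral {0..t} (\<lambda>s. A (x s) + u s)"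
    and T: "0 \<le> T"
  shows "energy x T \<le> (K / e)\<^sup>2 * energy u T"
proof -
  have g: "(\<lambda>s. A (x s) + u s) \<in> loc_L2" by (rule loc_L2_add[OF loc_L2_linear_image[OF x(1) A] u])
  have Qx: "(\<lambda>s. Q (x s)) \<in> loc_L2" by (rule loc_L2_linear_image[OF x(1) Q(1)])
  note sq = integrable_on_mult_right[OF loc_L2_square_integrable[OF x(1) order_refl, of T], of "- e"]
    integrable_on_mult_right[OF loc_L2_square_integrable[OF u order_refl, of T], of "K\<^sup>2 / e"]
  have pt: "2 * (Q y \<bullet> (A y + v)) \<le> - e * (norm y)\<^sup>2 + (K\<^sup>2 / e) * (norm v)\<^sup>2" for y v
  proof -
    have "Q y \<bullet> v \<le> norm (Q y) * norm v" by (rule norm_cauchy_schwarz)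
    also have "\<dots> \<le> K * norm y * norm v" by (intro mult_right_mono K) auto
    finally have "2 * (Q y \<bullet> v) \<le> 2 * (K * norm y * norm v)" by simp
    also have "\<dots> \<le> e * (norm y)\<^sup>2 + (K\<^sup>2 / e) * (norm v)\<^sup>2"
    proof -
      have "0 \<le> (e * norm y - K * norm v)\<^sup>2 / e" using e(1) by simp
      also have "\<dots> = e * (norm y)\<^sup>2 + (K\<^sup>2 / e) * (norm v)\<^sup>2 - 2 * (K * norm y * norm v)"
        using e(1) by (simp add: power2_diff power_mult_distrib field_simps power2_eq_square)
      finally show ?thesis by simp
    qed
    finally show ?thesis using e(2)[of y] by (simp add: inner_add_right)
  qed
  have "0 \<le> x T \<bullet> Q (x T)" by (rule Qpos)
  also have "\<dots> = integral {0..T} (\<lambda>t. 2 * (Q (x t) \<bullet> (A (x t) + u t)))"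
    by (rule quadratic_form_rate[OF g Q x(2) T])
  also have "\<dots> \<le> integral {0..T} (\<lambda>t. - e * (norm (x t))\<^sup>2 + (K\<^sup>2 / e) * (norm (u t))\<^sup>2)"
    by (rule integral_le[OF integrable_on_mult_right[OF loc_L2_inner_integrable[OF Qx g order_refl]]
          integrable_add[OF sq] pt])
  also have "\<dots> = - e * energy x T + (K\<^sup>2 / e) * energy u T"
    unfolding energy_def
    unfolding integral_add[OF sq] integral_mult_right ..
  finally show ?thesis using e(1) by (simp add: power_divide field_simps power2_eq_square)
qed


section \<open>Strictly proper stable systems have differentiable outputs\<close>

text \<open>The system \<open>1 / (s - \<mu>)\<close> started at rest: integral equation, gain,
  causality and transfer function are collected in one predicate, so that the operator can be
  obtained once and then composed. The gain \<open>1 / |Re \<mu>|\<close> is the norm of that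
  transfer function.\<close>

definition first_order_lag :: "complex \<Rightarrow> ((real \<Rightarrow> complex) \<Rightarrow> real \<Rightarrow> complex) \<Rightarrow> bool" where
  "first_order_lag \<mu> R \<longleftrightarrow> (\<forall>u\<in>loc_L2. R u \<in> loc_L2 \<and>
     (\<forall>t\<ge>0. R u t = integral {0..t} (\<lambda>s. \<mu> * R u s + u s)) \<and>
     (\<forall>T\<ge>0. energy (R u) T \<le> (1 / Re \<mu>)\<^sup>2 * energy u T) \<and>
     (\<forall>u'\<in>loc_L2. \<forall>T\<ge>0. (\<forall>t\<in>{0..T}. u t = u' t) \<longrightarrow> (\<forall>t\<in>{0..T}. R u t = R u' t)) \<and>
     (u \<in> sq_integrable \<longrightarrow> R u \<in> sq_integrable \<and>
       (\<forall>s>0. (of_real s - \<mu>) * lap (R u) s = lap u s)))"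

lemma first_order_lagD:
  assumes "first_order_lag \<mu> R"
  shows "u \<in> loc_L2 \<Longrightarrow> R u \<in> loc_L2"
    and "u \<in> loc_L2 \<Longrightarrow> 0 \<le> t \<Longrightarrow> R u t = integral {0..t} (\<lambda>s. \<mu> * R u s + u s)"
    and "u \<in> loc_L2 \<Longrightarrow> 0 \<le> T \<Longrightarrow> energy (R u) T \<le> (1 / Re \<mu>)\<^sup>2 * energy u T"
    and "u \<in> loc_L2 \<Longrightarrow> u' \<in> loc_L2 \<Longrightarrow> 0 \<le> T \<Longrightarrow> \<forall>t\<in>{0..T}. u t = u' t \<Longrightarrow> \<forall>t\<in>{0..T}. R u t = R u' t"
    and "u \<in> sq_integrable \<Longrightarrow> R u \<in> sq_integrable"
    and "u \<in> sq_integrable \<Longrightarrow> 0 < s \<Longrightarrow> (of_real s - \<mu>) * lap (R u) s = lap u s"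
  using assms sq_integrable_loc_L2(1)[of u] unfolding first_order_lag_def by blast+

lemma first_order_lag_exists:
  fixes \<mu> :: complex
  assumes l: "Re \<mu> < 0"
  shows "\<exists>R. first_order_lag \<mu> R"
proof -
  have lin: "linear (\<lambda>x. \<mu> * x)" by (rule bounded_linear.linear[OF bounded_linear_mult_right])
  have "\<exists>x. continuous_on {0..} x \<and> (\<forall>t\<ge>0. x t = integral {0..t} (\<lambda>s. \<mu> * x s + u s))" if "u \<in> loc_L2" for u
    using linear_ode_exists[OF lin that] by metis
  then obtain R where R: "\<And>u. u \<in> loc_L2 \<Longrightarrow> continuous_on {0..} (R u)"
    "\<And>u t. u \<in> loc_L2 \<Longrightarrow> 0 \<le> t \<Longrightarrow> R u t = integral {0..t} (\<lambda>s. \<mu> * R u s + u s)"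
    by metis
  have RL: "R u \<in> loc_L2" if "u \<in> loc_L2" for u by (rule loc_L2_continuous[OF R(1)[OF that]])
  have rhs: "(\<lambda>s. \<mu> * R u s + u s) \<in> loc_L2" if "u \<in> loc_L2" for u
    by (rule loc_L2_add[OF loc_L2_linear_image[OF RL[OF that] lin] that])
  have bound: "energy x T \<le> (1 / Re \<mu>)\<^sup>2 * energy u T"
    if "u \<in> loc_L2" "x \<in> loc_L2" "\<And>t. 0 \<le> t \<Longrightarrow> x t = integral {0..t} (\<lambda>s. \<mu> * x s + u s)" "0 \<le> T" for x u T
  proof -
    \<comment> \<open>The Lyapunov estimate with \<open>Q\<close> the identity, hence
      \<open>K = 1\<close> and \<open>e = - Re \<mu>\<close>.\<close>
    have "energy x T \<le> (1 / - Re \<mu>)\<^sup>2 * energy u T"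
    proof (rule lyapunov_energy_bound[OF lin, where Q = "\<lambda>x. x"])
      show "z \<bullet> (\<mu> * z) \<le> - (- Re \<mu>) * (norm z)\<^sup>2" for z
        unfolding inner_complex_def cmod_power2 by (simp add: algebra_simps power2_eq_square)
    qed (use l that in \<open>auto intro: linear_id[unfolded id_def]\<close>)
    then show ?thesis by simp
  qed
  \<comment> \<open>Two responses to inputs that agree on \<open>[0, T]\<close> differ by a response
    to zero input there, whose energy vanishes. Equality almost everywhere becomes equality
    everywhere because the responses are integrals.\<close>
  have caus: "\<forall>t\<in>{0..T}. R u t = R u' t"
    if u: "u \<in> loc_L2" "u' \<in> loc_L2" and T: "0 \<le> T" and eq: "\<forall>t\<in>{0..T}. u t = u' t" for u u' T
  proof
    let ?x = "\<lambda>t. R u t - R u' t" and ?d = "\<lambda>t. u t - u' t"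
    have xL: "?x \<in> loc_L2" and dL: "?d \<in> loc_L2" by (intro loc_L2_diff RL u)+
    have xeq: "?x t = integral {0..t} (\<lambda>s. \<mu> * ?x s + ?d s)" if "0 \<le> t" for t
    proof -
      have "?x t = integral {0..t} (\<lambda>s. \<mu> * R u s + u s) - integral {0..t} (\<lambda>s. \<mu> * R u' s + u' s)"
        by (simp only: R(2)[OF u(1) that, symmetric] R(2)[OF u(2) that, symmetric])
      also have "\<dots> = integral {0..t} (\<lambda>s. (\<mu> * R u s + u s) - (\<mu> * R u' s + u' s))"
        by (intro integral_diff[symmetric] loc_L2_integrable rhs u order_refl)
      finally show ?thesis by (simp add: algebra_simps)
    qed
    have "energy ?d T = 0"
      unfolding energy_def using eq integral_cong[of "{0..T}" "\<lambda>t. (norm (?d t))\<^sup>2" "\<lambda>_. 0"] by simp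
    then have "energy ?x T \<le> 0" using bound[OF dL xL xeq T] by simp
    then have neg: "negligible {t \<in> {0..T}. ?x t \<noteq> 0}" by (rule energy_eq_0_imp_AE[OF xL])
    fix t assume t: "t \<in> {0..T}"
    have "integral {0..t} (\<lambda>s. \<mu> * ?x s + ?d s) = integral {0..t} (\<lambda>s. 0)"
      by (rule integral_spike[OF neg]) (use t eq in auto)
    then show "R u t = R u' t" using xeq[of t] t by simp
  qed
  have xs: "R u \<in> sq_integrable" if u: "u \<in> sq_integrable" for u
  proof -
    note u' = sq_integrable_loc_L2[OF u]
    show ?thesis
    proof (rule sq_integrable_I(1)[OF RL[OF u'(1)]])
      fix T :: real assume T: "0 \<le> T"
      have "energy (R u) T \<le> (1 / Re \<mu>)\<^sup>2 * energy u T" by (rule bound[OF u'(1) RL[OF u'(1)] R(2)[OF u'(1)] T])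
      also have "\<dots> \<le> (1 / Re \<mu>)\<^sup>2 * (LINT t|halfline. (norm (u t))\<^sup>2)" by (intro mult_left_mono u'(2)) auto
      finally show "energy (R u) T \<le> (1 / Re \<mu>)\<^sup>2 * (LINT t|halfline. (norm (u t))\<^sup>2)" .
    qed
  qed
  have trans: "(of_real s - \<mu>) * lap (R u) s = lap u s" if u: "u \<in> sq_integrable" and s: "0 < s" for u s
  proof -
    have lxs: "(\<lambda>t. \<mu> * R u t) \<in> sq_integrable" by (rule sq_integrable_linear_image[OF xs[OF u] lin])
    have "s *\<^sub>R lap (R u) s = lap (\<lambda>t. \<mu> * R u t + u t) s"
      by (rule lap_indefinite_integral[OF sq_integrable_add[OF lxs u] xs[OF u] s R(2)[OF sq_integrable_loc_L2(1)[OF u]]])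
    also have "\<dots> = lap (\<lambda>t. \<mu> * R u t) s + lap u s"
      by (intro lap_add sq_integrable_exp_integrable lxs u s)
    also have "lap (\<lambda>t. \<mu> * R u t) s = \<mu> * lap (R u) s"
      by (rule lap_linear_image[OF sq_integrable_exp_integrable[OF xs[OF u] s] lin])
    finally show ?thesis by (simp add: scaleR_conv_of_real algebra_simps)
  qed
  have "first_order_lag \<mu> R"
    unfolding first_order_lag_def
  proof (intro ballI conjI allI impI)
    fix u :: "real \<Rightarrow> complex" and T :: real assume u: "u \<in> loc_L2"
    show "R u \<in> loc_L2" by (rule RL[OF u])
    show "R u t = integral {0..t} (\<lambda>s. \<mu> * R u s + u s)" if "0 \<le> t" for t by (rule R(2)[OF u that])
    show "energy (R u) T \<le> (1 / Re \<mu>)\<^sup>2 * energy u T" if "0 \<le> T" by (rule bound[OF u RL[OF u] R(2)[OF u] that])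
    show "R u t = R u' t" if "u' \<in> loc_L2" "0 \<le> T" "\<forall>t\<in>{0..T}. u t = u' t" "t \<in> {0..T}" for u' t
      using caus[OF u that(1-3)] that(4) by blast
  qed (use xs trans in auto)
  then show ?thesis by blast
qed

text \<open>\<open>realizes ls p \<Phi> \<Psi> c\<close>: the causal system \<open>\<Phi>\<close> has transfer function \<open>p(s) / \<Prod>\<^bsub>l \<in> ls\<^esub> (s - l)\<close>,
  and \<open>\<Psi>\<close> is its derivative; both have gain at most \<open>sqrt c\<close>.\<close>

definition realizes ::
  "complex list \<Rightarrow> complex poly \<Rightarrow> ((real \<Rightarrow> complex) \<Rightarrow> real \<Rightarrow> complex)
    \<Rightarrow> ((real \<Rightarrow> complex) \<Rightarrow> real \<Rightarrow> complex) \<Rightarrow> real \<Rightarrow> bool" where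
  "realizes ls p \<Phi> \<Psi> c \<longleftrightarrow> 0 \<le> c \<and> (\<forall>u\<in>loc_L2. \<Psi> u \<in> loc_L2 \<and>
     (\<forall>t\<ge>0. \<Phi> u t = integral {0..t} (\<Psi> u)) \<and>
     (\<forall>T\<ge>0. energy (\<Phi> u) T \<le> c * energy u T \<and> energy (\<Psi> u) T \<le> c * energy u T) \<and>
     (\<forall>u'\<in>loc_L2. \<forall>T\<ge>0. (\<forall>t\<in>{0..T}. u t = u' t) \<longrightarrow> (\<forall>t\<in>{0..T}. \<Psi> u t = \<Psi> u' t)) \<and>
     (u \<in> sq_integrable \<longrightarrow> (\<forall>s>0. (\<Prod>l\<leftarrow>ls. of_real s - l) * lap (\<Phi> u) s = poly p (of_real s) * lap u s)))"

lemma realizes_output_loc_L2: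
  assumes "realizes ls p \<Phi> \<Psi> c" "u \<in> loc_L2"
  shows "\<Phi> u \<in> loc_L2"
proof (rule loc_L2_continuous)
  have "continuous_on {0..} (\<lambda>t. integral {0..t} (\<Psi> u))"
    using assms by (intro indefinite_integral_continuous_halfline) (auto simp: realizes_def)
  then show "continuous_on {0..} (\<Phi> u)"
    by (rule continuous_on_eq) (use assms in \<open>auto simp: realizes_def\<close>)
qed

lemma realizes_output_sq_integrable:
  assumes r: "realizes ls p \<Phi> \<Psi> c" and u: "u \<in> sq_integrable"
  shows "\<Phi> u \<in> sq_integrable"
proof (rule sq_integrable_I(1)[OF realizes_output_loc_L2[OF r sq_integrable_loc_L2(1)[OF u]]])
  fix T :: real assume T: "0 \<le> T"
  have "energy (\<Phi> u) T \<le> c * energy u T"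
    using r sq_integrable_loc_L2(1)[OF u] T by (auto simp: realizes_def)
  also have "\<dots> \<le> c * (LINT t|halfline. (norm (u t))\<^sup>2)"
    using r by (intro mult_left_mono sq_integrable_loc_L2(2)[OF u]) (auto simp: realizes_def)
  finally show "energy (\<Phi> u) T \<le> c * (LINT t|halfline. (norm (u t))\<^sup>2)" .
qed

lemma realizes_single:
  assumes "Re \<mu> < 0"
  shows "\<exists>\<Phi> \<Psi> c. realizes [\<mu>] [:a:] \<Phi> \<Psi> c"
proof -
  obtain R where "first_order_lag \<mu> R" using first_order_lag_exists[OF assms] by blast
  note R = first_order_lagD[OF this]
  have lin: "linear (\<lambda>x. b * x)" for b :: complex
    by (rule bounded_linear.linear[OF bounded_linear_mult_right])
  have gain: "energy (\<lambda>t. b * f t) T \<le> (cmod b)\<^sup>2 * energy f T" if "f \<in> loc_L2" for f T and b :: complex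
    by (rule energy_linear_le[OF that lin]) (simp add: norm_mult)
  define r where "r = (1 / Re \<mu>)\<^sup>2"
  define c1 where "c1 = (cmod a)\<^sup>2 * r"
  define c2 where "c2 = (cmod a)\<^sup>2 * (2 * ((cmod \<mu>)\<^sup>2 * r) + 2)"
  have r0: "0 \<le> r" "0 \<le> c1" "0 \<le> c2" by (auto simp: r_def c1_def c2_def)
  have in_L2: "(\<lambda>s. \<mu> * R u s + u s) \<in> loc_L2" if "u \<in> loc_L2" for u
    by (rule loc_L2_add[OF loc_L2_linear_image[OF R(1)[OF that] lin] that])
  have "realizes [\<mu>] [:a:] (\<lambda>u t. a * R u t) (\<lambda>u t. a * (\<mu> * R u t + u t)) (c1 + c2)"
    unfolding realizes_def
  proof (intro conjI ballI allI impI)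
    show "0 \<le> c1 + c2" using r0 by simp
    fix u :: "real \<Rightarrow> complex" assume u: "u \<in> loc_L2"
    show "(\<lambda>t. a * (\<mu> * R u t + u t)) \<in> loc_L2" by (rule loc_L2_linear_image[OF in_L2[OF u] lin])
    show "a * R u t = integral {0..t} (\<lambda>t. a * (\<mu> * R u t + u t))" if "0 \<le> t" for t
      using integral_linear[OF loc_L2_integrable[OF in_L2[OF u] order_refl] bounded_linear_mult_right[of a], of t]
        R(2)[OF u that] by (simp add: o_def)
    fix T :: real assume T: "0 \<le> T"
    have e: "0 \<le> energy u T" by (rule energy_nonneg[OF u])
    have Rb: "energy (R u) T \<le> r * energy u T" unfolding r_def by (rule R(3)[OF u T])
    have "energy (\<lambda>t. a * R u t) T \<le> (cmod a)\<^sup>2 * energy (R u) T" by (rule gain[OF R(1)[OF u]])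
    also have "\<dots> \<le> (cmod a)\<^sup>2 * (r * energy u T)" by (intro mult_left_mono Rb) auto
    finally have b1: "energy (\<lambda>t. a * R u t) T \<le> c1 * energy u T" by (simp add: c1_def mult.assoc)
    have "energy (\<lambda>t. \<mu> * R u t) T \<le> (cmod \<mu>)\<^sup>2 * energy (R u) T" by (rule gain[OF R(1)[OF u]])
    also have "\<dots> \<le> (cmod \<mu>)\<^sup>2 * (r * energy u T)" by (intro mult_left_mono Rb) auto
    finally have b2: "energy (\<lambda>t. \<mu> * R u t) T \<le> (cmod \<mu>)\<^sup>2 * r * energy u T" by (simp add: mult.assoc)
    have "energy (\<lambda>t. a * (\<mu> * R u t + u t)) T \<le> (cmod a)\<^sup>2 * energy (\<lambda>t. \<mu> * R u t + u t) T"
      by (rule gain[OF in_L2[OF u]])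
    also have "\<dots> \<le> (cmod a)\<^sup>2 * (2 * energy (\<lambda>t. \<mu> * R u t) T + 2 * energy u T)"
      by (intro mult_left_mono energy_add_le loc_L2_linear_image[OF R(1)[OF u] lin] u) auto
    also have "\<dots> \<le> (cmod a)\<^sup>2 * (2 * ((cmod \<mu>)\<^sup>2 * r * energy u T) + 2 * energy u T)"
      by (intro mult_left_mono add_mono b2) auto
    also have "\<dots> = c2 * energy u T" by (simp add: c2_def algebra_simps)
    finally have b3: "energy (\<lambda>t. a * (\<mu> * R u t + u t)) T \<le> c2 * energy u T" .
    have c: "c1 * energy u T \<le> (c1 + c2) * energy u T" "c2 * energy u T \<le> (c1 + c2) * energy u T"
      using r0 e by (auto intro!: mult_right_mono)
    show "energy (\<lambda>t. a * R u t) T \<le> (c1 + c2) * energy u T" using b1 c(1) by linarith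
    show "energy (\<lambda>t. a * (\<mu> * R u t + u t)) T \<le> (c1 + c2) * energy u T" using b3 c(2) by linarith
    fix u' t assume u': "u' \<in> loc_L2" and eq: "\<forall>t\<in>{0..T}. u t = u' t" and t: "t \<in> {0..T}"
    show "a * (\<mu> * R u t + u t) = a * (\<mu> * R u' t + u' t)"
      using R(4)[OF u u' T eq] eq t by simp
  next
    fix u :: "real \<Rightarrow> complex" and s :: real
    assume u: "u \<in> loc_L2" "u \<in> sq_integrable" and s: "0 < s"
    note xs = R(5)[OF u(2)]
    have "lap (\<lambda>t. a * R u t) s = a * lap (R u) s"
      by (rule lap_linear_image[OF sq_integrable_exp_integrable[OF xs s] lin])
    then show "(\<Prod>l\<leftarrow>[\<mu>]. of_real s - l) * lap (\<lambda>t. a * R u t) s = poly [:a:] (of_real s) * lap u s"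
      using R(6)[OF u(2) s] by simp
  qed
  then show ?thesis by blast
qed

text \<open>Dividing the numerator by \<open>s - \<mu>\<close> splits the system into
  \<open>p'\<close> over the remaining factors plus \<open>a / (s - \<mu>)\<close> over the
  remaining factors. The second summand is a first-order lag followed by an already realized system,
  so both outputs inherit a derivative with finite gain.\<close>

lemma realizes_Cons:
  assumes l: "Re \<mu> < 0" and r1: "realizes ls p' \<Phi>1 \<Psi>1 c1" and r2: "realizes ls [:a:] \<Phi>2 \<Psi>2 c2"
    and p: "p = [:- \<mu>, 1:] * p' + [:a:]"
  shows "\<exists>\<Phi> \<Psi> c. realizes (\<mu> # ls) p \<Phi> \<Psi> c"
proof -
  obtain R where "first_order_lag \<mu> R" using first_order_lag_exists[OF l] by blast
  note R = first_order_lagD[OF this]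
  define r where "r = (1 / Re \<mu>)\<^sup>2"
  have r0: "0 \<le> r" by (simp add: r_def)
  have c0: "0 \<le> c1" "0 \<le> c2" using r1 r2 by (auto simp: realizes_def)
  have "realizes (\<mu> # ls) p (\<lambda>u t. \<Phi>1 u t + \<Phi>2 (R u) t) (\<lambda>u t. \<Psi>1 u t + \<Psi>2 (R u) t) (2 * c1 + 2 * (c2 * r))"
    unfolding realizes_def
  proof (intro conjI ballI allI impI)
    show "0 \<le> 2 * c1 + 2 * (c2 * r)" using c0 r0 by simp
    fix u :: "real \<Rightarrow> complex" assume u: "u \<in> loc_L2"
    note Ru = R(1)[OF u]
    have P: "\<Psi>1 u \<in> loc_L2" "\<Psi>2 (R u) \<in> loc_L2" using r1 r2 u Ru by (auto simp: realizes_def)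
    show "(\<lambda>t. \<Psi>1 u t + \<Psi>2 (R u) t) \<in> loc_L2" by (rule loc_L2_add[OF P])
    show "\<Phi>1 u t + \<Phi>2 (R u) t = integral {0..t} (\<lambda>t. \<Psi>1 u t + \<Psi>2 (R u) t)" if "0 \<le> t" for t
      using integral_add[OF P[THEN loc_L2_integrable, OF order_refl], of t] r1 r2 u Ru that
      by (auto simp: realizes_def)
    fix T :: real assume T: "0 \<le> T"
    have Rb: "energy (R u) T \<le> r * energy u T" unfolding r_def by (rule R(3)[OF u T])
    have sum: "energy (\<lambda>t. f t + g t) T \<le> (2 * c1 + 2 * (c2 * r)) * energy u T"
      if "f \<in> loc_L2" "g \<in> loc_L2" "energy f T \<le> c1 * energy u T" "energy g T \<le> c2 * energy (R u) T"
      for f g :: "real \<Rightarrow> complex"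
    proof -
      have "energy g T \<le> c2 * (r * energy u T)"
        using that(4) mult_left_mono[OF Rb c0(2)] by linarith
      then show ?thesis using energy_add_le[OF that(1,2), of T] that(3) by (simp add: algebra_simps)
    qed
    show "energy (\<lambda>t. \<Phi>1 u t + \<Phi>2 (R u) t) T \<le> (2 * c1 + 2 * (c2 * r)) * energy u T"
      by (rule sum[OF realizes_output_loc_L2[OF r1 u] realizes_output_loc_L2[OF r2 Ru]])
        (use r1 r2 u Ru T in \<open>auto simp: realizes_def\<close>)
    show "energy (\<lambda>t. \<Psi>1 u t + \<Psi>2 (R u) t) T \<le> (2 * c1 + 2 * (c2 * r)) * energy u T"
      by (rule sum[OF P]) (use r1 r2 u Ru T in \<open>auto simp: realizes_def\<close>)
    fix u' t assume u': "u' \<in> loc_L2" and eq: "\<forall>t\<in>{0..T}. u t = u' t" and t: "t \<in> {0..T}"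
    have "\<Psi>1 u t = \<Psi>1 u' t" using r1 u u' T eq t unfolding realizes_def by blast
    moreover have "\<Psi>2 (R u) t = \<Psi>2 (R u') t"
      using r2 Ru R(1)[OF u'] T R(4)[OF u u' T eq] t unfolding realizes_def by blast
    ultimately show "\<Psi>1 u t + \<Psi>2 (R u) t = \<Psi>1 u' t + \<Psi>2 (R u') t" by simp
  next
    fix u :: "real \<Rightarrow> complex" and s :: real
    assume u: "u \<in> loc_L2" "u \<in> sq_integrable" and s: "0 < s"
    note xs = R(5)[OF u(2)]
    have "lap (\<lambda>t. \<Phi>1 u t + \<Phi>2 (R u) t) s = lap (\<Phi>1 u) s + lap (\<Phi>2 (R u)) s"
      by (intro lap_add sq_integrable_exp_integrable s realizes_output_sq_integrable[OF r1 u(2)]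
          realizes_output_sq_integrable[OF r2 xs])
    then have "(\<Prod>l\<leftarrow>\<mu> # ls. of_real s - l) * lap (\<lambda>t. \<Phi>1 u t + \<Phi>2 (R u) t) s
      = (of_real s - \<mu>) * ((\<Prod>l\<leftarrow>ls. of_real s - l) * lap (\<Phi>1 u) s)
        + (of_real s - \<mu>) * ((\<Prod>l\<leftarrow>ls. of_real s - l) * lap (\<Phi>2 (R u)) s)"
      by (simp add: distrib_left mult.assoc)
    also have "(\<Prod>l\<leftarrow>ls. of_real s - l) * lap (\<Phi>1 u) s = poly p' (of_real s) * lap u s"
      using r1 u s unfolding realizes_def by blast
    also have "(\<Prod>l\<leftarrow>ls. of_real s - l) * lap (\<Phi>2 (R u)) s = a * lap (R u) s"
      using r2 xs sq_integrable_loc_L2(1)[OF xs] s unfolding realizes_def by auto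
    also have "(of_real s - \<mu>) * (a * lap (R u) s) = a * lap u s"
      unfolding R(6)[OF u(2) s, symmetric] by (rule mult.left_commute)
    finally show "(\<Prod>l\<leftarrow>\<mu> # ls. of_real s - l) * lap (\<lambda>t. \<Phi>1 u t + \<Phi>2 (R u) t) s
      = poly p (of_real s) * lap u s"
      by (simp add: p algebra_simps)
  qed
  then show ?thesis by blast
qed

text \<open>Peeling off one pole at a time, instead of expanding in partial fractions, treats
  multiple poles like simple ones. Synthetic division keeps the numerator strictly below the
  shortened denominator, and the constant remainder is covered because at least one factor is
  left.\<close>

lemma realizes_exists:
  assumes "ls \<noteq> []" "\<forall>l\<in>set ls. Re l < 0" "degree p < length ls"
  shows "\<exists>\<Phi> \<Psi> c. realizes ls p \<Phi> \<Psi> c"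
  using assms
proof (induction ls arbitrary: p rule: list_nonempty_induct)
  case (single \<mu>)
  then have "degree p = 0" by simp
  then obtain a where "p = [:a:]" by (rule degree_eq_zeroE)
  then show ?case using realizes_single single by simp
next
  case (cons \<mu> ls)
  have len: "0 < length ls" using cons.hyps by simp
  have d: "degree (synthetic_div p \<mu>) < length ls"
  proof -
    have "degree p < Suc (length ls)" using cons.prems(2) by simp
    then show ?thesis unfolding degree_synthetic_div using len by linarith
  qed
  obtain \<Phi>1 \<Psi>1 c1 where r1: "realizes ls (synthetic_div p \<mu>) \<Phi>1 \<Psi>1 c1"
    using cons.IH[OF _ d] cons.prems(1) by auto
  obtain \<Phi>2 \<Psi>2 c2 where r2: "realizes ls [:poly p \<mu>:] \<Phi>2 \<Psi>2 c2"
    using cons.IH[of "[:poly p \<mu>:]"] cons.prems(1) len by auto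
  show ?case
    by (rule realizes_Cons[OF _ r1 r2 synthetic_div_correct'[symmetric]]) (use cons.prems(1) in simp)
qed

section \<open>Truncation and the extended space\<close>

lemma trunc_loc_L2:
  assumes f: "f \<in> loc_L2"
  shows "trunc T f \<in> loc_L2"
proof (rule loc_L2_I)
  have [measurable]: "f \<in> borel_measurable halfline" by (rule loc_L2_measurable[OF f])
  have [measurable]: "(\<lambda>t. t) \<in> borel_measurable halfline"
    by (intro measurable_restrict_space1 measurable_completion) auto
  show "trunc T f \<in> borel_measurable halfline" unfolding trunc_def by measurable
  fix S :: real
  show "\<exists>g. g integrable_on {0..S} \<and> (\<forall>s\<in>{0..S}. (norm (trunc T f s))\<^sup>2 \<le> g s)"
    using loc_L2_square_integrable[OF f order_refl, of S]
    by (intro exI[of _ "\<lambda>s. (norm (f s))\<^sup>2"]) (auto simp: trunc_def)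
qed

lemma energy_trunc: "energy (trunc T f) T = energy f T"
  unfolding energy_def by (rule integral_cong) (simp add: trunc_def)

lemma energy_trunc_le:
  assumes f: "f \<in> loc_L2" and T: "0 < T"
  shows "energy (trunc T f) S \<le> energy f T"
proof -
  note t = trunc_loc_L2[OF f, of T]
  have "energy (trunc T f) S \<le> energy (trunc T f) (max S T)" by (rule energy_mono[OF t]) simp
  also have "\<dots> = energy (trunc T f) T + integral {T..max S T} (\<lambda>t. (norm (trunc T f t))\<^sup>2)"
    using T by (intro energy_split t) auto
  also have "integral {T..max S T} (\<lambda>t. (norm (trunc T f t))\<^sup>2) = integral {T..max S T} (\<lambda>t. 0)"
    by (rule integral_spike[of "{T}"]) (auto simp: trunc_def)
  finally show ?thesis by (simp add: energy_trunc)
qed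

lemma L2e_eq_loc_L2: "L2e = loc_L2"
proof (intro set_eqI iffI)
  fix f assume f: "f \<in> L2e"
  have t: "trunc T f \<in> sq_integrable" if "T > 0" for T
    using f that by (simp add: L2e_def L2_eq_sq_integrable)
  show "f \<in> loc_L2"
  proof (rule loc_L2_I)
    show "f \<in> borel_measurable halfline"
    proof (rule borel_measurable_LIMSEQ_real[of halfline "\<lambda>n. trunc (real n + 1) f"])
      fix t :: real
      have "\<forall>\<^sub>F n in sequentially. t \<le> real n"
        using filterlim_real_sequentially by (simp add: filterlim_at_top)
      then have "\<forall>\<^sub>F n in sequentially. trunc (real n + 1) f t = f t"
        by (rule eventually_mono) (simp add: trunc_def)
      then show "(\<lambda>n. trunc (real n + 1) f t) \<longlonglongrightarrow> f t" by (rule tendsto_eventually)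
    qed (use t in \<open>auto simp: sq_integrable_def\<close>)
    fix T :: real assume "0 \<le> T"
    then show "\<exists>g. g integrable_on {0..T} \<and> (\<forall>s\<in>{0..T}. (norm (f s))\<^sup>2 \<le> g s)"
      using loc_L2_square_integrable[OF sq_integrable_loc_L2(1)[OF t[of "T + 1"]] order_refl, of T]
      by (intro exI[of _ "\<lambda>s. (norm (trunc (T + 1) f s))\<^sup>2"]) (auto simp: trunc_def)
  qed
next
  fix f :: signal assume f: "f \<in> loc_L2"
  have "trunc T f \<in> sq_integrable" if "T > 0" for T
    by (rule sq_integrable_I(1)[OF trunc_loc_L2[OF f]]) (rule energy_trunc_le[OF f that])
  then show "f \<in> L2e" by (simp add: L2e_def L2_eq_sq_integrable)
qed

lemma trunc_L2: "f \<in> loc_L2 \<Longrightarrow> 0 < T \<Longrightarrow> trunc T f \<in> sq_integrable"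
  using L2e_eq_loc_L2 L2_eq_sq_integrable by (auto simp: L2e_def)

lemma trunc_sig_eq_iff:
  "trunc T f =\<^sub>a\<^sub>e trunc T g \<longleftrightarrow> negligible {t \<in> {0..T}. f t \<noteq> g t}"
proof -
  have "{t. 0 \<le> t \<and> trunc T f t \<noteq> trunc T g t} = {t \<in> {0..T}. f t \<noteq> g t}"
    by (auto simp: trunc_def)
  then show ?thesis by (simp add: sig_eq_def AE_halfline_iff)
qed


lemma linear_complex_of_real: "linear complex_of_real"
  by (rule bounded_linear.linear[OF bounded_linear_of_real])

lemma energy_complex_of_real: "energy (\<lambda>t. complex_of_real (y t)) T = energy y T"
  by (simp add: energy_def)

section \<open>The derivative of the low-pass output\<close>

text \<open>The denominator splits over the complex numbers; \<open>ls\<close> lists its roots with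
  multiplicity, and its leading coefficient is absorbed into the numerator
  \<open>pc\<close>.\<close>

lemma proper_stable_factorization:
  fixes p q :: "real poly"
  assumes d: "degree p < degree q"
    and q: "\<forall>s. poly (map_poly complex_of_real q) s = 0 \<longrightarrow> Re s < 0"
  obtains ls pc where "ls \<noteq> []" "\<forall>l\<in>set ls. Re l < 0" "degree pc < length ls"
    "\<And>s. 0 < Re s \<Longrightarrow> (\<Prod>l\<leftarrow>ls. s - l) \<noteq> 0"
    "\<And>s. poly (map_poly complex_of_real p) s / poly (map_poly complex_of_real q) s = poly pc s / (\<Prod>l\<leftarrow>ls. s - l)"
proof -
  let ?p = "map_poly complex_of_real p" and ?q = "map_poly complex_of_real q"
  have dp: "degree ?p = degree p" and dq: "degree ?q = degree q"
    by (simp_all add: degree_map_poly)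
  obtain root where root: "smult (lead_coeff ?q) (\<Prod>i<degree ?q. [:- root i, 1:]) = ?q"
    by (rule complex_poly_decompose')
  define ls where "ls = map root [0..<degree ?q]"
  have pq: "poly ?q s = lead_coeff ?q * (\<Prod>l\<leftarrow>ls. s - l)" for s
  proof -
    have "poly ?q s = poly (smult (lead_coeff ?q) (\<Prod>i<degree ?q. [:- root i, 1:])) s" by (simp only: root)
    also have "\<dots> = lead_coeff ?q * (\<Prod>i<degree ?q. s - root i)" by (simp add: poly_prod)
    also have "(\<Prod>i<degree ?q. s - root i) = (\<Prod>l\<leftarrow>ls. s - l)"
      using prod.distinct_set_conv_list[of "[0..<degree ?q]" "\<lambda>i. s - root i"]
      by (simp add: ls_def o_def atLeast0LessThan)
    finally show ?thesis .
  qed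
  have stab: "\<forall>l\<in>set ls. Re l < 0"
  proof
    fix l assume "l \<in> set ls"
    then have "(\<Prod>k\<leftarrow>ls. l - k) = 0" by (auto simp: prod_list_zero_iff)
    then show "Re l < 0" using q pq[of l] by simp
  qed
  show ?thesis
  proof (rule that)
    show "ls \<noteq> []" using d dq by (auto simp: ls_def)
    show "\<forall>l\<in>set ls. Re l < 0" by (rule stab)
    show "degree (smult (1 / lead_coeff ?q) ?p) < length ls"
      using d dp dq by (simp add: ls_def)
    show "(\<Prod>l\<leftarrow>ls. s - l) \<noteq> 0" if "0 < Re s" for s
      using stab that by (auto simp: prod_list_zero_iff)
    show "poly ?p s / poly ?q s = poly (smult (1 / lead_coeff ?q) ?p) s / (\<Prod>l\<leftarrow>ls. s - l)" for s
      unfolding pq by simp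
  qed
qed

text \<open>\<open>F\<close> is an abstract operator, so its smoothing effect must be deduced from
  its transfer function. For an input in \<open>L2\<close> the output agrees with that of the
  realization by injectivity of the Laplace transform. For an input in \<open>L2e\<close> the
  transfer function says nothing directly; the input is truncated, and causality of both systems
  carries the identity over to each bounded interval.\<close>

lemma stable_low_pass_derivative:
  assumes F: "stable_low_pass F Fs"
  shows "\<exists>D c. 0 \<le> c \<and> (\<forall>y\<in>loc_L2. D y \<in> loc_L2 \<and> (AE t in halfline. F y t = integral {0..t} (D y)) \<and>
     (\<forall>T\<ge>0. energy (D y) T \<le> c * energy y T))"
proof -
  obtain p q where pq: "degree p < degree q"
    "\<forall>s. poly (map_poly complex_of_real q) s = 0 \<longrightarrow> Re s < 0"
    "\<forall>s. Fs s = poly (map_poly complex_of_real p) s / poly (map_poly complex_of_real q) s"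
    using F unfolding stable_low_pass_def strictly_proper_stable_rational_def by blast
  obtain ls pc where ls: "ls \<noteq> []" "\<forall>l\<in>set ls. Re l < 0" "degree pc < length ls"
    "\<And>s. 0 < Re s \<Longrightarrow> (\<Prod>l\<leftarrow>ls. s - l) \<noteq> 0"
    "\<And>s. poly (map_poly complex_of_real p) s / poly (map_poly complex_of_real q) s = poly pc s / (\<Prod>l\<leftarrow>ls. s - l)"
    by (rule proper_stable_factorization[OF pq(1,2)]) blast
  obtain \<Phi> \<Psi> c where r: "realizes ls pc \<Phi> \<Psi> c" using realizes_exists[OF ls(1-3)] by blast
  obtain \<sigma> where \<sigma>: "\<sigma> \<ge> 0" and tf: "\<And>u s. u \<in> L2 \<Longrightarrow> Re s > \<sigma> \<Longrightarrow>
     integrable halfline (laplace_integrand (F u) s) \<and> laplace (F u) s = Fs s * laplace u s"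
    using F unfolding stable_low_pass_def has_transfer_function_def by blast
  have caus: "causal F" using F by (simp add: stable_low_pass_def stable_sys_def)
  define C where "C = (\<lambda>(y::signal) t. complex_of_real (y t))"
  have CL: "C y \<in> loc_L2" if "y \<in> loc_L2" for y
    unfolding C_def by (rule loc_L2_linear_image[OF that linear_complex_of_real])
  have Cs: "C y \<in> sq_integrable" if "y \<in> sq_integrable" for y
    unfolding C_def by (rule sq_integrable_linear_image[OF that linear_complex_of_real])
  have linRe: "linear Re" by (rule bounded_linear.linear[OF bounded_linear_Re])
  \<comment> \<open>The poles may be complex, so the realization acts on complex signals; for a real
    input the real part of its derivative is the one sought.\<close>
  define D where "D = (\<lambda>y t. Re (\<Psi> (C y) t))"
  have PL: "\<Psi> (C y) \<in> loc_L2" if "y \<in> loc_L2" for y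
    using r CL[OF that] by (auto simp: realizes_def)
  have DL: "D y \<in> loc_L2" if "y \<in> loc_L2" for y
    unfolding D_def by (rule loc_L2_linear_image[OF PL[OF that] linRe])
  have Dint: "Re (\<Phi> (C y) t) = integral {0..t} (D y)" if "y \<in> loc_L2" "0 \<le> t" for y t
  proof -
    have "\<Phi> (C y) t = integral {0..t} (\<Psi> (C y))" using r CL[OF that(1)] that(2) by (auto simp: realizes_def)
    then show ?thesis
      using integral_linear[OF loc_L2_integrable[OF PL[OF that(1)] order_refl] bounded_linear_Re, of t]
      by (simp add: D_def o_def)
  qed
  have main: "AE t in halfline. F y t = integral {0..t} (D y)" if y: "y \<in> sq_integrable" for y
  proof -
    have "AE t in halfline. complex_of_real (F y t) - \<Phi> (C y) t = 0"
    proof (rule laplace_injective_complex)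
      fix s assume s: "s > \<sigma>"
      then have s0: "s > 0" using \<sigma> by simp
      have t: "integrable halfline (laplace_integrand (F y) (of_real s))"
        "laplace (F y) (of_real s) = Fs (of_real s) * laplace y (of_real s)"
        using tf[of y "of_real s"] y s by (auto simp: L2_eq_sq_integrable)
      have i1: "integrable halfline (\<lambda>t. exp (- s * t) *\<^sub>R complex_of_real (F y t))"
      proof -
        have "integrable halfline (\<lambda>t. complex_of_real (exp (- s * t) *\<^sub>R F y t))"
          using laplace_of_real_integrable[OF t(1)] by (subst complex_of_real_integrable_eq)
        then show ?thesis by (simp add: scaleR_conv_of_real)
      qed
      have i2: "integrable halfline (\<lambda>t. exp (- s * t) *\<^sub>R \<Phi> (C y) t)"
        by (rule sq_integrable_exp_integrable[OF realizes_output_sq_integrable[OF r Cs[OF y]] s0])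
      show "integrable halfline (\<lambda>t. exp (- s * t) *\<^sub>R (complex_of_real (F y t) - \<Phi> (C y) t))"
        unfolding scaleR_diff_right by (rule Bochner_Integration.integrable_diff[OF i1 i2])
      have "(\<Prod>l\<leftarrow>ls. of_real s - l) * lap (\<Phi> (C y)) s = poly pc (of_real s) * lap (C y) s"
        using r Cs[OF y] sq_integrable_loc_L2(1)[OF Cs[OF y]] s0 unfolding realizes_def by blast
      moreover have "Fs (of_real s) = poly pc (of_real s) / (\<Prod>l\<leftarrow>ls. of_real s - l)"
        using pq(3) ls(5) by simp
      moreover have "(\<Prod>l\<leftarrow>ls. of_real s - l) \<noteq> 0" using ls(4)[of "of_real s"] s0 by simp
      ultimately have "lap (\<Phi> (C y)) s = Fs (of_real s) * lap (C y) s"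
        by (metis nonzero_mult_div_cancel_left times_divide_eq_left)
      also have "lap (C y) s = of_real (lap y s)"
        unfolding C_def by (rule lap_linear_image[OF sq_integrable_exp_integrable[OF y s0] linear_complex_of_real])
      also have "Fs (of_real s) * of_real (lap y s) = of_real (lap (F y) s)"
        using t(2) by (simp add: laplace_eq_lap)
      also have "\<dots> = lap (\<lambda>t. complex_of_real (F y t)) s"
        by (rule lap_linear_image[OF laplace_of_real_integrable[OF t(1)] linear_complex_of_real, symmetric])
      finally have "lap (\<Phi> (C y)) s = lap (\<lambda>t. complex_of_real (F y t)) s" .
      then show "lap (\<lambda>t. complex_of_real (F y t) - \<Phi> (C y) t) s = 0"
        using i1 i2 by (simp add: lap_def scaleR_diff_right)
    qed
    moreover have "AE t in halfline. 0 \<le> t" by (rule AE_I2) (simp add: space_restrict_space)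
    ultimately show ?thesis
    proof eventually_elim
      case (elim t)
      then have "F y t = Re (\<Phi> (C y) t)" by (metis Re_complex_of_real eq_iff_diff_eq_0)
      then show ?case using Dint[OF sq_integrable_loc_L2(1)[OF y] elim(2)] by simp
    qed
  qed
  have "AE t in halfline. F y t = integral {0..t} (D y)" if y: "y \<in> loc_L2" for y
  proof (rule AE_from_negligible_Icc)
    fix n :: nat
    \<comment> \<open>Causality concerns positive horizons only, and \<open>n\<close> may be
      zero.\<close>
    define T where "T = real n + 1"
    have T: "T > 0" by (simp add: T_def)
    define z where "z = trunc T y"
    have z: "z \<in> sq_integrable" unfolding z_def by (rule trunc_L2[OF y T])
    have zl: "z \<in> loc_L2" by (rule sq_integrable_loc_L2(1)[OF z])
    have "trunc T (F z) =\<^sub>a\<^sub>e trunc T (F y)"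
      using caus y T by (simp add: causal_def L2e_eq_loc_L2 z_def)
    then have n1: "negligible {t \<in> {0..T}. F z t \<noteq> F y t}" by (simp add: trunc_sig_eq_iff)
    have n2: "negligible {t. 0 \<le> t \<and> F z t \<noteq> integral {0..t} (D z)}"
      using main[OF z] by (simp add: AE_halfline_iff)
    have "\<forall>t\<in>{0..T}. C z t = C y t" by (simp add: C_def z_def trunc_def)
    then have eq: "\<forall>t\<in>{0..T}. \<Psi> (C z) t = \<Psi> (C y) t"
      using r CL[OF zl] CL[OF y] less_imp_le[OF T] unfolding realizes_def by blast
    have eqi: "integral {0..t} (D z) = integral {0..t} (D y)" if "t \<in> {0..T}" for t
    proof (rule integral_cong)
      fix s assume "s \<in> {0..t}"
      then have "s \<in> {0..T}" using that by auto
      then show "D z s = D y s" using eq by (simp add: D_def)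
    qed
    have "{t \<in> {0..real n}. \<not> F y t = integral {0..t} (D y)}
      \<subseteq> {t \<in> {0..T}. F z t \<noteq> F y t} \<union> {t. 0 \<le> t \<and> F z t \<noteq> integral {0..t} (D z)}"
    proof
      fix t assume t: "t \<in> {t \<in> {0..real n}. \<not> F y t = integral {0..t} (D y)}"
      then have "t \<in> {0..T}" by (simp add: T_def)
      then show "t \<in> {t \<in> {0..T}. F z t \<noteq> F y t} \<union> {t. 0 \<le> t \<and> F z t \<noteq> integral {0..t} (D z)}"
        using t eqi[of t] by auto
    qed
    then show "negligible {t \<in> {0..real n}. \<not> F y t = integral {0..t} (D y)}"
      using negligible_Un[OF n1 n2] negligible_subset by blast
  qed
  moreover have "energy (D y) T \<le> c * energy y T" if "y \<in> loc_L2" "0 \<le> T" for y T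
  proof -
    have "energy (D y) T \<le> 1\<^sup>2 * energy (\<Psi> (C y)) T"
      unfolding D_def by (rule energy_linear_le[OF PL[OF that(1)] linRe]) (simp add: abs_Re_le_cmod)
    also have "\<dots> \<le> c * energy (C y) T" using r CL[OF that(1)] that(2) by (auto simp: realizes_def)
    also have "energy (C y) T = energy y T" unfolding C_def by (rule energy_complex_of_real)
    finally show ?thesis .
  qed
  moreover have "0 \<le> c" using r by (simp add: realizes_def)
  ultimately show ?thesis using DL by blast
qed

section \<open>Asynchronous sampling\<close>

text \<open>\<open>\<phi> j\<close> is meant as the first actuation event not before the sampling
  instant \<open>T j\<close>. Several sampling instants may share one actuation event; the grid
  interval between equal values of \<open>\<phi>\<close> is then empty. The last two bounds are
  demanded for nonempty intervals only: there \<open>T j\<close> is the latest sampling instant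
  before \<open>\<phi> j\<close>, so its age is at most \<eta>.\<close>

definition event_grid :: "(nat \<Rightarrow> real) \<Rightarrow> (nat \<Rightarrow> real) \<Rightarrow> real \<Rightarrow> real \<Rightarrow> bool" where
  "event_grid T \<phi> L \<eta> \<longleftrightarrow> \<phi> 0 = 0 \<and> T 0 = 0 \<and> 0 < L \<and> 0 \<le> \<eta> \<and>
     (\<forall>j. T j \<le> \<phi> j \<and> T j < T (Suc j) \<and> \<phi> j \<le> \<phi> (Suc j) \<and> \<phi> (Suc j) - \<phi> j \<le> L \<and>
        (\<phi> j < \<phi> (Suc j) \<longrightarrow> \<phi> j < T (Suc j) \<and> \<phi> j - T j \<le> \<eta>)) \<and>
     filterlim \<phi> at_top sequentially"

lemma admissible_strict_mono: "admissible T \<Longrightarrow> strict_mono T"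
  by (auto simp: admissible_def strict_mono_Suc_iff)

lemma admissible_nonneg: "admissible T \<Longrightarrow> 0 \<le> T k"
  using strict_mono_mono[OF admissible_strict_mono, of T] monoD[of T 0 k] by (auto simp: admissible_def)

lemma interval_index:
  fixes T :: "nat \<Rightarrow> real"
  assumes "T 0 \<le> t" "filterlim T at_top sequentially"
  obtains k where "T k \<le> t" "t < T (Suc k)"
proof -
  have "\<forall>\<^sub>F n in sequentially. t + 1 \<le> T n" using assms(2) by (simp add: filterlim_at_top)
  then have "\<forall>\<^sub>F n in sequentially. t < T n" by (rule eventually_mono) simp
  then have ex: "\<exists>n. t < T n" by (rule eventually_happens'[OF sequentially_bot])
  define m where "m = (LEAST n. t < T n)"
  have m: "t < T m" unfolding m_def by (rule LeastI_ex[OF ex])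
  then have "m \<noteq> 0" using assms(1) by (cases m) auto
  then obtain k where k: "m = Suc k" by (cases m) auto
  have "\<not> t < T k"
    by (rule not_less_Least) (use k in \<open>simp add: m_def\<close>)
  then have "T k \<le> t" by simp
  then show ?thesis using that m k by blast
qed

lemma hold_eq:
  assumes "admissible T" "T k \<le> t" "t < T (Suc k)"
  shows "hold T a t = a k"
proof -
  have "(THE k. T k \<le> t \<and> t < T (Suc k)) = k"
  proof (rule the_equality)
    fix j assume j: "T j \<le> t \<and> t < T (Suc j)"
    then have "T j < T (Suc k)" "T k < T (Suc j)" using assms by auto
    then show "j = k"
      using strict_mono_less[OF admissible_strict_mono[OF assms(1)]] by (metis le_antisym less_Suc_eq_le)
  qed (use assms in auto)
  then show ?thesis by (simp add: hold_def)
qed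

lemma hold_right_continuous:
  assumes "admissible T"
  shows "right_continuous (hold T a)"
  unfolding right_continuous_def
proof (intro allI impI)
  fix t :: real assume "0 \<le> t"
  then obtain k where k: "T k \<le> t" "t < T (Suc k)"
    using interval_index[of T t] assms by (auto simp: admissible_def)
  have "\<forall>\<^sub>F s in at_right t. hold T a s = a k"
    unfolding eventually_at_right_field
    using k by (intro exI[of _ "T (Suc k)"]) (auto intro!: hold_eq[OF assms])
  then have "(hold T a \<longlongrightarrow> a k) (at_right t)" by (rule tendsto_eventually)
  then show "continuous (at_right t) (hold T a)"
    by (simp add: continuous_within hold_eq[OF assms k])
qed

text \<open>The events of \<open>Ts\<close> with index from \<open>\<kappa> j\<close> up to, but
  excluding, \<open>\<kappa> (Suc j)\<close> lie in \<open>[T j, T (Suc j))\<close>, where the first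
  hold has the value \<open>a j\<close>; the second hold therefore keeps this value on
  \<open>[\<phi> j, \<phi> (Suc j))\<close>. The gap \<open>\<tau>' + \<tau>o\<close> arises because
  \<open>\<phi> (Suc j)\<close> is at most \<open>T (Suc j) + \<tau>o\<close> and
  \<open>\<phi> j\<close> is at least \<open>T j\<close>.\<close>

lemma resampled_hold:
  assumes T: "admissible T" and Ts: "admissible Ts" and B: "timing_bounds T Ts \<tau>' \<tau>s \<tau>o \<eta>"
    and pos: "0 < \<tau>'" "0 \<le> \<tau>o" "0 \<le> \<eta>"
  obtains \<phi> where "event_grid T \<phi> (\<tau>' + \<tau>o) \<eta>"
    "\<And>a j t. \<phi> j \<le> t \<Longrightarrow> t < \<phi> (Suc j) \<Longrightarrow> hold Ts (sample Ts (hold T a)) t = a j"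
proof -
  define \<kappa> where "\<kappa> = (\<lambda>j. LEAST k. T j \<le> Ts k)"
  define \<phi> where "\<phi> = (\<lambda>j. Ts (\<kappa> j))"
  note sT = admissible_strict_mono[OF T] and sTs = admissible_strict_mono[OF Ts]
  have limT: "filterlim T at_top sequentially" "T 0 = 0" and limTs: "filterlim Ts at_top sequentially" "Ts 0 = 0"
    using T Ts by (auto simp: admissible_def)
  have ex: "\<exists>k. T j \<le> Ts k" for j
  proof -
    have "\<forall>\<^sub>F n in sequentially. T j \<le> Ts n" using limTs(1) by (simp add: filterlim_at_top)
    then show ?thesis by (auto simp: eventually_sequentially)
  qed
  have \<kappa>: "T j \<le> Ts (\<kappa> j)" for j unfolding \<kappa>_def by (rule LeastI_ex[OF ex])
  have \<kappa>_less: "Ts k < T j" if "k < \<kappa> j" for k j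
    using not_less_Least[OF that[unfolded \<kappa>_def]] by simp
  have fe: "first_event_from Ts (T j) = \<phi> j" for j
    unfolding first_event_from_def \<phi>_def
  proof (rule Least_equality)
    show "Ts (\<kappa> j) \<in> range Ts \<inter> {T j..}" using \<kappa> by simp
    fix y assume "y \<in> range Ts \<inter> {T j..}"
    then obtain k where k: "y = Ts k" "T j \<le> Ts k" by auto
    then have "\<not> k < \<kappa> j" using \<kappa>_less by force
    then show "Ts (\<kappa> j) \<le> y" using strict_mono_less_eq[OF sTs] k by simp
  qed
  have mono: "\<kappa> j \<le> \<kappa> (Suc j)" for j
  proof -
    have "T j \<le> Ts (\<kappa> (Suc j))" using \<kappa>[of "Suc j"] strict_monoD[OF sT lessI[of j]] by linarith
    then show ?thesis unfolding \<kappa>_def by (rule Least_le)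
  qed
  have bnd: "T (Suc j) - T j \<le> \<tau>'" "\<phi> j - T j \<le> \<tau>o" "\<phi> j - last_event_until T (\<phi> j) \<le> \<eta>" for j
    using B unfolding timing_bounds_def Let_def fe by auto
  have last: "last_event_until T b = T j" if "T j \<le> b" "b < T (Suc j)" for b j
    unfolding last_event_until_def
  proof (rule Max_eqI)
    have sub: "k \<le> j" if "T k \<le> b" for k
      using that \<open>b < T (Suc j)\<close> strict_mono_less[OF sT, of k "Suc j"] by simp
    then have "range T \<inter> {0..b} \<subseteq> T ` {..j}" by auto
    then show "finite (range T \<inter> {0..b})" by (rule finite_subset) simp
    show "y \<le> T j" if "y \<in> range T \<inter> {0..b}" for y
      using that sub strict_mono_less_eq[OF sT] by auto
    show "T j \<in> range T \<inter> {0..b}" using admissible_nonneg[OF T, of j] \<open>T j \<le> b\<close> by simp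
  qed
  have "event_grid T \<phi> (\<tau>' + \<tau>o) \<eta>"
    unfolding event_grid_def
  proof (intro conjI allI impI)
    have "\<kappa> 0 = 0" unfolding \<kappa>_def using limT(2) limTs(2) by (intro Least_equality) auto
    then show "\<phi> 0 = 0" by (simp add: \<phi>_def limTs)
    show "filterlim \<phi> at_top sequentially"
      by (rule filterlim_at_top_mono[OF limT(1)]) (use \<kappa> in \<open>simp add: \<phi>_def\<close>)
    fix j
    show "T j \<le> \<phi> j" using \<kappa> by (simp add: \<phi>_def)
    show "T j < T (Suc j)" by (rule strict_monoD[OF sT lessI])
    show "\<phi> j \<le> \<phi> (Suc j)" using strict_mono_less_eq[OF sTs] mono by (simp add: \<phi>_def)
    show "\<phi> (Suc j) - \<phi> j \<le> \<tau>' + \<tau>o" using bnd(1)[of j] bnd(2)[of "Suc j"] \<open>T j \<le> \<phi> j\<close> by linarith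
    assume "\<phi> j < \<phi> (Suc j)"
    \<comment> \<open>By minimality of \<open>\<kappa> (Suc j)\<close>, an event of
      \<open>Ts\<close> with smaller index precedes \<open>T (Suc j)\<close>. Hence
      \<open>T j\<close> is the last event of \<open>T\<close> up to \<open>\<phi> j\<close>, and
      the bound on the age of the sample applies.\<close>
    then have "\<kappa> j < \<kappa> (Suc j)" using strict_mono_less[OF sTs] by (simp add: \<phi>_def)
    then show less: "\<phi> j < T (Suc j)" unfolding \<phi>_def by (rule \<kappa>_less)
    show "\<phi> j - T j \<le> \<eta>" using bnd(3)[of j] last[OF \<open>T j \<le> \<phi> j\<close> less] by simp
  qed (use limT pos in auto)
  moreover have "hold Ts (sample Ts (hold T a)) t = a j" if t: "\<phi> j \<le> t" "t < \<phi> (Suc j)" for a j t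
  proof -
    have "0 \<le> t" using t(1) admissible_nonneg[OF Ts, of "\<kappa> j"] by (simp add: \<phi>_def)
    then obtain k where k: "Ts k \<le> t" "t < Ts (Suc k)"
      using interval_index[of Ts t] limTs by auto
    have "\<phi> j < Ts (Suc k)" "Ts k < \<phi> (Suc j)" using k t by auto
    then have "\<kappa> j \<le> k" "k < \<kappa> (Suc j)"
      unfolding \<phi>_def strict_mono_less[OF sTs] by auto
    then have "T j \<le> Ts k" "Ts k < T (Suc j)"
      using \<kappa>[of j] strict_mono_less_eq[OF sTs, of "\<kappa> j" k] \<kappa>_less[of k "Suc j"] by auto
    then have "hold T a (Ts k) = a j" by (rule hold_eq[OF T])
    then show ?thesis
      using sample_right_continuous[of "hold T a" Ts k] hold_right_continuous[OF T]
        admissible_nonneg[OF Ts, of k] hold_eq[OF Ts k] by simp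
  qed
  ultimately show ?thesis by (rule that)
qed


section \<open>Gain and passivity of the sampling error\<close>

lemma energy_minkowski:
  assumes f: "f \<in> loc_L2" and g: "g \<in> loc_L2"
  shows "sqrt (energy (\<lambda>t. f t + g t) T) \<le> sqrt (energy f T) + sqrt (energy g T)"
proof (rule real_le_lsqrt)
  let ?A = "energy f T" and ?B = "energy g T" and ?P = "integral {0..T} (\<lambda>t. f t \<bullet> g t)"
  have A: "0 \<le> ?A" and B: "0 \<le> ?B" by (rule energy_nonneg[OF f], rule energy_nonneg[OF g])
  note ig = loc_L2_square_integrable[OF f order_refl, of T] loc_L2_square_integrable[OF g order_refl, of T]
    loc_L2_inner_integrable[OF f g order_refl, of T]
  have "?P\<^sup>2 \<le> ?A * ?B"
    using integral_cauchy_schwarz[OF f g order_refl, of T] by (simp add: energy_def)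
  then have P: "?P \<le> sqrt ?A * sqrt ?B"
    unfolding real_sqrt_mult[symmetric] by (rule real_le_rsqrt)
  have "energy (\<lambda>t. f t + g t) T
    = integral {0..T} (\<lambda>t. (norm (f t))\<^sup>2 + (norm (g t))\<^sup>2 + 2 * (f t \<bullet> g t))"
    unfolding energy_def power2_norm_eq_inner
    by (rule integral_cong) (simp add: inner_add_left inner_add_right inner_commute)
  also have "\<dots> = ?A + ?B + 2 * ?P"
    unfolding energy_def
    by (simp only: integral_add[OF integrable_add[OF ig(1,2)] integrable_on_mult_right[OF ig(3)]]
        integral_add[OF ig(1,2)] integral_mult_right)
  also have "\<dots> \<le> ?A + ?B + 2 * (sqrt ?A * sqrt ?B)" using P by simp
  also have "\<dots> = (sqrt ?A + sqrt ?B)\<^sup>2" using A B by (simp add: power2_sum)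
  finally show "energy (\<lambda>t. f t + g t) T \<le> (sqrt ?A + sqrt ?B)\<^sup>2" .
qed (use energy_nonneg[OF f] energy_nonneg[OF g] in auto)

text \<open>Schur test for the Volterra operator with the weight \<open>cos (c (t - a))\<close>.\<close>

lemma wirtinger_strict:
  fixes v :: "real \<Rightarrow> real"
  assumes v: "v \<in> loc_L2" and ab: "0 \<le> a" "a \<le> b" and c: "0 < c" "c * (b - a) < pi / 2"
  shows "c\<^sup>2 * integral {a..b} (\<lambda>t. (integral {a..t} v)\<^sup>2) \<le> integral {a..b} (\<lambda>t. (v t)\<^sup>2)"
proof -
  \<comment> \<open>A quarter of a cosine period: positive up to \<open>b\<close> because
    \<open>c * (b - a) < pi / 2\<close>, and satisfying \<open>p'' = - c^2 p\<close>.\<close>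
  define p where "p = (\<lambda>t. cos (c * (t - a)))"
  define q where "q = (\<lambda>t. (v t)\<^sup>2 / p t)"
  have arg: "0 \<le> c * (t - a)" "c * (t - a) < pi / 2" if "t \<in> {a..b}" for t
  proof -
    show "0 \<le> c * (t - a)" using that c by simp
    have "c * (t - a) \<le> c * (b - a)" using that c by (intro mult_left_mono) auto
    then show "c * (t - a) < pi / 2" using c by linarith
  qed
  have ppos: "0 < p t" if "t \<in> {a..b}" for t
    unfolding p_def using arg[OF that] by (intro cos_gt_zero_pi) auto
  have pcont: "continuous_on S p" for S unfolding p_def by (intro continuous_intros)
  have v2: "(\<lambda>t. (v t)\<^sup>2) absolutely_integrable_on {a..b}"
    using loc_L2_square_integrable[OF v ab(1), of b] by (intro nonnegative_absolutely_integrable_1) auto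
  have q: "q absolutely_integrable_on {a..b}"
  proof -
    have ci: "continuous_on {a..b} (\<lambda>t. 1 / p t)"
      using ppos by (intro continuous_intros pcont) (auto simp: less_imp_neq[symmetric])
    have "(\<lambda>t. (1 / p t) * (v t)\<^sup>2) absolutely_integrable_on {a..b}"
    proof (rule absolutely_integrable_bounded_measurable_product_real[OF _ _ _ v2])
      show "(\<lambda>t. 1 / p t) \<in> borel_measurable (lebesgue_on {a..b})"
        by (rule continuous_imp_measurable_on_sets_lebesgue[OF ci]) simp
      show "bounded ((\<lambda>t. 1 / p t) ` {a..b})"
        by (intro compact_imp_bounded compact_continuous_image ci) simp
    qed simp
    then show ?thesis by (simp add: q_def)
  qed
  have qsub: "q integrable_on {a..t}" if "t \<in> {a..b}" for t
    by (rule integrable_on_subinterval[of q "{a..b}"]) (use q that in \<open>auto simp: absolutely_integrable_on_def\<close>)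
  have P: "integral {a..t} p = sin (c * (t - a)) / c" if "a \<le> t" for t
  proof -
    have "(p has_integral (sin (c * (t - a)) / c - sin (c * (a - a)) / c)) {a..t}"
      unfolding p_def using that c(1)
      by (intro fundamental_theorem_of_calculus)
        (auto intro!: derivative_eq_intros simp: has_real_derivative_iff_has_vector_derivative[symmetric])
    then show ?thesis by (simp add: integral_unique)
  qed
  define P where "P = (\<lambda>t. sin (c * (t - a)) / c)"
  have S: "integral {a..t} P = (1 - cos (c * (t - a))) / c\<^sup>2" if "a \<le> t" for t
  proof -
    have "(P has_integral (- cos (c * (t - a)) / c\<^sup>2 - - cos (c * (a - a)) / c\<^sup>2)) {a..t}"
      unfolding P_def using that c(1)
      by (intro fundamental_theorem_of_calculus)
        (auto intro!: derivative_eq_intros simp: has_real_derivative_iff_has_vector_derivative[symmetric] power2_eq_square)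
    then show ?thesis using c(1) by (simp add: integral_unique diff_divide_distrib)
  qed
  have Pi: "P absolutely_integrable_on {a..b}"
    unfolding P_def by (intro absolutely_integrable_continuous_real continuous_intros) (use c in auto)
  \<comment> \<open>Cauchy-Schwarz after writing \<open>v\<close> as \<open>sqrt p\<close> times
    \<open>v / sqrt p\<close>; the integral of the weight is the sine \<open>P\<close>.\<close>
  have cs: "(integral {a..t} v)\<^sup>2 \<le> integral {a..t} q * P t" if t: "t \<in> {a..b}" for t
  proof -
    have sub: "s \<in> {a..b}" if "s \<in> {a..t}" for s using that t by auto
    have e1: "(norm (sqrt (p s)))\<^sup>2 = p s" "(norm (v s / sqrt (p s)))\<^sup>2 = q s"
      "sqrt (p s) \<bullet> (v s / sqrt (p s)) = v s" if "s \<in> {a..t}" for s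
      using ppos[OF sub[OF that]] by (auto simp: q_def power_divide)
    have "(integral {a..t} (\<lambda>s. sqrt (p s) \<bullet> (v s / sqrt (p s))))\<^sup>2
      \<le> integral {a..t} (\<lambda>s. (norm (sqrt (p s)))\<^sup>2) * integral {a..t} (\<lambda>s. (norm (v s / sqrt (p s)))\<^sup>2)"
    proof (rule integral_Cauchy_Schwarz_general)
      show "(\<lambda>s. (norm (sqrt (p s)))\<^sup>2) integrable_on {a..t}"
        by (subst integrable_cong[OF e1(1)]) (auto intro: integrable_continuous_real pcont)
      show "(\<lambda>s. (norm (v s / sqrt (p s)))\<^sup>2) integrable_on {a..t}"
        by (subst integrable_cong[OF e1(2)]) (auto intro: qsub[OF t])
      show "(\<lambda>s. sqrt (p s) \<bullet> (v s / sqrt (p s))) integrable_on {a..t}"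
        by (subst integrable_cong[OF e1(3)]) (auto intro: loc_L2_integrable[OF v ab(1)])
    qed
    also have "integral {a..t} (\<lambda>s. (norm (sqrt (p s)))\<^sup>2) = integral {a..t} p"
      by (rule integral_cong[OF e1(1)])
    also have "integral {a..t} p = P t" using P[of t] t by (simp add: P_def)
    also have "integral {a..t} (\<lambda>s. (norm (v s / sqrt (p s)))\<^sup>2) = integral {a..t} q"
      by (rule integral_cong[OF e1(2)])
    also have "integral {a..t} (\<lambda>s. sqrt (p s) \<bullet> (v s / sqrt (p s))) = integral {a..t} v"
      by (rule integral_cong[OF e1(3)])
    finally show ?thesis by (simp add: mult.commute)
  qed
  have Vc: "continuous_on {a..b} (\<lambda>t. (integral {a..t} v)\<^sup>2)"
    by (intro continuous_intros indefinite_integral_continuous_1 loc_L2_integrable v ab)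
  have prod1: "(\<lambda>t. integral {a..t} q * P t) integrable_on {a..b}"
    using integral_product_rule_real(2)[OF q Pi] by (simp add: absolutely_integrable_on_def)
  have prod2: "(\<lambda>t. q t * integral {a..t} P) integrable_on {a..b}"
    using integral_product_rule_real(2)[OF Pi q] by (simp add: absolutely_integrable_on_def mult.commute)
  have qi: "q integrable_on {a..b}" using qsub ab by simp
  have "integral {a..b} (\<lambda>t. (integral {a..t} v)\<^sup>2) \<le> integral {a..b} (\<lambda>t. integral {a..t} q * P t)"
    by (rule integral_le[OF integrable_continuous_real[OF Vc] prod1 cs])
  \<comment> \<open>Integration by parts leaves \<open>q\<close> times the integral of
    \<open>P\<close> over \<open>[t, b]\<close>. That integral is \<open>(p t - p b) / c^2\<close>,
    at most \<open>p t / c^2\<close>, and the weight cancels against the one in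
    \<open>q\<close>.\<close>
  also have "\<dots> = integral {a..b} q * integral {a..b} P - integral {a..b} (\<lambda>t. q t * integral {a..t} P)"
    using integral_product_rule_real(1)[OF q Pi] by simp
  also have "\<dots> = integral {a..b} (\<lambda>t. q t * integral {a..b} P - q t * integral {a..t} P)"
    using integral_diff[OF integrable_on_mult_left[OF qi] prod2, of "integral {a..b} P"] by simp
  also have "\<dots> \<le> integral {a..b} (\<lambda>t. (1 / c\<^sup>2) * (v t)\<^sup>2)"
  proof (rule integral_le)
    show "(\<lambda>t. q t * integral {a..b} P - q t * integral {a..t} P) integrable_on {a..b}"
      by (rule integrable_diff[OF integrable_on_mult_left[OF qi] prod2])
    show "(\<lambda>t. (1 / c\<^sup>2) * (v t)\<^sup>2) integrable_on {a..b}"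
      using v2 by (intro integrable_on_mult_right) (simp add: absolutely_integrable_on_def)
    fix t assume t: "t \<in> {a..b}"
    have "integral {a..b} P - integral {a..t} P = (p t - p b) / c\<^sup>2"
      using t by (simp add: S p_def diff_divide_distrib)
    also have "\<dots> \<le> p t / c\<^sup>2"
      using ppos[of b] ab c by (intro divide_right_mono) auto
    finally have "q t * (integral {a..b} P - integral {a..t} P) \<le> q t * (p t / c\<^sup>2)"
      using ppos[OF t] by (intro mult_left_mono) (auto simp: q_def)
    also have "\<dots> = (1 / c\<^sup>2) * (v t)\<^sup>2" using ppos[OF t] by (simp add: q_def)
    finally show "q t * integral {a..b} P - q t * integral {a..t} P \<le> (1 / c\<^sup>2) * (v t)\<^sup>2"
      by (simp add: right_diff_distrib)
  qed
  also have "\<dots> = (1 / c\<^sup>2) * integral {a..b} (\<lambda>t. (v t)\<^sup>2)" by (rule integral_mult_right)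
  finally show ?thesis using c(1) by (simp add: field_simps)
qed

text \<open>The antiderivative vanishes at the left end only, so the critical length is a quarter
  period, \<open>c * L = pi / 2\<close>. There the cosine weight can vanish at the right end; the
  constant is therefore reached as a limit, scaling \<open>c^2\<close> by
  \<open>z < 1\<close>.\<close>

lemma wirtinger:
  fixes v :: "real \<Rightarrow> real"
  assumes v: "v \<in> loc_L2" and ab: "0 \<le> a" "a \<le> b" "b - a \<le> L" and L: "0 < L"
  shows "integral {a..b} (\<lambda>t. (integral {a..t} v)\<^sup>2) \<le> (2 * L / pi)\<^sup>2 * integral {a..b} (\<lambda>t. (v t)\<^sup>2)"
proof -
  let ?I = "integral {a..b} (\<lambda>t. (integral {a..t} v)\<^sup>2)"
  have "(pi / (2 * L))\<^sup>2 * ?I \<le> integral {a..b} (\<lambda>t. (v t)\<^sup>2)"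
  proof (rule field_le_mult_one_interval)
    fix z :: real assume z: "0 < z" "z < 1"
    define c where "c = sqrt z * (pi / (2 * L))"
    have c: "0 < c" using z L by (simp add: c_def)
    have "c * (b - a) \<le> c * L" using c ab by (intro mult_left_mono) auto
    also have "c * L = sqrt z * (pi / 2)" using L by (simp add: c_def)
    also have "\<dots> < 1 * (pi / 2)" using z by (intro mult_strict_right_mono) auto
    finally have "c\<^sup>2 * ?I \<le> integral {a..b} (\<lambda>t. (v t)\<^sup>2)"
      by (intro wirtinger_strict v ab c) simp
    moreover have "c\<^sup>2 = z * (pi / (2 * L))\<^sup>2" unfolding c_def power_mult_distrib using z by simp
    ultimately show "z * ((pi / (2 * L))\<^sup>2 * ?I) \<le> integral {a..b} (\<lambda>t. (v t)\<^sup>2)" by (simp add: mult.assoc)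
  qed
  then show ?thesis using L by (simp add: power_divide power_mult_distrib field_simps)
qed

section \<open>Estimates along the event grid\<close>

lemma event_gridD:
  assumes "event_grid T \<phi> L \<eta>"
  shows "\<phi> 0 = 0" "T 0 = 0" "0 < L" "0 \<le> \<eta>" "T j \<le> \<phi> j" "T j < T (Suc j)" "\<phi> j \<le> \<phi> (Suc j)"
    "\<phi> (Suc j) - \<phi> j \<le> L" "\<phi> j < \<phi> (Suc j) \<Longrightarrow> \<phi> j < T (Suc j)"
    "\<phi> j < \<phi> (Suc j) \<Longrightarrow> \<phi> j - T j \<le> \<eta>" "filterlim \<phi> at_top sequentially"
  using assms unfolding event_grid_def by blast+

lemma event_grid_nonneg:
  assumes "event_grid T \<phi> L \<eta>"
  shows "0 \<le> T j" "0 \<le> \<phi> j"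
proof -
  show *: "0 \<le> T j" for j
  proof (induction j)
    case (Suc j)
    then show ?case using event_gridD(6)[OF assms, of j] by linarith
  qed (simp add: event_gridD(2)[OF assms])
  show "0 \<le> \<phi> j" using *[of j] event_gridD(5)[OF assms, of j] by linarith
qed

lemma event_grid_index:
  assumes "event_grid T \<phi> L \<eta>" "0 \<le> t"
  obtains j where "\<phi> j \<le> t" "t < \<phi> (Suc j)"
  using interval_index[of \<phi> t] event_gridD(1,11)[OF assms(1)] assms(2) by metis

lemma event_grid_step_measurable:
  fixes f c :: "_ \<Rightarrow> real"
  assumes g: "event_grid T \<phi> L \<eta>" and f: "\<And>j t. \<phi> j \<le> t \<Longrightarrow> t < \<phi> (Suc j) \<Longrightarrow> f t = c j"
  shows "f \<in> borel_measurable halfline"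
proof (rule borel_measurable_LIMSEQ_real[of halfline "\<lambda>n t. \<Sum>j<n. indicator {\<phi> j..<\<phi> (Suc j)} t * c j"])
  have mono: "mono \<phi>" using event_gridD(7)[OF g] by (simp add: mono_iff_le_Suc)
  fix t assume "t \<in> space halfline"
  then obtain k where k: "\<phi> k \<le> t" "t < \<phi> (Suc k)"
    using event_grid_index[OF g, of t] by (auto simp: space_restrict_space)
  have other: "indicator {\<phi> j..<\<phi> (Suc j)} t * c j = 0" if "j \<noteq> k" for j
  proof (cases "j < k")
    case True
    then have "\<phi> (Suc j) \<le> \<phi> k" using mono by (simp add: mono_def)
    then show ?thesis using k by simp
  next
    case False
    then have "\<phi> (Suc k) \<le> \<phi> j" using mono that by (simp add: mono_def)
    then show ?thesis using k by simp
  qed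
  have "\<forall>\<^sub>F n in sequentially. k < n" by (rule eventually_gt_at_top)
  then have "\<forall>\<^sub>F n in sequentially. (\<Sum>j<n. indicator {\<phi> j..<\<phi> (Suc j)} t * c j) = f t"
  proof (rule eventually_mono)
    fix n assume "k < n"
    then have "(\<Sum>j<n. indicator {\<phi> j..<\<phi> (Suc j)} t * c j) = (\<Sum>j\<in>{k}. indicator {\<phi> j..<\<phi> (Suc j)} t * c j)"
      by (intro sum.mono_neutral_right) (use other in auto)
    then show "(\<Sum>j<n. indicator {\<phi> j..<\<phi> (Suc j)} t * c j) = f t" using k f[OF k] by simp
  qed
  then show "(\<lambda>n. \<Sum>j<n. indicator {\<phi> j..<\<phi> (Suc j)} t * c j) \<longlonglongrightarrow> f t" by (rule tendsto_eventually)
next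
  have [measurable]: "(\<lambda>t. indicat_real {\<phi> j..<\<phi> (Suc j)} t) \<in> borel_measurable halfline" for j
    by (intro measurable_restrict_space1 measurable_completion) auto
  show "(\<lambda>t. \<Sum>j<n. indicator {\<phi> j..<\<phi> (Suc j)} t * c j) \<in> borel_measurable halfline" for n
    by measurable
qed

text \<open>For nonempty grid intervals, \<open>\<phi> j < T (Suc j)\<close>, so the intervals
  \<open>[T j, \<phi> j]\<close> do not overlap and their energies add up to at most the energy up
  to \<open>b\<close>. Empty grid intervals contribute nothing. The lemma serves both the gain of
  the constant part of the error and passivity.\<close>

lemma event_grid_bound:
  fixes v f :: "real \<Rightarrow> real"
  assumes g: "event_grid T \<phi> L \<eta>" and v: "v \<in> loc_L2" and k: "0 \<le> k"
    and f: "\<And>b. f integrable_on {0..b}"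
    and step: "\<And>j b. \<phi> j < b \<Longrightarrow> b \<le> \<phi> (Suc j) \<Longrightarrow>
       integral {\<phi> j..b} f \<le> k * integral {T j..\<phi> j} (\<lambda>t. (v t)\<^sup>2)"
    and b: "0 \<le> b"
  shows "integral {0..b} f \<le> k * energy v b"
proof -
  note D = event_gridD[OF g]
  have split: "integral {0..b} f = integral {0..\<phi> j} f + integral {\<phi> j..b} f" if "\<phi> j \<le> b" for j b
    using event_grid_nonneg[OF g] that
    by (intro Henstock_Kurzweil_Integration.integral_combine[symmetric] f) auto
  have E: "energy v (\<phi> j) = energy v (T j) + integral {T j..\<phi> j} (\<lambda>t. (v t)\<^sup>2)" for j
    using energy_split[OF v event_grid_nonneg(1)[OF g] D(5), of j] by simp
  \<comment> \<open>The energy on the right stops at \<open>T j\<close> rather than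
    \<open>\<phi> j\<close>, so that the energy on \<open>[T j, \<phi> j]\<close> is still unspent
    when the next grid interval is added.\<close>
  have J: "integral {0..\<phi> j} f \<le> k * energy v (T j)" for j
  proof (induction j)
    case 0
    then show ?case using D(1,2) by (simp add: energy_def)
  next
    case (Suc j)
    show ?case
    proof (cases "\<phi> j < \<phi> (Suc j)")
      case True
      have "integral {0..\<phi> (Suc j)} f \<le> k * energy v (T j) + k * integral {T j..\<phi> j} (\<lambda>t. (v t)\<^sup>2)"
        using split[OF D(7)[of j]] Suc.IH step[OF True order_refl] by linarith
      also have "\<dots> = k * energy v (\<phi> j)" by (simp add: E algebra_simps)
      also have "\<dots> \<le> k * energy v (T (Suc j))"
        using D(9)[OF True] by (intro mult_left_mono energy_mono v k) auto
      finally show ?thesis .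
    next
      case False
      then have "\<phi> (Suc j) = \<phi> j" using D(7)[of j] by simp
      moreover have "k * energy v (T j) \<le> k * energy v (T (Suc j))"
        using D(6)[of j] by (intro mult_left_mono energy_mono v k) auto
      ultimately show ?thesis using Suc.IH by simp
    qed
  qed
  obtain j where j: "\<phi> j \<le> b" "b < \<phi> (Suc j)" by (rule event_grid_index[OF g b])
  have "integral {\<phi> j..b} f \<le> k * integral {T j..\<phi> j} (\<lambda>t. (v t)\<^sup>2)"
  proof (cases "\<phi> j = b")
    case True
    have "0 \<le> integral {T j..\<phi> j} (\<lambda>t. (v t)\<^sup>2)"
      using loc_L2_square_integrable[OF v event_grid_nonneg(1)[OF g]] by (intro integral_nonneg) auto
    then show ?thesis using True k by simp
  next
    case False
    then show ?thesis using j by (intro step) auto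
  qed
  then have "integral {0..b} f \<le> k * energy v (\<phi> j)"
    using split[OF j(1)] J[of j] by (simp add: E distrib_left)
  also have "\<dots> \<le> k * energy v b" using j(1) by (intro mult_left_mono energy_mono v k)
  finally show ?thesis .
qed

section \<open>The sampling error and its two parts\<close>

locale sampling_error =
  fixes T \<phi> :: "nat \<Rightarrow> real" and L \<eta> :: real and v w :: "real \<Rightarrow> real"
  assumes grid: "event_grid T \<phi> L \<eta>" and v: "v \<in> loc_L2"
    and w: "\<And>j t. \<phi> j \<le> t \<Longrightarrow> t < \<phi> (Suc j) \<Longrightarrow> w t = integral {T j..t} v"
begin

lemmas D = event_gridD[OF grid]
lemmas nonneg = event_grid_nonneg[OF grid]

lemma v_integrable: "0 \<le> a \<Longrightarrow> v integrable_on {a..b}"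
  by (rule loc_L2_integrable[OF v])

lemma sum_integrals: "\<phi> j \<le> t \<Longrightarrow> integral {T j..t} v = integral {T j..\<phi> j} v + integral {\<phi> j..t} v"
  using D(5)[of j] nonneg[of j]
  by (intro Henstock_Kurzweil_Integration.integral_combine[symmetric] v_integrable) auto

definition index :: "real \<Rightarrow> nat" where
  "index t = (LEAST j. t < \<phi> (Suc j))"

lemma index_eq:
  assumes "\<phi> j \<le> t" "t < \<phi> (Suc j)"
  shows "index t = j"
  unfolding index_def
proof (rule Least_equality)
  show "t < \<phi> (Suc j)" by (rule assms(2))
  have mono: "mono \<phi>" using D(7) by (simp add: mono_iff_le_Suc)
  fix k assume "t < \<phi> (Suc k)"
  then have "\<not> \<phi> (Suc k) \<le> \<phi> j" using assms(1) by simp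
  then have "\<not> Suc k \<le> j" using mono by (auto simp: mono_def)
  then show "j \<le> k" by simp
qed

text \<open>The error is split at \<open>\<phi> j\<close>: \<open>w2\<close> holds its value at the
  start of the grid interval, and \<open>w1\<close> restarts from zero there, as Wirtinger's
  inequality requires.\<close>

definition w2 :: "real \<Rightarrow> real" where "w2 t = integral {T (index t)..\<phi> (index t)} v"
definition w1 :: "real \<Rightarrow> real" where "w1 t = w t - w2 t"

lemma w2_eq: "\<phi> j \<le> t \<Longrightarrow> t < \<phi> (Suc j) \<Longrightarrow> w2 t = integral {T j..\<phi> j} v"
  by (simp add: w2_def index_eq)

lemma w1_eq: "\<phi> j \<le> t \<Longrightarrow> t < \<phi> (Suc j) \<Longrightarrow> w1 t = integral {\<phi> j..t} v"
  using sum_integrals[of j t] by (simp add: w1_def w2_eq w)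

lemma integral_bounded:
  assumes "0 \<le> a" "a \<le> b" "b \<le> c"
  shows "\<bar>integral {a..b} v\<bar> \<le> integral {0..c} (\<lambda>t. \<bar>v t\<bar>)"
proof -
  have i: "(\<lambda>t. \<bar>v t\<bar>) integrable_on {p..q}" if "0 \<le> p" for p q
    using loc_L2_absolutely_integrable[OF v that, of q] by (simp add: absolutely_integrable_on_def)
  have "norm (integral {a..b} v) \<le> integral {a..b} (\<lambda>t. \<bar>v t\<bar>)"
    using assms by (intro integral_norm_bound_integral v_integrable i) auto
  also have "\<dots> \<le> integral {0..c} (\<lambda>t. \<bar>v t\<bar>)"
    using assms by (intro integral_subset_le i) auto
  finally show ?thesis by simp
qed

lemma w2_loc_L2: "w2 \<in> loc_L2"
proof (rule loc_L2_bounded)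
  show "w2 \<in> borel_measurable halfline"
    using w2_eq by (rule event_grid_step_measurable[OF grid, where c = "\<lambda>j. integral {T j..\<phi> j} v"])
  fix b :: real assume b: "0 \<le> b"
  have "norm (w2 t) \<le> integral {0..b} (\<lambda>t. \<bar>v t\<bar>)" if t: "t \<in> {0..b}" for t
  proof -
    obtain j where j: "\<phi> j \<le> t" "t < \<phi> (Suc j)" using event_grid_index[OF grid, of t] t by auto
    show ?thesis using integral_bounded[of "T j" "\<phi> j" b] nonneg[of j] D(5)[of j] j t w2_eq[OF j] by simp
  qed
  then show "\<exists>B. \<forall>t\<in>{0..b}. norm (w2 t) \<le> B" by blast
qed

text \<open>On the half-line \<open>w1\<close> is a continuous indefinite integral minus a step
  function on the grid, which settles measurability.\<close>

lemma w1_loc_L2: "w1 \<in> loc_L2"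
proof -
  define s where "s t = integral {0..\<phi> (index t)} v" for t
  have s: "s t = integral {0..\<phi> j} v" if "\<phi> j \<le> t" "t < \<phi> (Suc j)" for j t
    using that by (simp add: s_def index_eq)
  have sL: "s \<in> loc_L2"
  proof (rule loc_L2_bounded)
    show "s \<in> borel_measurable halfline" 
      using s by (rule event_grid_step_measurable[OF grid, where c = "\<lambda>j. integral {0..\<phi> j} v"])
    fix b :: real assume b: "0 \<le> b"
    have "norm (s t) \<le> integral {0..b} (\<lambda>t. \<bar>v t\<bar>)" if t: "t \<in> {0..b}" for t
    proof -
      obtain j where j: "\<phi> j \<le> t" "t < \<phi> (Suc j)" using event_grid_index[OF grid, of t] t by auto
      show ?thesis using integral_bounded[of 0 "\<phi> j" b] nonneg[of j] j t s[OF j] by simp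
    qed
    then show "\<exists>B. \<forall>t\<in>{0..b}. norm (s t) \<le> B" by blast
  qed
  have "(\<lambda>t. integral {0..t} v - s t) \<in> loc_L2"
    by (rule loc_L2_diff[OF indefinite_integral_loc_L2[OF v] sL])
  then show ?thesis
  proof (rule loc_L2_AE)
    show "AE t in halfline. integral {0..t} v - s t = w1 t"
    proof (rule AE_I2)
      fix t assume "t \<in> space halfline"
      then have t: "0 \<le> t" by (simp add: space_restrict_space)
      obtain j where j: "\<phi> j \<le> t" "t < \<phi> (Suc j)" using event_grid_index[OF grid t] by auto
      have "integral {0..\<phi> j} v + integral {\<phi> j..t} v = integral {0..t} v"
        using nonneg[of j] j by (intro Henstock_Kurzweil_Integration.integral_combine v_integrable) auto
      then show "integral {0..t} v - s t = w1 t" by (simp add: s[OF j] w1_eq[OF j])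
    qed
  qed
qed

lemma w_sum: "w = (\<lambda>t. w1 t + w2 t)"
  by (simp add: w1_def)

lemma w_loc_L2: "w \<in> loc_L2"
  by (subst w_sum) (rule loc_L2_add[OF w1_loc_L2 w2_loc_L2])

lemma energy_w1: "0 \<le> b \<Longrightarrow> energy w1 b \<le> (2 * L / pi)\<^sup>2 * energy v b"
proof -
  have step: "integral {\<phi> j..b} (\<lambda>t. (norm (w1 t))\<^sup>2) \<le> (2 * L / pi)\<^sup>2 * integral {\<phi> j..b} (\<lambda>t. (norm (v t))\<^sup>2)"
    if b: "\<phi> j \<le> b" "b \<le> \<phi> (Suc j)" for j b
  proof -
    \<comment> \<open>The formula for \<open>w1\<close> excludes the right end of the grid interval,
      which is the point \<open>b\<close> when \<open>b = \<phi> (Suc j)\<close>.\<close>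
    have "integral {\<phi> j..b} (\<lambda>t. (norm (w1 t))\<^sup>2) = integral {\<phi> j..b} (\<lambda>t. (integral {\<phi> j..t} v)\<^sup>2)"
      by (rule integral_spike[of "{b}"]) (use b w1_eq[of j] in auto)
    also have "\<dots> \<le> (2 * L / pi)\<^sup>2 * integral {\<phi> j..b} (\<lambda>t. (v t)\<^sup>2)"
      using b nonneg[of j] D(3) D(8)[of j] by (intro wirtinger v) auto
    finally show ?thesis by simp
  qed
  have extend: "energy w1 b \<le> (2 * L / pi)\<^sup>2 * energy v b"
    if "energy w1 (\<phi> j) \<le> (2 * L / pi)\<^sup>2 * energy v (\<phi> j)" "\<phi> j \<le> b" "b \<le> \<phi> (Suc j)" for j b
    using energy_split[OF w1_loc_L2 nonneg(2) that(2)] energy_split[OF v nonneg(2) that(2)]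
      step[OF that(2,3)] that(1) by (simp add: distrib_left)
  have J: "energy w1 (\<phi> j) \<le> (2 * L / pi)\<^sup>2 * energy v (\<phi> j)" for j
  proof (induction j)
    case 0
    then show ?case by (simp add: D(1) energy_def)
  next
    case (Suc j)
    then show ?case by (rule extend[OF _ D(7) order_refl])
  qed
  assume "0 \<le> b"
  obtain j where j: "\<phi> j \<le> b" "b < \<phi> (Suc j)" using event_grid_index[OF grid \<open>0 \<le> b\<close>] by blast
  then show ?thesis by (intro extend[OF J]) auto
qed

text \<open>The constant on a grid interval has, by Cauchy-Schwarz over
  \<open>[T j, \<phi> j]\<close>, a square of at most \<eta> times the energy of \<open>v\<close>
  there, and it lasts for at most \<open>L\<close>.\<close>

lemma energy_w2:
  assumes "0 \<le> b"
  shows "energy w2 b \<le> L * \<eta> * energy v b"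
  unfolding energy_def[of w2]
proof (rule event_grid_bound[OF grid v, where f = "\<lambda>t. (norm (w2 t))\<^sup>2" and k = "L * \<eta>"])
  show "0 \<le> b" by (rule assms)
  show "0 \<le> L * \<eta>" using D(3,4) by simp
  show "(\<lambda>t. (norm (w2 t))\<^sup>2) integrable_on {0..b}" for b
    by (rule loc_L2_square_integrable[OF w2_loc_L2 order_refl])
  fix j b assume b: "\<phi> j < b" "b \<le> \<phi> (Suc j)"
  then have lt: "\<phi> j < \<phi> (Suc j)" by simp
  let ?I = "integral {T j..\<phi> j} (\<lambda>t. (v t)\<^sup>2)"
  have I: "0 \<le> ?I" using loc_L2_square_integrable[OF v nonneg(1)] by (intro integral_nonneg) auto
  have "integral {\<phi> j..b} (\<lambda>t. (norm (w2 t))\<^sup>2) = integral {\<phi> j..b} (\<lambda>t. (integral {T j..\<phi> j} v)\<^sup>2)"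
    by (rule integral_spike[of "{b}"]) (use b w2_eq[of j] in auto)
  also have "\<dots> = (b - \<phi> j) * (integral {T j..\<phi> j} v)\<^sup>2" using b by simp
  also have "(integral {T j..\<phi> j} v)\<^sup>2 \<le> (\<phi> j - T j) * ?I"
    using integral_square_le[OF v nonneg(1) D(5), of j] by simp
  also have "(\<phi> j - T j) * ?I \<le> \<eta> * ?I" using D(10)[OF lt] I by (intro mult_right_mono)
  also have "(b - \<phi> j) * (\<eta> * ?I) \<le> L * (\<eta> * ?I)"
    using b D(8)[of j] D(4) I by (intro mult_right_mono) auto
  finally show "integral {\<phi> j..b} (\<lambda>t. (norm (w2 t))\<^sup>2) \<le> L * \<eta> * ?I" using b by (simp add: mult.assoc)
qed

lemma gain:
  assumes "0 \<le> b"
  shows "energy w b \<le> (2 * L / pi + sqrt (L * \<eta>))\<^sup>2 * energy v b"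
proof -
  have v0: "0 \<le> energy v b" by (rule energy_nonneg[OF v])
  have "sqrt (energy w b) \<le> sqrt (energy w1 b) + sqrt (energy w2 b)"
    using energy_minkowski[OF w1_loc_L2 w2_loc_L2] by (simp only: w_sum[symmetric])
  also have "\<dots> \<le> sqrt ((2 * L / pi)\<^sup>2 * energy v b) + sqrt (L * \<eta> * energy v b)"
    by (intro add_mono real_sqrt_le_mono energy_w1 energy_w2 assms)
  also have "\<dots> = (2 * L / pi + sqrt (L * \<eta>)) * sqrt (energy v b)"
    using D(3) by (simp add: real_sqrt_mult distrib_right)
  finally have "energy w b \<le> ((2 * L / pi + sqrt (L * \<eta>)) * sqrt (energy v b))\<^sup>2"
    using energy_nonneg[OF w_loc_L2, of b] D(3,4) by (simp add: sqrt_le_D)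
  then show ?thesis using v0 by (simp add: power_mult_distrib)
qed

text \<open>On a grid interval \<open>2 v w\<close> is the derivative of \<open>w\<^sup>2\<close>, so only the initial value of \<open>w\<^sup>2\<close> is lost.\<close>

lemma passivity:
  assumes "0 \<le> b"
  shows "0 \<le> integral {0..b} (\<lambda>t. 2 * (v t * w t)) + \<eta> * energy v b"
proof -
  have vw: "(\<lambda>t. v t * w t) integrable_on {a..b}" if "0 \<le> a" for a b
    using loc_L2_inner_integrable[OF v w_loc_L2 that] by simp
  have "integral {0..b} (\<lambda>t. - (2 * (v t * w t))) \<le> \<eta> * energy v b"
  proof (rule event_grid_bound[OF grid v D(4), where f = "\<lambda>t. - (2 * (v t * w t))"])
    show "0 \<le> b" by (rule assms)
    show "(\<lambda>t. - (2 * (v t * w t))) integrable_on {0..b}" for b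
      by (intro integrable_neg integrable_on_mult_right vw order_refl)
    fix j b assume b: "\<phi> j < b" "b \<le> \<phi> (Suc j)"
    then have lt: "\<phi> j < \<phi> (Suc j)" by simp
    let ?c = "integral {T j..\<phi> j} v" and ?x = "integral {\<phi> j..b} v"
    have c2: "?c\<^sup>2 \<le> \<eta> * integral {T j..\<phi> j} (\<lambda>t. (v t)\<^sup>2)"
    proof -
      have "?c\<^sup>2 \<le> (\<phi> j - T j) * integral {T j..\<phi> j} (\<lambda>t. (v t)\<^sup>2)"
        using integral_square_le[OF v nonneg(1) D(5), of j] by simp
      also have "\<dots> \<le> \<eta> * integral {T j..\<phi> j} (\<lambda>t. (v t)\<^sup>2)"
        using D(10)[OF lt] loc_L2_square_integrable[OF v nonneg(1)]
        by (intro mult_right_mono integral_nonneg) auto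
      finally show ?thesis .
    qed
    have vi: "v absolutely_integrable_on {\<phi> j..b}"
      by (rule loc_L2_absolutely_integrable[OF v nonneg(2)])
    have i1: "(\<lambda>t. integral {\<phi> j..t} v * v t) integrable_on {\<phi> j..b}"
      using integral_product_rule_real(2)[OF vi vi] by (simp add: absolutely_integrable_on_def)
    have "integral {\<phi> j..b} (\<lambda>t. 2 * (v t * w t))
      = integral {\<phi> j..b} (\<lambda>t. 2 * (integral {\<phi> j..t} v * v t) + (2 * ?c) * v t)"
    proof (rule integral_spike[of "{b}"])
      fix t assume "t \<in> {\<phi> j..b} - {b}"
      then have t: "\<phi> j \<le> t" "t < \<phi> (Suc j)" using b by auto
      show "2 * (integral {\<phi> j..t} v * v t) + 2 * ?c * v t = 2 * (v t * w t)"
        using w[OF t] sum_integrals[OF t(1)] by (simp add: algebra_simps)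
    qed simp
    also have "\<dots> = 2 * integral {\<phi> j..b} (\<lambda>t. integral {\<phi> j..t} v * v t) + (2 * ?c) * ?x"
      by (simp only: integral_add[OF integrable_on_mult_right[OF i1]
            integrable_on_mult_right[OF v_integrable[OF nonneg(2)]]] integral_mult_right)
    also have "2 * integral {\<phi> j..b} (\<lambda>t. integral {\<phi> j..t} v * v t) = ?x * ?x"
      using integral_product_rule_real(1)[OF vi vi] by (simp add: mult.commute)
    \<comment> \<open>\<open>?c\<close> is the value of the error at the start of the interval and
      \<open>?c + ?x\<close> its limit from the left at \<open>b\<close>.\<close>
    finally have "integral {\<phi> j..b} (\<lambda>t. 2 * (v t * w t)) = (?c + ?x)\<^sup>2 - ?c\<^sup>2"
      by (simp add: power2_eq_square algebra_simps)
    moreover have "integral {\<phi> j..b} (\<lambda>t. - (2 * (v t * w t))) = - integral {\<phi> j..b} (\<lambda>t. 2 * (v t * w t))"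
      by (rule integral_neg)
    ultimately show "integral {\<phi> j..b} (\<lambda>t. - (2 * (v t * w t))) \<le> \<eta> * integral {T j..\<phi> j} (\<lambda>t. (v t)\<^sup>2)"
      using c2 zero_le_power2[of "?c + ?x"] by linarith
  qed
  then show ?thesis by simp
qed

end


section \<open>Lyapunov's inequality for Hurwitz matrices\<close>

text \<open>The vector \<open>p(M) w\<close>, evaluated by Horner's scheme.\<close>

definition poly_orbit :: "complex^'n^'n \<Rightarrow> complex^'n \<Rightarrow> complex poly \<Rightarrow> complex^'n" where
  "poly_orbit M w p = fold_coeffs (\<lambda>a v. a *s w + M *v v) p 0"

lemma poly_orbit_0 [simp]: "poly_orbit M w 0 = 0"
  by (simp add: poly_orbit_def)

lemma poly_orbit_pCons: "poly_orbit M w (pCons a p) = a *s w + M *v poly_orbit M w p"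
  by (cases "p = 0 \<and> a = 0") (auto simp: poly_orbit_def)

lemma poly_orbit_add: "poly_orbit M w (p + q) = poly_orbit M w p + poly_orbit M w q"
  by (induction p q rule: poly_induct2)
    (simp_all add: poly_orbit_pCons matrix_vector_right_distrib vector_sadd_rdistrib algebra_simps)

lemma poly_orbit_smult: "poly_orbit M w (smult c p) = c *s poly_orbit M w p"
  by (induction p) (simp_all add: poly_orbit_pCons vec.scale_right_distrib matrix_vector_mult_scaleR
      vector_scalar_commute vector_smult_assoc)

lemma poly_orbit_linear_factor:
  "poly_orbit M w ([:- a, 1:] * p) = M *v poly_orbit M w p - a *s poly_orbit M w p"
proof -
  have "[:- a, 1:] * p = pCons 0 p + smult (- a) p" by (simp add: mult_pCons_left)
  then show ?thesis
    by (simp only: poly_orbit_add poly_orbit_smult poly_orbit_pCons) (simp add: vec.scale_minus_left)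
qed

lemma poly_orbit_in_invariant:
  assumes "vec.subspace W" "\<And>w. w \<in> W \<Longrightarrow> M *v w \<in> W" "w \<in> W"
  shows "poly_orbit M w p \<in> W"
  by (induction p) (auto simp: poly_orbit_pCons intro!: vec.subspace_0[OF assms(1)]
      vec.subspace_add[OF assms(1)] vec.subspace_scale[OF assms(1)] assms(2,3))

text \<open>The vectors \<open>w\<close>, \<open>M w\<close>, \<open>M^2 w\<close>, ... cannot all
  be independent of their predecessors in a finite-dimensional space.\<close>

lemma annihilating_polynomial:
  fixes M :: "complex^'n^'n"
  obtains p where "p \<noteq> 0" "poly_orbit M w p = 0"
proof -
  define f where "f k = poly_orbit M w (monom 1 k)" for k
  \<comment> \<open>The vanishing of the coefficients from \<open>k\<close> on ensures that
    \<open>p\<close> cannot cancel the leading term of \<open>monom 1 k\<close> below.\<close>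
  have span: "\<exists>p. (\<forall>i\<ge>k. coeff p i = 0) \<and> v = poly_orbit M w p" if "v \<in> vec.span (f ` {..<k})" for v k
    using that
  proof (induction v rule: vec.span_induct)
    case base
    let ?S = "{v. \<exists>p. (\<forall>i\<ge>k. coeff p i = 0) \<and> v = poly_orbit M w p}"
    show ?case
      unfolding vec.subspace_def
    proof (intro conjI ballI allI)
      show "0 \<in> ?S" by (auto intro!: exI[of _ 0])
      fix x assume "x \<in> ?S"
      then obtain p where p: "\<forall>i\<ge>k. coeff p i = 0" "x = poly_orbit M w p" by blast
      show "c *s x \<in> ?S" for c
        using p by (auto intro!: exI[of _ "smult c p"] simp: poly_orbit_smult)
      fix y assume "y \<in> ?S"
      then obtain q where q: "\<forall>i\<ge>k. coeff q i = 0" "y = poly_orbit M w q" by blast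
      show "x + y \<in> ?S"
        using p q by (auto intro!: exI[of _ "p + q"] simp: poly_orbit_add)
    qed
  next
    case (step v)
    then obtain i where "i < k" "v = f i" by auto
    then show ?case by (intro exI[of _ "monom 1 i"]) (auto simp: f_def)
  qed
  have "\<exists>k. f k \<in> vec.span (f ` {..<k})"
  proof (rule ccontr)
    assume "\<not> ?thesis"
    then have no: "f k \<notin> vec.span (f ` {..<k})" for k by blast
    have ind: "vec.independent (f ` {..<k}) \<and> card (f ` {..<k}) = k" for k
    proof (induction k)
      case (Suc k)
      have "f ` {..<Suc k} = insert (f k) (f ` {..<k})" by (auto simp: lessThan_Suc)
      moreover have "f k \<notin> f ` {..<k}" using no[of k] by (rule contrapos_nn) (rule vec.span_base)
      ultimately show ?case using Suc no[of k] by (simp add: vec.independent_insertI)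
    qed (simp add: vec.independent_empty)
    have "k \<le> vec.dim (UNIV :: (complex^'n) set)" for k
      using vec.independent_card_le_dim[OF subset_UNIV conjunct1[OF ind[of k]]] conjunct2[OF ind[of k]]
      by (simp only:)
    from this[of "Suc (vec.dim (UNIV :: (complex^'n) set))"] show False by simp
  qed
  then obtain k where "f k \<in> vec.span (f ` {..<k})" ..
  from span[OF this] obtain p where p: "\<forall>i\<ge>k. coeff p i = 0" "f k = poly_orbit M w p" by blast
  have "coeff (monom 1 k + smult (- 1) p) k \<noteq> 0" using p(1) by simp
  then have "monom 1 k + smult (- 1) p \<noteq> 0" by (metis coeff_0)
  moreover have "poly_orbit M w (monom 1 k + smult (- 1) p) = 0"
    using p(2) by (simp only: poly_orbit_add poly_orbit_smult f_def) (simp add: vec.scale_minus_left)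
  ultimately show ?thesis by (rule that)
qed

text \<open>Take an annihilating polynomial of \<open>w\<close> of least degree and split off a root
  \<open>l\<close>. The cofactor does not annihilate \<open>w\<close>, so applied to
  \<open>w\<close> it gives an eigenvector for \<open>l\<close>, which remains in \<open>W\<close>
  by invariance.\<close>

lemma invariant_subspace_eigenvector:
  fixes M :: "complex^'n^'n"
  assumes W: "vec.subspace W" "\<And>w. w \<in> W \<Longrightarrow> M *v w \<in> W" and w: "w \<in> W" "w \<noteq> 0"
  obtains l z where "z \<in> W" "z \<noteq> 0" "M *v z = l *s z"
proof -
  obtain p0 where p0: "p0 \<noteq> 0 \<and> poly_orbit M w p0 = 0"
    using annihilating_polynomial[of M w] by blast
  define p where "p = arg_min degree (\<lambda>p. p \<noteq> 0 \<and> poly_orbit M w p = 0)"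
  have p: "p \<noteq> 0" "poly_orbit M w p = 0"
    using arg_min_natI[of "\<lambda>p. p \<noteq> 0 \<and> poly_orbit M w p = 0" p0 degree, OF p0] by (auto simp: p_def)
  have min: "degree p \<le> degree r" if "r \<noteq> 0" "poly_orbit M w r = 0" for r
    unfolding p_def by (rule arg_min_nat_le) (use that in simp)
  have "degree p \<noteq> 0"
  proof
    assume "degree p = 0"
    then obtain a where a: "p = [:a:]" by (rule degree_eq_zeroE)
    then have "a *s w = 0" using p(2) by (simp add: poly_orbit_pCons)
    then show False using a p(1) w(2) by simp
  qed
  then obtain l where "poly p l = 0"
    using fundamental_theorem_of_algebra[of p] by (auto simp: constant_degree)
  then obtain r where r: "p = [:- l, 1:] * r" by (auto simp: poly_eq_0_iff_dvd elim: dvdE)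
  have "r \<noteq> 0" using r p(1) by auto
  have "degree p = degree [:- l, 1:] + degree r"
    unfolding r by (rule degree_mult_eq) (use \<open>r \<noteq> 0\<close> in auto)
  then have "degree r < degree p" by simp
  then have "poly_orbit M w r \<noteq> 0" using min[OF \<open>r \<noteq> 0\<close>] by force
  moreover have "M *v poly_orbit M w r = l *s poly_orbit M w r"
    using p(2) unfolding r poly_orbit_linear_factor by simp
  ultimately show ?thesis
    using that poly_orbit_in_invariant[OF W w(1)] by blast
qed

section \<open>Hermitian forms and projections\<close>

definition herm :: "complex^'n \<Rightarrow> complex^'n \<Rightarrow> complex" where
  "herm y z = (\<Sum>i\<in>UNIV. cnj (y $ i) * z $ i)"

lemma herm_add_right: "herm y (z + z') = herm y z + herm y z'"
  and herm_add_left: "herm (y + y') z = herm y z + herm y' z"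
  and herm_diff_right: "herm y (z - z') = herm y z - herm y z'"
  and herm_scale_right: "herm y (c *s z) = c * herm y z"
  and herm_scale_left: "herm (c *s y) z = cnj c * herm y z"
  and herm_cnj: "cnj (herm y z) = herm z y"
  by (simp_all add: herm_def sum.distrib sum_subtractf sum_distrib_left algebra_simps)

lemma herm_complex_matrix:
  "herm y (complex_matrix Q *v z) = herm (complex_matrix (transpose Q) *v y) z"
proof -
  have "herm y (complex_matrix Q *v z) = (\<Sum>i\<in>UNIV. \<Sum>j\<in>UNIV. cnj (y $ i) * of_real (Q $ i $ j) * z $ j)"
    by (simp add: herm_def matrix_vector_mult_def sum_distrib_left map_matrix_def mult.assoc)
  also have "\<dots> = (\<Sum>j\<in>UNIV. \<Sum>i\<in>UNIV. cnj (y $ i) * of_real (Q $ i $ j) * z $ j)"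
    by (rule sum.swap)
  also have "\<dots> = herm (complex_matrix (transpose Q) *v y) z"
    by (simp add: herm_def matrix_vector_mult_def sum_distrib_right map_matrix_def transpose_def mult.assoc mult.left_commute)
  finally show ?thesis .
qed

text \<open>The mixed terms of real and imaginary part enter only the imaginary part of the form, so
  definiteness over the reals passes to complex vectors.\<close>

lemma Re_herm_complex_matrix:
  fixes y :: "complex^'n" and N :: "real^'n^'n"
  defines "a \<equiv> (\<chi> i. Re (y $ i))" and "b \<equiv> (\<chi> i. Im (y $ i))"
  shows "Re (herm y (complex_matrix N *v y)) = a \<bullet> (N *v a) + b \<bullet> (N *v b)"
proof -
  have "Re (herm y (complex_matrix N *v y))
    = (\<Sum>i\<in>UNIV. \<Sum>j\<in>UNIV. Re (cnj (y $ i) * (of_real (N $ i $ j) * y $ j)))"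
    by (simp add: herm_def matrix_vector_mult_def sum_distrib_left map_matrix_def)
  also have "\<dots> = (\<Sum>i\<in>UNIV. \<Sum>j\<in>UNIV. a $ i * (N $ i $ j * a $ j) + b $ i * (N $ i $ j * b $ j))"
    by (intro sum.cong refl) (simp add: a_def b_def algebra_simps)
  also have "\<dots> = a \<bullet> (N *v a) + b \<bullet> (N *v b)"
    by (simp add: inner_vec_def matrix_vector_mult_def sum_distrib_left sum.distrib)
  finally show ?thesis .
qed

lemma complex_matrix_mult: "complex_matrix (M ** N) = complex_matrix M ** complex_matrix N"
  by (simp add: vec_eq_iff map_matrix_def matrix_matrix_mult_def)

text \<open>Gram-Schmidt for a form that is known to be definite on the span of \<open>B\<close>
  only. The new vector \<open>b\<close> is first made orthogonal to the span of \<open>S\<close>;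
  one further correction along the result then suffices.\<close>

lemma hermitian_projection:
  fixes Q :: "real^'n^'n"
  defines "q \<equiv> \<lambda>y z. herm y (complex_matrix Q *v z)"
  assumes B: "finite B" and pos: "\<And>u. u \<in> vec.span B \<Longrightarrow> u \<noteq> 0 \<Longrightarrow> 0 < Re (q u u)"
  shows "\<exists>u\<in>vec.span B. \<forall>v\<in>vec.span B. q v (w - u) = 0"
  using B pos
proof (induction B arbitrary: w)
  case empty
  then show ?case by (intro bexI[of _ 0]) (simp_all add: q_def herm_def)
next
  case (insert b S)
  have lin: "q v (x + y) = q v x + q v y" "q (x + y) v = q x v + q y v" "q v (x - y) = q v x - q v y"
    "q v (c *s x) = c * q v x" "q (c *s x) v = cnj c * q x v" for v x y c
    by (simp_all add: q_def matrix_vector_right_distrib matrix_vector_mult_diff_distrib vector_scalar_commute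
        herm_add_left herm_add_right herm_diff_right herm_scale_left herm_scale_right)
  have sub: "v \<in> vec.span (insert b S)" if "v \<in> vec.span S" for v
    using that vec.span_mono[of S "insert b S"] by blast
  have posS: "0 < Re (q u u)" if "u \<in> vec.span S" "u \<noteq> 0" for u
    using insert.prems[OF sub[OF that(1)] that(2)] .
  obtain ub where ub: "ub \<in> vec.span S" "\<forall>v\<in>vec.span S. q v (b - ub) = 0"
    using insert.IH[OF posS] by blast
  obtain uw where uw: "uw \<in> vec.span S" "\<forall>v\<in>vec.span S. q v (w - uw) = 0"
    using insert.IH[OF posS] by blast
  let ?b = "b - ub"
  have bs: "?b \<in> vec.span (insert b S)"
    by (intro vec.span_diff sub ub(1) vec.span_base) simp
  \<comment> \<open>If \<open>?b\<close> is zero, the quotient is 0 by convention and the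
    orthogonality condition is trivial.\<close>
  define k where "k = q ?b (w - uw) / q ?b ?b"
  have orth: "q ?b (w - (uw + k *s ?b)) = 0"
  proof (cases "?b = 0")
    case True
    then show ?thesis by (simp add: q_def herm_def)
  next
    case False
    then have "q ?b ?b \<noteq> 0" using insert.prems[OF bs] by force
    have "q ?b (w - (uw + k *s ?b)) = q ?b ((w - uw) - k *s ?b)" by (simp add: diff_diff_eq)
    also have "\<dots> = q ?b (w - uw) - k * q ?b ?b" by (simp only: lin(3)[of ?b "w - uw" "k *s ?b"] lin(4))
    also have "\<dots> = 0" unfolding k_def using \<open>q ?b ?b \<noteq> 0\<close> by (rule_tac iffD2[OF right_minus_eq]) (rule nonzero_eq_divide_eq[THEN iffD1, OF _ refl, symmetric])
    finally show ?thesis .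
  qed
  have orthS: "q v (w - (uw + k *s ?b)) = 0" if "v \<in> vec.span S" for v
  proof -
    have "q v (w - (uw + k *s ?b)) = q v ((w - uw) - k *s ?b)" by (simp add: diff_diff_eq)
    also have "\<dots> = q v (w - uw) - k * q v ?b" by (simp only: lin(3)[of v "w - uw" "k *s ?b"] lin(4))
    finally show ?thesis using uw ub that by simp
  qed
  show ?case
  proof (intro bexI ballI)
    show "uw + k *s ?b \<in> vec.span (insert b S)"
      by (intro vec.span_add vec.span_scale sub uw(1) bs)
    fix v assume "v \<in> vec.span (insert b S)"
    then obtain m where m: "v - m *s b \<in> vec.span S" by (auto simp: vec.span_breakdown_eq)
    have vS: "v - m *s ?b \<in> vec.span S"
    proof -
      have "v - m *s ?b = (v - m *s b) + m *s ub" by (simp add: vec.scale_right_diff_distrib)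
      then show ?thesis by (simp only: vec.span_add[OF m vec.span_scale[OF ub(1)]])
    qed
    have "v = (v - m *s ?b) + m *s ?b" by simp
    then have "q v (w - (uw + k *s ?b)) = q (v - m *s ?b) (w - (uw + k *s ?b)) + cnj m * q ?b (w - (uw + k *s ?b))"
      by (metis lin(2) lin(5))
    then show "q v (w - (uw + k *s ?b)) = 0" using orth orthS[OF vS] by simp
  qed
qed

text \<open>Extend the kernel vector \<open>z\<close> to a basis of \<open>W\<close>; the images of
  the other basis vectors already span the image.\<close>

lemma dim_image_less:
  fixes f :: "complex^'n \<Rightarrow> complex^'n"
  assumes W: "vec.subspace W" and z: "z \<in> W" "z \<noteq> 0" "f z = 0"
    and f: "\<And>x y. f (x + y) = f x + f y" "\<And>c x. f (c *s x) = c *s f x"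
  shows "vec.dim (f ` W) < vec.dim W"
proof -
  have "vec.independent {z}" using z(2) by simp
  then obtain B where B: "{z} \<subseteq> B" "B \<subseteq> W" "vec.independent B" "W \<subseteq> vec.span B"
    using vec.maximal_independent_subset_extend[of "{z}" W] z(1) by blast
  have finB: "finite B" using B(3) by (rule vec.finiteI_independent)
  have "f w \<in> vec.span (f ` (B - {z}))" if "w \<in> vec.span B" for w
    using that
  proof (induction w rule: vec.span_induct)
    case base
    have f0: "f 0 = 0" using f(2)[of 0 0] by simp
    show ?case
      unfolding vec.subspace_def by (auto simp: f f0 intro: vec.span_zero vec.span_add vec.span_scale)
  next
    case (step w)
    then show ?case using z(3) by (cases "w = z") (auto intro: vec.span_base vec.span_zero)
  qed
  then have "f ` W \<subseteq> vec.span (f ` (B - {z}))" using B(4) by blast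
  then have "vec.dim (f ` W) \<le> card (f ` (B - {z}))"
    by (rule vec.dim_le_card) (use finB in simp)
  also have "\<dots> \<le> card (B - {z})" by (rule card_image_le) (use finB in simp)
  also have "\<dots> < card B" using B(1) finB by (intro psubset_card_mono) auto
  also have "\<dots> = vec.dim W" by (rule vec.basis_card_eq_dim[OF B(2,4,3)])
  finally show ?thesis .
qed

text \<open>Induction over invariant subspaces \<open>W\<close>: for an eigenvalue \<open>l\<close> of \<open>A\<close> on \<open>W\<close> the range
  \<open>U = (A - l) W\<close> is smaller, and on the \<open>Q\<close>-orthogonal complement of \<open>U\<close> in \<open>W\<close> the form
  \<open>y\<^sup>* Q A y\<close> equals \<open>l y\<^sup>* Q y\<close>.\<close>

lemma lyapunov_positive:
  fixes A Q :: "real^'n^'n"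
  assumes A: "hurwitz A" and Q: "transpose Q = Q"
    and e: "e > 0" "\<And>x. (Q *v x) \<bullet> (A *v x) \<le> - e * (norm x)\<^sup>2"
  shows "0 \<le> x \<bullet> (Q *v x)"
proof -
  define q where "q = (\<lambda>y z. herm y (complex_matrix Q *v z))"
  let ?A = "complex_matrix A"
  have qcnj: "cnj (q y z) = q z y" for y z
    unfolding q_def herm_cnj using herm_complex_matrix[of z Q y] Q by simp
  have lin: "q v (x + y) = q v x + q v y" "q (x + y) v = q x v + q y v" "q v (c *s x) = c * q v x" for v x y c
    by (simp_all add: q_def matrix_vector_right_distrib vector_scalar_commute
        herm_add_left herm_add_right herm_scale_right)
  have neg: "Re (q y (?A *v y)) < 0" if "y \<noteq> 0" for y
  proof -
    define a where "a = (\<chi> i. Re (y $ i))"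
    define b where "b = (\<chi> i. Im (y $ i))"
    have ab: "a \<noteq> 0 \<or> b \<noteq> 0"
      using that by (auto simp: a_def b_def vec_eq_iff complex_eq_iff)
    have le: "c \<bullet> ((Q ** A) *v c) \<le> - e * (norm c)\<^sup>2" for c
    proof -
      have "c \<bullet> ((Q ** A) *v c) = (Q *v c) \<bullet> (A *v c)"
        using dot_lmul_matrix[of c Q "A *v c"] transpose_matrix_vector[of Q c]
        by (simp add: Q flip: matrix_vector_mul_assoc)
      then show ?thesis using e(2)[of c] by simp
    qed
    have "q y (?A *v y) = herm y (complex_matrix (Q ** A) *v y)"
      by (simp add: q_def complex_matrix_mult matrix_vector_mul_assoc)
    then have "Re (q y (?A *v y)) = a \<bullet> ((Q ** A) *v a) + b \<bullet> ((Q ** A) *v b)"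
      by (simp add: Re_herm_complex_matrix a_def b_def)
    also have "\<dots> \<le> - e * (norm a)\<^sup>2 + - e * (norm b)\<^sup>2" by (intro add_mono le)
    also have "\<dots> < 0"
    proof -
      have "0 < (norm a)\<^sup>2 + (norm b)\<^sup>2" using ab by (auto intro: add_pos_nonneg add_nonneg_pos)
      then have "0 < e * ((norm a)\<^sup>2 + (norm b)\<^sup>2)" using e(1) by simp
      then show ?thesis by (simp add: distrib_left)
    qed
    finally show ?thesis .
  qed
  \<comment> \<open>Quantifying over all invariant subspaces lets the induction pass to the image of
    \<open>A - l\<close>; strict positivity there is what provides the orthogonal projection onto
    it.\<close>
  have pos: "0 < Re (q w w)" if "vec.subspace W" "\<And>w. w \<in> W \<Longrightarrow> ?A *v w \<in> W" "w \<in> W" "w \<noteq> 0" for W w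
    using that
  proof (induction "vec.dim W" arbitrary: W w rule: less_induct)
    case less
    obtain l z where z: "z \<in> W" "z \<noteq> 0" "?A *v z = l *s z"
      using invariant_subspace_eigenvector[OF less.prems(1-4)] by blast
    have l: "Re l < 0" using A z(2,3) unfolding hurwitz_def by blast
    define f where "f = (\<lambda>w. ?A *v w - l *s w)"
    have f: "f (x + y) = f x + f y" "f (c *s x) = c *s f x" for x y c
      by (simp_all add: f_def matrix_vector_right_distrib vector_scalar_commute vec.scale_right_distrib
          vec.scale_right_diff_distrib vector_smult_assoc mult.commute)
    have fW: "f w \<in> W" if "w \<in> W" for w
      unfolding f_def using that less.prems(1,2) by (intro vec.subspace_diff vec.subspace_scale) auto
    have Usub: "vec.subspace (f ` W)"
      unfolding vec.subspace_def
    proof (intro conjI ballI allI)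
      have "f 0 = 0" using f(2)[of 0 0] by simp
      then show "0 \<in> f ` W" using imageI[OF vec.subspace_0[OF less.prems(1)], of f] by simp
      fix x assume "x \<in> f ` W"
      then obtain x' where x: "x' \<in> W" "x = f x'" by (rule imageE)
      show "c *s x \<in> f ` W" for c
        unfolding x(2) f(2)[symmetric] by (intro imageI vec.subspace_scale[OF less.prems(1)] x(1))
      fix y assume "y \<in> f ` W"
      then obtain y' where y: "y' \<in> W" "y = f y'" by (rule imageE)
      show "x + y \<in> f ` W"
        unfolding x(2) y(2) f(1)[symmetric] by (intro imageI vec.subspace_add[OF less.prems(1)] x(1) y(1))
    qed
    have Uinv: "?A *v u \<in> f ` W" if "u \<in> f ` W" for u
    proof -
      have uW: "u \<in> W" using that fW by auto
      have "?A *v u = f u + l *s u" by (simp add: f_def)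
      then show ?thesis
        using vec.subspace_add[OF Usub imageI[OF uW] vec.subspace_scale[OF Usub that]] by simp
    qed
    have dimU: "vec.dim (f ` W) < vec.dim W"
      by (rule dim_image_less[OF less.prems(1) z(1,2) _ f]) (simp add: f_def z(3))
    have posU: "0 < Re (q u u)" if "u \<in> f ` W" "u \<noteq> 0" for u
      using less.hyps[OF dimU Usub Uinv that] .
    obtain B where B: "B \<subseteq> f ` W" "vec.independent B" "f ` W \<subseteq> vec.span B" "card B = vec.dim (f ` W)"
      by (rule vec.basis_exists)
    have spanB: "vec.span B = f ` W"
      using B vec.span_minimal[OF B(1) Usub] by blast
    obtain u where u: "u \<in> f ` W" "\<forall>v\<in>f ` W. q v (w - u) = 0"
      using hermitian_projection[of B Q w] vec.finiteI_independent[OF B(2)] posU spanB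
      unfolding q_def by auto
    let ?y = "w - u"
    have yW: "?y \<in> W" using less.prems(1,3) u(1) fW by (intro vec.subspace_diff) auto
    \<comment> \<open>\<open>?y\<close> is orthogonal to the image of \<open>f\<close>, in
      particular to \<open>f ?y\<close>. The form of \<open>?y\<close> with \<open>A ?y\<close> is
      thus \<open>l\<close> times the form of \<open>?y\<close> with itself; it has negative real
      part, and so has \<open>l\<close>.\<close>
    have posy: "0 < Re (q ?y ?y)" if "?y \<noteq> 0"
    proof -
      have "q ?y (f ?y) = cnj (q (f ?y) ?y)" by (simp only: qcnj)
      also have "\<dots> = 0" using u(2) yW by simp
      finally have "q ?y (f ?y) = 0" .
      moreover have "?A *v ?y = f ?y + l *s ?y" by (simp add: f_def)
      ultimately have "q ?y (?A *v ?y) = l * q ?y ?y" by (simp only: lin) simp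
      moreover have "Im (q ?y ?y) = 0" using qcnj[of ?y ?y] by (simp add: complex_eq_iff)
      ultimately have "Re (q ?y (?A *v ?y)) = Re l * Re (q ?y ?y)" by simp
      then have "Re l * Re (q ?y ?y) < 0" using neg[OF that] by simp
      then show ?thesis using l by (simp add: mult_less_0_iff)
    qed
    have "q w w = q (u + ?y) (u + ?y)" by simp
    also have "\<dots> = q u u + q u ?y + (q ?y u + q ?y ?y)" by (simp only: lin) simp
    also have "q u ?y = 0" using u by blast
    also have "q ?y u = 0" using \<open>q u ?y = 0\<close> qcnj[of u ?y] by (metis complex_cnj_zero)
    finally have sum: "Re (q w w) = Re (q u u) + Re (q ?y ?y)" by simp
    show ?case
    proof (cases "u = 0")
      case True
      then show ?thesis using posy less.prems(4) by simp
    next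
      case False
      then have "0 < Re (q u u)" by (rule posU[OF u(1)])
      moreover have "0 \<le> Re (q ?y ?y)"
      proof (cases "?y = 0")
        case True
        show ?thesis unfolding True q_def by (simp add: herm_def)
      qed (use posy in simp)
      ultimately show ?thesis using sum by simp
    qed
  qed
  show ?thesis
  proof (cases "x = 0")
    case False
    define y where "y = (\<chi> i. complex_of_real (x $ i))"
    have y: "(\<chi> i. Re (y $ i)) = x" "(\<chi> i. Im (y $ i)) = 0"
      by (simp_all add: y_def vec_eq_iff)
    have "y \<noteq> 0"
    proof
      assume "y = 0"
      then have "x = 0" using y(1) by (simp add: vec_eq_iff)
      then show False using False by simp
    qed
    then have "0 < Re (q y y)" by (intro pos[of UNIV]) (auto simp: vec.subspace_UNIV)
    also have "Re (q y y) = x \<bullet> (Q *v x)"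
      unfolding q_def Re_herm_complex_matrix y by simp
    finally show ?thesis by simp
  qed simp
qed


section \<open>Block matrices and the dissipation inequality\<close>

definition join :: "'a^'m \<Rightarrow> 'a^'n \<Rightarrow> 'a^('m + 'n)" where
  "join x y = (\<chi> i. case i of Inl m \<Rightarrow> x $ m | Inr n \<Rightarrow> y $ n)"

lemma sum_UNIV_Plus:
  fixes f :: "'m::finite + 'n::finite \<Rightarrow> 'a::comm_monoid_add"
  shows "(\<Sum>i\<in>UNIV. f i) = (\<Sum>m\<in>UNIV. f (Inl m)) + (\<Sum>n\<in>UNIV. f (Inr n))"
  unfolding UNIV_Plus_UNIV[symmetric] by (subst sum.Plus) auto

lemma inner_join: "join x y \<bullet> join x' y' = x \<bullet> x' + y \<bullet> y'"
  by (simp add: inner_vec_def sum_UNIV_Plus join_def)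

lemma norm_join: "(norm (join x y))\<^sup>2 = (norm x)\<^sup>2 + (norm y)\<^sup>2"
  for x :: "real^'m" and y :: "real^'n"
  by (simp add: power2_norm_eq_inner inner_join)

lemma beside_mult_join: "beside A B *v join x y = A *v x + B *v y"
  by (simp add: vec_eq_iff matrix_vector_mult_def beside_def join_def sum_UNIV_Plus)

lemma above_mult: "above A B *v x = join (A *v x) (B *v x)"
  by (simp add: vec_eq_iff matrix_vector_mult_def above_def join_def split: sum.split)

lemma block_matrix_mult_join:
  "block_matrix A B C D *v join x y = join (A *v x + B *v y) (C *v x + D *v y)"
  by (simp add: block_matrix_def above_mult beside_mult_join)

lemma mat_mult_vec: "mat c *v x = c *s x"
proof -
  have "(\<Sum>j\<in>UNIV. (if i = j then c else 0) * x $ j) = (\<Sum>j\<in>UNIV. if i = j then c * x $ j else 0)" for i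
    by (rule sum.cong) auto
  then show ?thesis by (simp add: vec_eq_iff matrix_vector_mult_def mat_def sum.delta')
qed

section \<open>Quadratic forms of block matrices\<close>

lemma congruence_quadratic_form:
  fixes N :: "real^'m^'n" and K :: "real^'n^'n"
  shows "z \<bullet> ((transpose N ** K ** N) *v z) = (N *v z) \<bullet> (K *v (N *v z))"
proof -
  have "z \<bullet> ((transpose N ** K ** N) *v z) = z \<bullet> (transpose N *v (K *v (N *v z)))"
    by (simp add: matrix_vector_mul_assoc matrix_mul_assoc)
  also have "\<dots> = (K *v (N *v z)) \<bullet> (N *v z)"
    by (metis dot_lmul_matrix inner_commute transpose_matrix_vector)
  finally show ?thesis by (simp add: inner_commute)
qed

lemma minus_matrix_vector_mult: "(- M) *v z = - (M *v z)" for M :: "real^'m^'n"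
  by (simp add: vec_eq_iff matrix_vector_mult_def sum_negf)

text \<open>The minimum over the compact unit sphere is positive; homogeneity extends the
  bound.\<close>

lemma pos_definite_coercive:
  fixes M :: "real^'n^'n"
  assumes "pos_definite M"
  shows "\<exists>e>0. \<forall>z. e * (norm z)\<^sup>2 \<le> z \<bullet> (M *v z)"
proof -
  let ?f = "\<lambda>z. z \<bullet> (M *v z)"
  have cont: "continuous_on (sphere 0 1) ?f"
    by (intro continuous_intros linear_continuous_on matrix_vector_mul_bounded_linear)
  have ne: "sphere (0 :: real^'n) 1 \<noteq> {}" by simp
  obtain z0 where z0: "z0 \<in> sphere 0 1" "\<And>z. z \<in> sphere 0 1 \<Longrightarrow> ?f z0 \<le> ?f z"
    using continuous_attains_inf[OF compact_sphere ne cont] by blast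
  have "z0 \<noteq> 0" using z0(1) by auto
  then have pos: "0 < ?f z0" using assms by (simp add: pos_definite_def)
  have "?f z0 * (norm z)\<^sup>2 \<le> ?f z" for z
  proof (cases "z = 0")
    case False
    have "?f z0 \<le> ?f (z /\<^sub>R norm z)" using False by (intro z0(2)) simp
    also have "?f (z /\<^sub>R norm z) = ?f z / (norm z)\<^sup>2"
      by (simp add: matrix_vector_mult_scaleR power2_eq_square divide_inverse)
    finally show ?thesis using False by (simp add: field_simps)
  qed simp
  then show ?thesis using pos by blast
qed

text \<open>The matrix inequality evaluated at the stacked vector of state \<open>x\<close> and
  input \<open>r\<close>. The first block product is the rate of the storage
  \<open>x \<bullet> Q x\<close>, the second the weighted supply of output and input; strictness
  supplies the uniform margin \<open>e\<close>.\<close>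

lemma lmi_dissipation:
  fixes A Q :: "real^'n^'n" and B :: "real^1^'n" and C :: "real^'n^1" and D :: "real^1^1"
    and \<alpha> X Y :: real
  assumes Q: "transpose Q = Q"
    and neg: "neg_definite
      (transpose (block_matrix A B (mat 1) 0) ** block_matrix 0 Q Q 0 ** block_matrix A B (mat 1) 0
       + transpose (block_matrix C D 0 (mat 1))
         ** block_matrix (mat \<alpha>) (mat Y) (mat Y) (mat (- X)) ** block_matrix C D 0 (mat 1))"
  shows "\<exists>e>0. \<forall>x r. 2 * ((Q *v x) \<bullet> (A *v x + B *v vec r)) + \<alpha> * ((C *v x) $ 1 + D $ 1 $ 1 * r)\<^sup>2
     + 2 * Y * (((C *v x) $ 1 + D $ 1 $ 1 * r) * r) - X * r\<^sup>2 \<le> - e * ((norm x)\<^sup>2 + r\<^sup>2)"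
proof -
  let ?N1 = "block_matrix A B (mat 1) 0 :: real^('n + 1)^('n + 'n)" and ?N2 = "block_matrix C D 0 (mat 1) :: real^('n + 1)^(1 + 1)"
  let ?K1 = "block_matrix 0 Q Q 0 :: real^('n + 'n)^('n + 'n)"
  let ?K2 = "block_matrix (mat \<alpha>) (mat Y) (mat Y) (mat (- X)) :: real^(1 + 1)^(1 + 1)"
  let ?M = "transpose ?N1 ** ?K1 ** ?N1 + transpose ?N2 ** ?K2 ** ?N2"
  obtain e where e: "e > 0" "\<And>z. e * (norm z)\<^sup>2 \<le> z \<bullet> ((- ?M) *v z)"
    using pos_definite_coercive neg unfolding neg_definite_def by blast
  have "2 * ((Q *v x) \<bullet> (A *v x + B *v vec r)) + \<alpha> * ((C *v x) $ 1 + D $ 1 $ 1 * r)\<^sup>2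
     + 2 * Y * (((C *v x) $ 1 + D $ 1 $ 1 * r) * r) - X * r\<^sup>2 \<le> - e * ((norm x)\<^sup>2 + r\<^sup>2)" for x :: "real^'n" and r
  proof -
    let ?w = "vec r :: real^1" and ?y = "(C *v x) $ 1 + D $ 1 $ 1 * r"
    let ?z = "join x ?w"
    have Qs: "a \<bullet> (Q *v b) = (Q *v a) \<bullet> b" for a b
      using dot_lmul_matrix[of a Q b] transpose_matrix_vector[of Q a] Q by simp
    have v: "C *v x + D *v ?w = vec ?y"
      by (simp add: vec_eq_iff matrix_vector_mult_def forall_1 sum_1)
    have n1: "?N1 *v ?z = join (A *v x + B *v ?w) x" by (simp add: block_matrix_mult_join)
    have q1: "(?N1 *v ?z) \<bullet> (?K1 *v (?N1 *v ?z)) = 2 * ((Q *v x) \<bullet> (A *v x + B *v ?w))"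
      by (simp add: n1 block_matrix_mult_join inner_join Qs inner_commute[of _ "Q *v x"])
        (simp add: Qs[symmetric] inner_commute)
    have n2: "?N2 *v ?z = join (vec ?y) ?w" by (simp add: block_matrix_mult_join v)
    have q2: "(?N2 *v ?z) \<bullet> (?K2 *v (?N2 *v ?z)) = \<alpha> * ?y\<^sup>2 + 2 * Y * (?y * r) - X * r\<^sup>2"
      unfolding n2
      by (simp only: block_matrix_mult_join inner_join mat_mult_vec)
        (simp add: inner_vec_def sum_1 power2_eq_square algebra_simps)
    have "?z \<bullet> ((- ?M) *v ?z) = - ((?N1 *v ?z) \<bullet> (?K1 *v (?N1 *v ?z)) + (?N2 *v ?z) \<bullet> (?K2 *v (?N2 *v ?z)))"
    proof -
      have "(- ?M) *v ?z = - ((transpose ?N1 ** ?K1 ** ?N1) *v ?z + (transpose ?N2 ** ?K2 ** ?N2) *v ?z)"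
        unfolding matrix_vector_mult_add_rdistrib[symmetric] by (rule minus_matrix_vector_mult)
      then show ?thesis
        by (simp only: inner_minus_right inner_add_right congruence_quadratic_form)
    qed
    moreover have "(norm ?z)\<^sup>2 = (norm x)\<^sup>2 + r\<^sup>2"
    proof -
      have "(norm (vec r :: real^1))\<^sup>2 = r\<^sup>2"
        unfolding power2_norm_eq_inner by (simp add: inner_vec_def sum_1 power2_eq_square)
      then show ?thesis by (simp add: norm_join)
    qed
    ultimately show ?thesis using e(2)[of ?z] unfolding q1 q2 by simp
  qed
  then show ?thesis using e(1) by blast
qed

section \<open>State-space realizations in the time domain\<close>

lemma hurwitz_invertible:
  fixes A :: "real^'n^'n"
  assumes "hurwitz A" "0 < Re s"
  shows "invertible (mat s - complex_matrix A)"
proof -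
  have "inj ((*v) (mat s - complex_matrix A))"
  proof (rule injI)
    fix x y assume "(mat s - complex_matrix A) *v x = (mat s - complex_matrix A) *v y"
    then have "(mat s - complex_matrix A) *v (x - y) = 0" by (simp add: matrix_vector_mult_diff_distrib)
    then have "complex_matrix A *v (x - y) = s *s (x - y)"
      by (simp add: matrix_vector_mult_diff_rdistrib mat_mult_vec)
    then show "x = y" using assms unfolding hurwitz_def by (metis less_asym right_minus_eq)
  qed
  then show ?thesis
    using matrix_left_invertible_injective[of "mat s - complex_matrix A"]
    by (simp add: invertible_left_inverse)
qed

lemma complex_matrix_beside: "complex_matrix (beside A B) = beside (complex_matrix A) (complex_matrix B)"
  by (simp add: vec_eq_iff map_matrix_def beside_def split: sum.split)

lemma complex_matrix_above: "complex_matrix (above A B) = above (complex_matrix A) (complex_matrix B)"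
  by (simp add: vec_eq_iff map_matrix_def above_def split: sum.split)

lemma complex_matrix_vector:
  "complex_matrix M *v (\<chi> i. complex_of_real (x $ i)) = (\<chi> i. complex_of_real ((M *v x) $ i))"
  by (simp add: vec_eq_iff map_matrix_def matrix_vector_mult_def)

text \<open>Evaluates the transfer matrix through a solution \<open>z\<close> of the resolvent
  equation, so that no inverse is computed; \<open>z\<close> will be the transform of the state. The
  input \<open>join 0 (vec c)\<close> means \<open>d = 0\<close>, and \<open>Inr 1\<close> selects
  the output \<open>v\<close>.\<close>

lemma state_space_second_output:
  fixes A :: "real^'n^'n" and B_d B_w :: "real^1^'n" and C_z C_v :: "real^'n^1"
  assumes inv: "invertible (mat s - complex_matrix A)"
    and z: "(mat s - complex_matrix A) *v z = complex_matrix B_w *v vec c"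
  shows "(state_space A (beside B_d B_w) (above C_z C_v) (block_matrix D_zd D_zw D_vd D_vw) s *v join 0 (vec c)) $ Inr 1
    = (complex_matrix C_v *v z) $ 1 + of_real (D_vw $ 1 $ 1) * c"
proof -
  let ?R = "mat s - complex_matrix A"
  have "matrix_inv ?R ** ?R = mat 1"
    unfolding matrix_inv_def using someI_ex[OF inv[unfolded invertible_def]] by blast
  then have z': "matrix_inv ?R *v (complex_matrix B_w *v vec c) = z"
    unfolding z[symmetric] by (simp add: matrix_vector_mul_assoc)
  show ?thesis
    unfolding state_space_def
    by (simp add: matrix_vector_mult_add_rdistrib matrix_vector_mul_assoc[symmetric] complex_matrix_beside
        complex_matrix_above block_matrix_def beside_mult_join above_mult z')
      (simp add: join_def matrix_vector_mult_def sum_1 map_matrix_def)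
qed

lemma linear_input_matrix: "linear (\<lambda>r. B *v (vec r :: real^1))" for B :: "real^1^'n"
proof (rule linearI)
  show "B *v (vec (a + b) :: real^1) = B *v vec a + B *v vec b" for a b
    by (simp add: matrix_vector_right_distrib[symmetric] vec_add)
  show "B *v (vec (c *\<^sub>R a) :: real^1) = c *\<^sub>R (B *v vec a)" for c a
  proof -
    have "(vec (c *\<^sub>R a) :: real^1) = c *\<^sub>R vec a" by (simp add: vec_eq_iff)
    then show ?thesis by (simp add: matrix_vector_mult_scaleR)
  qed
qed

lemma linear_output_row: "linear (\<lambda>x. (C *v x) $ 1)" for C :: "real^'n^1"
  by (rule linearI) (simp_all add: matrix_vector_right_distrib matrix_vector_mult_scaleR)

text \<open>This ties an arbitrary realization, minimal or not, to actual signals. The state started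
  at rest is in \<open>L2\<close>, so its transform exists and solves the resolvent equation; hence
  \<open>g\<close> and the output computed from the state have equal transforms on a
  half-axis.\<close>

lemma realization_time_domain:
  fixes A Q :: "real^'n^'n" and B_d B_w :: "real^1^'n" and C_z C_v :: "real^'n^1"
  assumes A: "hurwitz A" and Q: "transpose Q = Q"
    and e: "e > 0" "\<And>x. (Q *v x) \<bullet> (A *v x) \<le> - e * (norm x)\<^sup>2"
    and w: "w \<in> sq_integrable" and xL: "x \<in> loc_L2"
    and x: "\<And>t. 0 \<le> t \<Longrightarrow> x t = integral {0..t} (\<lambda>s. A *v x s + B_w *v vec (w s))"
    and \<sigma>: "\<sigma> \<ge> 0"
    and g: "\<And>s. s > \<sigma> \<Longrightarrow> integrable halfline (laplace_integrand g (of_real s))"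
      "\<And>s. s > \<sigma> \<Longrightarrow> laplace g (of_real s)
        = (state_space A (beside B_d B_w) (above C_z C_v) (block_matrix D_zd D_zw D_vd D_vw) (of_real s)
            *v laplace_pair (\<lambda>t. 0, w) (of_real s)) $ Inr 1"
  shows "AE t in halfline. g t = (C_v *v x t) $ 1 + D_vw $ 1 $ 1 * w t"
proof -
  have linA: "linear ((*v) A)" by simp
  have linB: "linear (\<lambda>r. B_w *v vec r)" by (rule linear_input_matrix)
  have linC: "linear (\<lambda>x. (C_v *v x) $ 1)" by (rule linear_output_row)
  define u where "u = (\<lambda>s. B_w *v (vec (w s) :: real^1))"
  have us: "u \<in> sq_integrable" unfolding u_def by (rule sq_integrable_linear_image[OF w linB])
  note uL = sq_integrable_loc_L2[OF us]
  have Qsym: "(Q *v a) \<bullet> b = a \<bullet> (Q *v b)" for a b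
    using dot_lmul_matrix[of a Q b] transpose_matrix_vector[of Q a] Q by simp
  obtain K where K: "\<And>x. norm (Q *v x) \<le> K * norm x"
    using linear_bounded[of "(*v) Q"] by auto
  \<comment> \<open>The bound on the state comes from the storage given by \<open>Q\<close>, which
    is nonnegative by \<open>lyapunov_positive\<close>.\<close>
  have xs: "x \<in> sq_integrable"
  proof (rule sq_integrable_I(1)[OF xL])
    fix T :: real assume T: "0 \<le> T"
    have "energy x T \<le> (K / e)\<^sup>2 * energy u T"
      by (rule lyapunov_energy_bound[OF linA, where Q = "(*v) Q"])
        (use Qsym lyapunov_positive[OF A Q e] e K uL(1) xL x T in \<open>auto simp: u_def\<close>)
    also have "\<dots> \<le> (K / e)\<^sup>2 * (LINT t|halfline. (norm (u t))\<^sup>2)"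
      by (intro mult_left_mono uL(2)) auto
    finally show "energy x T \<le> (K / e)\<^sup>2 * (LINT t|halfline. (norm (u t))\<^sup>2)" .
  qed
  define v where "v = (\<lambda>t. (C_v *v x t) $ 1 + D_vw $ 1 $ 1 * w t)"
  have cx: "(\<lambda>t. (C_v *v x t) $ 1) \<in> sq_integrable" by (rule sq_integrable_linear_image[OF xs linC])
  have linD: "linear (\<lambda>r. D_vw $ 1 $ 1 * r)" by (rule bounded_linear.linear[OF bounded_linear_mult_right])
  have dw: "(\<lambda>t. D_vw $ 1 $ 1 * w t) \<in> sq_integrable" by (rule sq_integrable_linear_image[OF w linD])
  have vs: "v \<in> sq_integrable" unfolding v_def by (rule sq_integrable_add[OF cx dw])
  have "AE t in halfline. g t - v t = 0"
  proof (rule laplace_injective_real)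
    fix s assume s: "s > \<sigma>"
    then have s0: "s > 0" using \<sigma> by simp
    note ex = sq_integrable_exp_integrable[OF _ s0]
    have Ax: "(\<lambda>t. A *v x t) \<in> sq_integrable" by (rule sq_integrable_linear_image[OF xs linA])
    have "s *\<^sub>R lap x s = lap (\<lambda>t. A *v x t + u t) s"
      by (rule lap_indefinite_integral[OF sq_integrable_add[OF Ax us] xs s0]) (simp add: x u_def)
    also have "\<dots> = lap (\<lambda>t. A *v x t) s + lap u s" by (intro lap_add ex Ax us)
    also have "lap (\<lambda>t. A *v x t) s = A *v lap x s" by (rule lap_linear_image[OF ex[OF xs] linA])
    also have "lap u s = B_w *v vec (lap w s)" unfolding u_def by (rule lap_linear_image[OF ex[OF w] linB])
    finally have lx: "s *\<^sub>R lap x s = A *v lap x s + B_w *v vec (lap w s)" .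
    define z where "z = (\<chi> i. complex_of_real (lap x s $ i))"
    have "(mat (of_real s) - complex_matrix A) *v z = complex_matrix B_w *v vec (of_real (lap w s))"
    proof -
      have vw: "(vec (of_real (lap w s)) :: complex^1) = (\<chi> i. complex_of_real ((vec (lap w s) :: real^1) $ i))"
        by (simp add: vec_eq_iff)
      have "(s *\<^sub>R lap x s) $ i = (A *v lap x s) $ i + (B_w *v vec (lap w s)) $ i" for i
        using arg_cong[OF lx, of "\<lambda>y. y $ i"] by simp
      then have "complex_of_real s * of_real (lap x s $ i)
         = of_real ((A *v lap x s) $ i) + of_real ((B_w *v vec (lap w s)) $ i)" for i
        by (simp flip: of_real_mult of_real_add)
      then show ?thesis
        unfolding vw matrix_vector_mult_diff_rdistrib mat_mult_vec z_def complex_matrix_vector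
        by (simp add: vec_eq_iff)
    qed
    note second = state_space_second_output[OF hurwitz_invertible[OF A] this]
    have lp: "laplace_pair (\<lambda>t. 0, w) (of_real s) = join 0 (vec (of_real (lap w s)))"
      by (simp add: laplace_pair_def join_def vec_eq_iff laplace_eq_lap lap_def split: sum.split)
    have "complex_of_real (lap g s) = (complex_matrix C_v *v z) $ 1 + of_real (D_vw $ 1 $ 1) * of_real (lap w s)"
      using g(2)[OF s] second[of B_d C_z C_v D_zd D_zw D_vd D_vw] s0 by (simp add: lp laplace_eq_lap)
    also have "(complex_matrix C_v *v z) $ 1 = of_real ((C_v *v lap x s) $ 1)"
      by (simp add: z_def complex_matrix_vector)
    finally have lg: "lap g s = (C_v *v lap x s) $ 1 + D_vw $ 1 $ 1 * lap w s"
      by (simp flip: of_real_mult of_real_add)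
    have "lap v s = lap (\<lambda>t. (C_v *v x t) $ 1) s + lap (\<lambda>t. D_vw $ 1 $ 1 * w t) s"
      unfolding v_def by (intro lap_add ex cx dw)
    also have "\<dots> = lap g s"
      unfolding lg lap_linear_image[OF ex[OF xs] linC] lap_linear_image[OF ex[OF w] linD] ..
    finally have lv: "lap v s = lap g s" .
    show "integrable halfline (\<lambda>t. exp (- s * t) *\<^sub>R (g t - v t))"
      unfolding scaleR_diff_right by (intro Bochner_Integration.integrable_diff ex vs laplace_of_real_integrable g(1) s)
    show "lap (\<lambda>t. g t - v t) s = 0"
      using lv laplace_of_real_integrable[OF g(1)[OF s]] ex[OF vs] by (simp add: lap_def right_diff_distrib)
  qed
  then show ?thesis by (simp add: v_def)
qed


section \<open>The nominal loop\<close>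

lemma energy_cong_negligible:
  assumes "negligible {t \<in> {0..T}. f t \<noteq> g t}"
  shows "energy f T = energy g T"
  unfolding energy_def by (rule integral_spike[OF assms]) auto

lemma L2_norm_square: "(L2_norm f)\<^sup>2 = (LINT t|halfline. (norm (f t))\<^sup>2)"
  by (simp add: L2_norm_def)

lemma energy_le_L2_norm: "f \<in> sq_integrable \<Longrightarrow> energy f T \<le> (L2_norm f)\<^sup>2"
  unfolding L2_norm_square by (rule sq_integrable_loc_L2(2))

lemma L2_norm_trunc_le: "f \<in> loc_L2 \<Longrightarrow> 0 < T \<Longrightarrow> (L2_norm (trunc T f))\<^sup>2 \<le> energy f T"
  unfolding L2_norm_square
  by (rule sq_integrable_I(2)[OF sq_integrable_loc_L2(1)[OF trunc_L2]]) (auto intro: energy_trunc_le)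

lemma sig_eq_sym: "f =\<^sub>a\<^sub>e g \<Longrightarrow> g =\<^sub>a\<^sub>e f"
  unfolding sig_eq_def by (erule eventually_mono) simp

lemma sig_eq_trans: "f =\<^sub>a\<^sub>e g \<Longrightarrow> g =\<^sub>a\<^sub>e k \<Longrightarrow> f =\<^sub>a\<^sub>e k"
  unfolding sig_eq_def by (erule (1) eventually_elim2) simp

lemma sig_eq_halfline: "(\<And>t. 0 \<le> t \<Longrightarrow> f t = g t) \<Longrightarrow> f =\<^sub>a\<^sub>e g"
  unfolding sig_eq_def by (rule AE_I2) (simp add: space_restrict_space)

lemma energy_sig_eq: "f =\<^sub>a\<^sub>e g \<Longrightarrow> energy f T = energy g T"
  unfolding sig_eq_def by (rule energy_AE_cong)

lemma integral_sig_eq: "f =\<^sub>a\<^sub>e g \<Longrightarrow> 0 \<le> a \<Longrightarrow> integral {a..b} f = integral {a..b} g"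
  unfolding sig_eq_def by (rule integral_AE_cong)

lemma sig_eq_if_energy_zero:
  assumes f: "f \<in> loc_L2" and g: "g \<in> loc_L2" and e: "\<And>T. 0 < T \<Longrightarrow> energy (\<lambda>t. f t - g t) T \<le> 0"
  shows "f =\<^sub>a\<^sub>e g"
  unfolding sig_eq_def
proof (rule AE_from_negligible_Icc)
  fix n :: nat
  have "negligible {t \<in> {0..real n + 1}. f t - g t \<noteq> 0}"
    by (rule energy_eq_0_imp_AE[OF loc_L2_diff[OF f g] e]) simp
  then show "negligible {t \<in> {0..real n}. \<not> f t = g t}"
    by (rule negligible_subset) auto
qed

lemma trunc_sig_eq_if_energy_zero:
  assumes f: "f \<in> loc_L2" and g: "g \<in> loc_L2" and e: "energy (\<lambda>t. f t - g t) T \<le> 0"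
  shows "trunc T f =\<^sub>a\<^sub>e trunc T g"
  unfolding trunc_sig_eq_iff using energy_eq_0_imp_AE[OF loc_L2_diff[OF f g] e] by simp

lemma energy_diff_trunc: "energy (\<lambda>t. f t - trunc T f t) T = 0"
proof -
  have "energy (\<lambda>t. f t - trunc T f t) T = integral {0..T} (\<lambda>t. 0)"
    unfolding energy_def by (rule integral_cong) (simp add: trunc_def)
  then show ?thesis by simp
qed

section \<open>Superposition and gains in the nominal loop\<close>

lemma loop_solution_linear:
  assumes lin: "linear_sys G" "linear_sys \<Delta>"
    and s: "loop_solution G \<Delta> d x" "loop_solution G \<Delta> d' x'"
  shows "loop_solution G \<Delta> (\<lambda>t. a * fst d t + b * fst d' t, \<lambda>t. a * snd d t + b * snd d' t)
     (\<lambda>t. a * fst x t + b * fst x' t, \<lambda>t. a * snd x t + b * snd x' t)"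
proof -
  have x: "fst x \<in> L2e" "snd x \<in> L2e" "fst x' \<in> L2e" "snd x' \<in> L2e"
    using s by (auto simp: loop_solution_def)
  have "\<Delta> (\<lambda>t. a * snd x t + b * snd x' t) =\<^sub>a\<^sub>e (\<lambda>t. a * \<Delta> (snd x) t + b * \<Delta> (snd x') t)"
    "G (\<lambda>t. a * fst x t + b * fst x' t) =\<^sub>a\<^sub>e (\<lambda>t. a * G (fst x) t + b * G (fst x') t)"
    using lin x by (auto simp: linear_sys_def)
  note L = this
  have S: "fst x =\<^sub>a\<^sub>e (\<lambda>t. \<Delta> (snd x) t + fst d t)" "snd x =\<^sub>a\<^sub>e (\<lambda>t. G (fst x) t + snd d t)"
    "fst x' =\<^sub>a\<^sub>e (\<lambda>t. \<Delta> (snd x') t + fst d' t)" "snd x' =\<^sub>a\<^sub>e (\<lambda>t. G (fst x') t + snd d' t)"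
    using s by (auto simp: loop_solution_def)
  have "(\<lambda>t. a * fst x t + b * fst x' t) =\<^sub>a\<^sub>e
      (\<lambda>t. \<Delta> (\<lambda>t. a * snd x t + b * snd x' t) t + (a * fst d t + b * fst d' t))"
    using L(1) S(1,3) unfolding sig_eq_def by eventually_elim (simp add: algebra_simps)
  moreover have "(\<lambda>t. a * snd x t + b * snd x' t) =\<^sub>a\<^sub>e
      (\<lambda>t. G (\<lambda>t. a * fst x t + b * fst x' t) t + (a * snd d t + b * snd d' t))"
    using L(2) S(2,4) unfolding sig_eq_def by eventually_elim (simp add: algebra_simps)
  moreover have "(\<lambda>t. a * f t + b * g t) \<in> L2e" if "f \<in> L2e" "g \<in> L2e" for f g
    using that unfolding L2e_eq_loc_L2 by (intro loc_L2_add loc_L2_cmult)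
  ultimately show ?thesis using x by (simp add: loop_solution_def)
qed

lemma loop_solution_input_cong:
  assumes "loop_solution G \<Delta> (dw, dv) x" "dw =\<^sub>a\<^sub>e dw'"
  shows "loop_solution G \<Delta> (dw', dv) x"
proof -
  have "fst x =\<^sub>a\<^sub>e (\<lambda>t. \<Delta> (snd x) t + dw t)" using assms(1) by (simp add: loop_solution_def)
  then have "fst x =\<^sub>a\<^sub>e (\<lambda>t. \<Delta> (snd x) t + dw' t)"
    using assms(2) unfolding sig_eq_def by eventually_elim simp
  then show ?thesis using assms(1) by (simp add: loop_solution_def)
qed

lemma neg_sys_linear:
  assumes "linear_sys F"
  shows "linear_sys (neg_sys F)"
  unfolding linear_sys_def
proof (intro ballI allI)
  fix u v a b assume "u \<in> L2e" "v \<in> L2e"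
  then have "F (\<lambda>t. a * u t + b * v t) =\<^sub>a\<^sub>e (\<lambda>t. a * F u t + b * F v t)"
    using assms by (simp add: linear_sys_def)
  then show "neg_sys F (\<lambda>t. a * u t + b * v t) =\<^sub>a\<^sub>e (\<lambda>t. a * neg_sys F u t + b * neg_sys F v t)"
    unfolding sig_eq_def neg_sys_def by (rule eventually_mono) simp
qed

text \<open>Inputs are truncated at \<open>T\<close>: by causality the solution on
  \<open>[0, T]\<close> does not change, and the norm of the truncated input is controlled by the
  energy up to \<open>T\<close>. This extends the gain from \<open>L2\<close> to \<open>L2e\<close>,
  horizon by horizon.\<close>

lemma stable_interconnection_gain:
  assumes "stable_interconnection G \<Delta>"
  shows "\<exists>c\<ge>0. \<forall>d\<in>loc_L2 \<times> loc_L2. \<forall>T>0. energy (fst (closed_loop G \<Delta> d)) T + energy (snd (closed_loop G \<Delta> d)) T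
    \<le> c * (energy (fst d) T + energy (snd d) T)"
proof -
  obtain c where c: "\<And>d. d \<in> L2 \<times> L2 \<Longrightarrow> closed_loop G \<Delta> d \<in> L2 \<times> L2 \<and>
      pair_norm (closed_loop G \<Delta> d) \<le> c * pair_norm d"
    using assms unfolding stable_interconnection_def by blast
  have "energy (fst (closed_loop G \<Delta> d)) T + energy (snd (closed_loop G \<Delta> d)) T
    \<le> c\<^sup>2 * (energy (fst d) T + energy (snd d) T)" if d: "d \<in> loc_L2 \<times> loc_L2" and T: "0 < T" for d T
  proof -
    let ?d = "(trunc T (fst d), trunc T (snd d))"
    let ?x = "closed_loop G \<Delta> ?d" and ?y = "closed_loop G \<Delta> d"
    have dl: "fst d \<in> loc_L2" "snd d \<in> loc_L2" using d by auto
    have "?d \<in> L2 \<times> L2" using trunc_L2[OF dl(1) T] trunc_L2[OF dl(2) T] by (simp add: L2_eq_sq_integrable)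
    note x = c[OF this]
    have "trunc T (fst ?x) =\<^sub>a\<^sub>e trunc T (fst ?y)" "trunc T (snd ?x) =\<^sub>a\<^sub>e trunc T (snd ?y)"
      using assms T d unfolding stable_interconnection_def well_posed_def L2e_eq_loc_L2 Let_def by blast+
    then have "energy (fst ?x) T = energy (fst ?y) T" "energy (snd ?x) T = energy (snd ?y) T"
      unfolding trunc_sig_eq_iff by (auto intro: energy_cong_negligible)
    then have "energy (fst ?y) T + energy (snd ?y) T = energy (fst ?x) T + energy (snd ?x) T"
      by simp
    also have "\<dots> \<le> (L2_norm (fst ?x))\<^sup>2 + (L2_norm (snd ?x))\<^sup>2"
      using x by (intro add_mono energy_le_L2_norm) (auto simp: L2_eq_sq_integrable mem_Times_iff)
    also have "\<dots> = (pair_norm ?x)\<^sup>2" by (simp add: pair_norm_def)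
    also have "\<dots> \<le> (c * pair_norm ?d)\<^sup>2"
      using x by (intro power_mono) (auto simp: pair_norm_def)
    also have "\<dots> = c\<^sup>2 * ((L2_norm (trunc T (fst d)))\<^sup>2 + (L2_norm (trunc T (snd d)))\<^sup>2)"
      by (simp add: pair_norm_def power_mult_distrib)
    also have "\<dots> \<le> c\<^sup>2 * (energy (fst d) T + energy (snd d) T)"
      by (intro mult_left_mono add_mono L2_norm_trunc_le dl T) auto
    finally show ?thesis .
  qed
  then show ?thesis by (intro exI[of _ "c\<^sup>2"]) auto
qed

text \<open>\<open>D y\<close> is a derivative of \<open>F y\<close> with finite gain on every
  horizon; it takes the place of the arbitrary choice in \<open>diff_sys\<close>.\<close>

locale nominal_loop =
  fixes P F D :: sys and cD cN :: real
  assumes linP: "linear_sys P" and linF: "linear_sys F" and causP: "causal P" and causF: "causal F"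
    and wp: "well_posed P (neg_sys F)"
    and cD: "0 \<le> cD" and cN: "0 \<le> cN"
    and D_loc: "\<And>y. y \<in> loc_L2 \<Longrightarrow> D y \<in> loc_L2"
    and D_int: "\<And>y. y \<in> loc_L2 \<Longrightarrow> F y =\<^sub>a\<^sub>e (\<lambda>t. integral {0..t} (D y))"
    and D_gain: "\<And>y T. y \<in> loc_L2 \<Longrightarrow> 0 \<le> T \<Longrightarrow> energy (D y) T \<le> cD * energy y T"
    and N_gain: "\<And>d T. d \<in> loc_L2 \<times> loc_L2 \<Longrightarrow> 0 < T \<Longrightarrow>
       energy (fst (closed_loop P (neg_sys F) d)) T + energy (snd (closed_loop P (neg_sys F) d)) T
         \<le> cN * (energy (fst d) T + energy (snd d) T)"
begin

abbreviation N :: "signal \<Rightarrow> signal \<Rightarrow> signal \<times> signal" where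
  "N dw dv \<equiv> closed_loop P (neg_sys F) (dw, dv)"

lemma N_solution: "dw \<in> loc_L2 \<Longrightarrow> dv \<in> loc_L2 \<Longrightarrow> loop_solution P (neg_sys F) (dw, dv) (N dw dv)"
  unfolding closed_loop_def
  by (rule someI_ex) (use wp in \<open>auto simp: well_posed_def L2e_eq_loc_L2\<close>)

lemma N_unique:
  assumes "dw \<in> loc_L2" "dv \<in> loc_L2" "loop_solution P (neg_sys F) (dw, dv) x"
  shows "fst x =\<^sub>a\<^sub>e fst (N dw dv)" "snd x =\<^sub>a\<^sub>e snd (N dw dv)"
  using assms N_solution[OF assms(1,2)] wp unfolding well_posed_def L2e_eq_loc_L2 by blast+

lemma N_loc: "dw \<in> loc_L2 \<Longrightarrow> dv \<in> loc_L2 \<Longrightarrow> fst (N dw dv) \<in> loc_L2 \<and> snd (N dw dv) \<in> loc_L2"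
  using N_solution by (auto simp: loop_solution_def L2e_eq_loc_L2)

lemma N_add:
  assumes "dw \<in> loc_L2" "dv \<in> loc_L2" "dw' \<in> loc_L2" "dv' \<in> loc_L2"
  shows "snd (N (\<lambda>t. a * dw t + b * dw' t) (\<lambda>t. a * dv t + b * dv' t))
    =\<^sub>a\<^sub>e (\<lambda>t. a * snd (N dw dv) t + b * snd (N dw' dv') t)"
proof -
  let ?dw = "\<lambda>t. a * dw t + b * dw' t" and ?dv = "\<lambda>t. a * dv t + b * dv' t"
  have d: "?dw \<in> loc_L2" "?dv \<in> loc_L2" by (intro loc_L2_add loc_L2_cmult assms)+
  have "loop_solution P (neg_sys F) (?dw, ?dv) (\<lambda>t. a * fst (N dw dv) t + b * fst (N dw' dv') t,
      \<lambda>t. a * snd (N dw dv) t + b * snd (N dw' dv') t)"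
    using loop_solution_linear[OF linP neg_sys_linear[OF linF] N_solution[OF assms(1,2)] N_solution[OF assms(3,4)], of a b]
    by simp
  from N_unique(2)[OF d this] show ?thesis by (simp add: sig_eq_sym)
qed

text \<open>The locale gives no linearity of \<open>D\<close>; it follows from that of
  \<open>F\<close>, since weak derivatives are unique.\<close>

lemma D_linear:
  assumes y: "y \<in> loc_L2" "y' \<in> loc_L2"
  shows "D (\<lambda>t. a * y t + b * y' t) =\<^sub>a\<^sub>e (\<lambda>t. a * D y t + b * D y' t)"
proof -
  let ?z = "\<lambda>t. a * y t + b * y' t" and ?g = "\<lambda>t. a * D y t + b * D y' t"
  have z: "?z \<in> loc_L2" by (intro loc_L2_add loc_L2_cmult y)
  have g: "?g \<in> loc_L2" by (intro loc_L2_add loc_L2_cmult D_loc y)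
  have gi: "integral {0..t} ?g = a * integral {0..t} (D y) + b * integral {0..t} (D y')" for t
    using loc_L2_integrable[OF D_loc[OF y(1)] order_refl] loc_L2_integrable[OF D_loc[OF y(2)] order_refl]
    by (subst integral_add) (auto intro: integrable_on_mult_right)
  have "F ?z =\<^sub>a\<^sub>e (\<lambda>t. a * F y t + b * F y' t)"
    using linF y by (auto simp: linear_sys_def L2e_eq_loc_L2)
  then have "AE t in halfline. 0 + integral {0..t} (D ?z) = 0 + integral {0..t} ?g"
    using D_int[OF z] D_int[OF y(1)] D_int[OF y(2)] unfolding sig_eq_def gi by eventually_elim simp
  then show ?thesis unfolding sig_eq_def by (rule weak_derivative_unique[OF D_loc[OF z] g])
qed

lemma D_diff:
  assumes y: "y \<in> loc_L2" "y' \<in> loc_L2"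
  shows "D (\<lambda>t. y t - y' t) =\<^sub>a\<^sub>e (\<lambda>t. D y t - D y' t)"
  using D_linear[OF y, of 1 "- 1"] by simp

lemma D_add:
  assumes y: "y \<in> loc_L2" "y' \<in> loc_L2"
  shows "D (\<lambda>t. y t + y' t) =\<^sub>a\<^sub>e (\<lambda>t. D y t + D y' t)"
  using D_linear[OF y, of 1 1] by simp

text \<open>Causality phrased with energies: linearity reduces it to the finite-horizon gain of
  \<open>D\<close> on the difference.\<close>

lemma D_causal:
  assumes y: "y \<in> loc_L2" "y' \<in> loc_L2" and T: "0 \<le> T" and eq: "energy (\<lambda>t. y t - y' t) T \<le> 0"
  shows "energy (\<lambda>t. D y t - D y' t) T \<le> 0"
proof -
  have "energy (\<lambda>t. D y t - D y' t) T = energy (D (\<lambda>t. y t - y' t)) T"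
    by (rule energy_sig_eq[OF sig_eq_sym[OF D_diff[OF y]]])
  also have "\<dots> \<le> cD * energy (\<lambda>t. y t - y' t) T" by (rule D_gain[OF loc_L2_diff[OF y] T])
  also have "\<dots> \<le> 0" using cD eq by (rule mult_nonneg_nonpos)
  finally show ?thesis .
qed

lemma D_cong:
  assumes y: "y \<in> loc_L2" "y' \<in> loc_L2" and eq: "y =\<^sub>a\<^sub>e y'"
  shows "D y =\<^sub>a\<^sub>e D y'"
proof (rule sig_eq_if_energy_zero[OF D_loc[OF y(1)] D_loc[OF y(2)]])
  fix T :: real assume "0 < T"
  have "(\<lambda>t. y t - y' t) =\<^sub>a\<^sub>e (\<lambda>t. 0)" using eq unfolding sig_eq_def by eventually_elim simp
  then have "energy (\<lambda>t. y t - y' t) T = 0" by (simp add: energy_sig_eq) (simp add: energy_def)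
  then show "energy (\<lambda>t. D y t - D y' t) T \<le> 0" using \<open>0 < T\<close> by (intro D_causal y) auto
qed

lemma diff_sys_eq_D:
  assumes y: "y \<in> loc_L2"
  shows "diff_sys (F y) =\<^sub>a\<^sub>e D y"
proof -
  have LI: "(LINT x:{0..t}|lebesgue. g x) = integral {0..t} g" if "g \<in> loc_L2" for g :: signal and t
    by (rule set_lebesgue_integral_eq_integral(2)[OF loc_L2_absolutely_integrable[OF that order_refl]])
  have "D y \<in> L2e \<and> (\<exists>c. AE t in halfline. F y t = c + (LINT x:{0..t}|lebesgue. D y x))"
    using D_loc[OF y] D_int[OF y] by (auto intro!: exI[of _ 0] simp: L2e_eq_loc_L2 LI sig_eq_def)
  from someI[of "\<lambda>g. g \<in> L2e \<and> (\<exists>c. AE t in halfline. F y t = c + (LINT x:{0..t}|lebesgue. g x))", OF this]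
  have g: "diff_sys (F y) \<in> loc_L2"
    and "\<exists>c. AE t in halfline. F y t = c + (LINT x:{0..t}|lebesgue. diff_sys (F y) x)"
    unfolding diff_sys_def by (simp_all add: L2e_eq_loc_L2)
  then obtain c where "AE t in halfline. F y t = c + integral {0..t} (diff_sys (F y))"
    by (auto simp: LI)
  then have "AE t in halfline. c + integral {0..t} (diff_sys (F y)) = 0 + integral {0..t} (D y)"
    using D_int[OF y] unfolding sig_eq_def by eventually_elim simp
  then show ?thesis unfolding sig_eq_def by (rule weak_derivative_unique[OF g D_loc[OF y]])
qed

text \<open>The channel from \<open>w\<close> to \<open>v\<close> of the generalized plant, with
  \<open>D\<close> for the differentiation.\<close>

definition H :: sys where "H w = D (snd (N w (\<lambda>t. 0)))"

lemma H_loc: "w \<in> loc_L2 \<Longrightarrow> H w \<in> loc_L2"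
  unfolding H_def using N_loc[OF _ loc_L2_zero] by (intro D_loc) blast

lemma N_output_gain:
  assumes d: "dw \<in> loc_L2" "dv \<in> loc_L2" and T: "0 < T"
  shows "energy (D (snd (N dw dv))) T \<le> cD * cN * (energy dw T + energy dv T)"
proof -
  note n = N_loc[OF d]
  have "energy (snd (N dw dv)) T \<le> cN * (energy dw T + energy dv T)"
    using N_gain[of "(dw, dv)" T] d T energy_nonneg[of "fst (N dw dv)" T] n by simp
  then have "cD * energy (snd (N dw dv)) T \<le> cD * (cN * (energy dw T + energy dv T))"
    using cD by (rule mult_left_mono)
  then show ?thesis using D_gain[of "snd (N dw dv)" T] n T by (simp add: mult.assoc)
qed

lemma H_diff:
  assumes w: "w \<in> loc_L2" "w' \<in> loc_L2"
  shows "(\<lambda>t. H w t - H w' t) =\<^sub>a\<^sub>e H (\<lambda>t. w t - w' t)"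
proof -
  note z = loc_L2_zero
  note n = N_loc[OF w(1) z] N_loc[OF w(2) z] N_loc[OF loc_L2_diff[OF w] z]
  have eq: "snd (N (\<lambda>t. w t - w' t) (\<lambda>t. 0)) =\<^sub>a\<^sub>e (\<lambda>t. snd (N w (\<lambda>t. 0)) t - snd (N w' (\<lambda>t. 0)) t)"
    using N_add[OF w(1) z w(2) z, of 1 "- 1"] by simp
  have "H (\<lambda>t. w t - w' t) =\<^sub>a\<^sub>e D (\<lambda>t. snd (N w (\<lambda>t. 0)) t - snd (N w' (\<lambda>t. 0)) t)"
    unfolding H_def by (rule D_cong[OF _ _ eq]) (use n in \<open>auto intro: loc_L2_diff\<close>)
  moreover have "D (\<lambda>t. snd (N w (\<lambda>t. 0)) t - snd (N w' (\<lambda>t. 0)) t) =\<^sub>a\<^sub>e (\<lambda>t. H w t - H w' t)"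
    unfolding H_def by (rule D_diff) (use n in auto)
  ultimately show ?thesis by (rule sig_eq_sym[OF sig_eq_trans])
qed

lemma H_gain:
  assumes w: "w \<in> loc_L2" and T: "0 \<le> T"
  shows "energy (H w) T \<le> cD * cN * energy w T"
proof (cases "T = 0")
  case True
  then show ?thesis by (simp add: energy_def)
next
  case False
  then have "energy (H w) T \<le> cD * cN * (energy w T + energy (\<lambda>t. 0 :: real) T)"
    unfolding H_def using T by (intro N_output_gain w loc_L2_zero) auto
  then show ?thesis by (simp add: energy_def)
qed

lemma H_diff_gain:
  assumes w: "w \<in> loc_L2" "w' \<in> loc_L2" and T: "0 \<le> T"
  shows "energy (\<lambda>t. H w t - H w' t) T \<le> cD * cN * energy (\<lambda>t. w t - w' t) T"
  unfolding energy_sig_eq[OF H_diff[OF w]] by (rule H_gain[OF loc_L2_diff[OF w] T])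

text \<open>Superposition: an additional input \<open>w\<close> next to \<open>dw\<close> adds
  \<open>H w\<close> to the response of the nominal loop to the external disturbances.\<close>

lemma D_solution:
  assumes d: "dw \<in> loc_L2" "dv \<in> loc_L2" and w: "w \<in> loc_L2"
    and s: "loop_solution P (neg_sys F) (\<lambda>t. w t + dw t, dv) (u, y)"
  shows "D y =\<^sub>a\<^sub>e (\<lambda>t. H w t + D (snd (N dw dv)) t)"
proof -
  note z = loc_L2_zero
  have yl: "y \<in> loc_L2" using s by (simp add: loop_solution_def L2e_eq_loc_L2)
  have n: "snd (N w (\<lambda>t. 0)) \<in> loc_L2" "snd (N dw dv) \<in> loc_L2"
    using N_loc[OF w z] N_loc[OF d] by auto
  have "y =\<^sub>a\<^sub>e snd (N (\<lambda>t. w t + dw t) dv)"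
    using N_unique(2)[OF loc_L2_add[OF w d(1)] d(2) s] by simp
  also have "snd (N (\<lambda>t. w t + dw t) dv) =\<^sub>a\<^sub>e (\<lambda>t. snd (N w (\<lambda>t. 0)) t + snd (N dw dv) t)"
    using N_add[OF w z d, of 1 1] by simp
  finally (sig_eq_trans) have "D y =\<^sub>a\<^sub>e D (\<lambda>t. snd (N w (\<lambda>t. 0)) t + snd (N dw dv) t)"
    by (rule D_cong[OF yl loc_L2_add[OF n]])
  then show ?thesis unfolding H_def using D_add[OF n] by (rule sig_eq_trans)
qed

end


section \<open>The sampled loop\<close>

text \<open>\<open>p\<close> is the output of the realization and \<open>q\<close> the part of
  \<open>v\<close> caused by external disturbances. Young's inequality absorbs each of the two cross
  terms with \<open>q\<close> at the price of a quarter of the margin, which leaves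
  \<open>e / 2\<close>.\<close>

lemma dissipation_pointwise:
  fixes p q r s Z \<alpha> X Y e \<kappa> :: real
  assumes diss: "Z + \<alpha> * p\<^sup>2 + 2 * Y * (p * r) - X * r\<^sup>2 \<le> - e * s"
    and p: "p\<^sup>2 \<le> \<kappa> * s" and r: "r\<^sup>2 \<le> s" and e: "0 < e" and \<kappa>: "0 < \<kappa>"
  shows "\<alpha> * (p + q)\<^sup>2 + 2 * Y * ((p + q) * r) - X * r\<^sup>2
    \<le> - Z - e / 2 * s + (\<alpha> + 4 * \<kappa> * \<alpha>\<^sup>2 / e + 4 * Y\<^sup>2 / e) * q\<^sup>2"
proof -
  have young: "2 * (a * b) \<le> \<mu> * a\<^sup>2 + b\<^sup>2 / \<mu>" if "0 < \<mu>" for a b \<mu> :: real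
  proof -
    have "0 \<le> (\<mu> * a - b)\<^sup>2 / \<mu>" using that by simp
    also have "\<dots> = \<mu> * a\<^sup>2 + b\<^sup>2 / \<mu> - 2 * (a * b)"
      using that by (simp add: power2_diff power_mult_distrib field_simps power2_eq_square)
    finally show ?thesis by simp
  qed
  have "2 * (p * (\<alpha> * q)) \<le> (e / (4 * \<kappa>)) * p\<^sup>2 + (\<alpha> * q)\<^sup>2 / (e / (4 * \<kappa>))"
    by (rule young) (use e \<kappa> in simp)
  also have "(e / (4 * \<kappa>)) * p\<^sup>2 \<le> (e / (4 * \<kappa>)) * (\<kappa> * s)"
    by (rule mult_left_mono[OF p]) (use e \<kappa> in simp)
  finally have 1: "2 * (p * (\<alpha> * q)) \<le> e / 4 * s + 4 * \<kappa> * \<alpha>\<^sup>2 / e * q\<^sup>2"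
    using e \<kappa> by (simp add: field_simps)
  have "2 * (r * (Y * q)) \<le> (e / 4) * r\<^sup>2 + (Y * q)\<^sup>2 / (e / 4)"
    by (rule young) (use e in simp)
  also have "(e / 4) * r\<^sup>2 \<le> (e / 4) * s" by (rule mult_left_mono[OF r]) (use e in simp)
  finally have 2: "2 * (r * (Y * q)) \<le> e / 4 * s + 4 * Y\<^sup>2 / e * q\<^sup>2"
    using e by (simp add: field_simps)
  have "\<alpha> * (p + q)\<^sup>2 + 2 * Y * ((p + q) * r) - X * r\<^sup>2
    = (\<alpha> * p\<^sup>2 + 2 * Y * (p * r) - X * r\<^sup>2) + 2 * (p * (\<alpha> * q)) + \<alpha> * q\<^sup>2 + 2 * (r * (Y * q))"
    by (simp add: power2_sum algebra_simps)
  also have "\<dots> \<le> (- Z - e * s) + (e / 4 * s + 4 * \<kappa> * \<alpha>\<^sup>2 / e * q\<^sup>2) + \<alpha> * q\<^sup>2 + (e / 4 * s + 4 * Y\<^sup>2 / e * q\<^sup>2)"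
    using diss 1 2 by linarith
  also have "\<dots> = - Z - e / 2 * s + (\<alpha> + 4 * \<kappa> * \<alpha>\<^sup>2 / e + 4 * Y\<^sup>2 / e) * q\<^sup>2"
    by (simp add: algebra_simps)
  finally show ?thesis .
qed

text \<open>The hypothesis on the quadratic integral is what the gain and passivity of the sampling
  error supply. Integrated dissipation, with storage zero at the start and nonnegative at
  \<open>T\<close>, turns it into a bound whose constant depends neither on \<open>T\<close> nor on
  the signals.\<close>

lemma dissipation_bound:
  fixes A Q :: "real^'n^'n" and B :: "real^1^'n" and C :: "real^'n^1" and d \<alpha> X Y e :: real
  assumes Q: "transpose Q = Q" "\<And>x. 0 \<le> x \<bullet> (Q *v x)" and e: "0 < e" and \<alpha>: "0 \<le> \<alpha>"
    and diss: "\<And>x r. 2 * ((Q *v x) \<bullet> (A *v x + B *v vec r)) + \<alpha> * ((C *v x) $ 1 + d * r)\<^sup>2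
     + 2 * Y * (((C *v x) $ 1 + d * r) * r) - X * r\<^sup>2 \<le> - e * ((norm x)\<^sup>2 + r\<^sup>2)"
  shows "\<exists>c\<ge>0. \<forall>x w v0 T. 0 \<le> T \<longrightarrow> x \<in> loc_L2 \<longrightarrow> w \<in> loc_L2 \<longrightarrow> v0 \<in> loc_L2 \<longrightarrow>
     (\<forall>t\<ge>0. x t = integral {0..t} (\<lambda>s. A *v x s + B *v vec (w s))) \<longrightarrow>
     0 \<le> \<alpha> * energy (\<lambda>t. ((C *v x t) $ 1 + d * w t) + v0 t) T
       + 2 * Y * integral {0..T} (\<lambda>t. (((C *v x t) $ 1 + d * w t) + v0 t) * w t) - X * energy w T \<longrightarrow>
     energy w T \<le> c * energy v0 T"
proof -
  have linC: "linear (\<lambda>x. (C *v x) $ 1)" by (rule linear_output_row)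
  obtain k where k: "\<And>x. \<bar>(C *v x) $ 1\<bar> \<le> k * norm x"
    using linear_bounded[OF linC] by auto
  define \<kappa> where "\<kappa> = 2 * k\<^sup>2 + 2 * d\<^sup>2 + 1"
  have \<kappa>: "0 < \<kappa>" by (simp add: \<kappa>_def add_nonneg_pos)
  have y: "((C *v x) $ 1 + d * r)\<^sup>2 \<le> \<kappa> * ((norm x)\<^sup>2 + r\<^sup>2)" for x r
  proof -
    have "((C *v x) $ 1 + d * r)\<^sup>2 \<le> 2 * ((C *v x) $ 1)\<^sup>2 + 2 * (d * r)\<^sup>2"
      using norm_add_square_le[of "(C *v x) $ 1" "d * r"] by simp
    also have "((C *v x) $ 1)\<^sup>2 \<le> (k * norm x)\<^sup>2"
      using power_mono[OF k[of x] abs_ge_zero, of 2] by simp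
    finally have "((C *v x) $ 1 + d * r)\<^sup>2 \<le> 2 * (k\<^sup>2 * (norm x)\<^sup>2) + 2 * (d\<^sup>2 * r\<^sup>2)"
      by (simp add: power_mult_distrib)
    moreover have "0 \<le> k\<^sup>2 * r\<^sup>2" "0 \<le> d\<^sup>2 * (norm x)\<^sup>2" "0 \<le> (norm x)\<^sup>2" "0 \<le> r\<^sup>2" by simp_all
    moreover have "\<kappa> * ((norm x)\<^sup>2 + r\<^sup>2) = 2 * (k\<^sup>2 * (norm x)\<^sup>2) + 2 * (d\<^sup>2 * r\<^sup>2)
        + (2 * (k\<^sup>2 * r\<^sup>2) + 2 * (d\<^sup>2 * (norm x)\<^sup>2) + (norm x)\<^sup>2 + r\<^sup>2)"
      by (simp add: \<kappa>_def algebra_simps)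
    ultimately show ?thesis by linarith
  qed
  define c where "c = \<alpha> + 4 * \<kappa> * \<alpha>\<^sup>2 / e + 4 * Y\<^sup>2 / e"
  have c: "0 \<le> c" using \<alpha> \<kappa> e by (simp add: c_def)
  have Qsym: "(Q *v a) \<bullet> b = a \<bullet> (Q *v b)" for a b
    using dot_lmul_matrix[of a Q b] transpose_matrix_vector[of Q a] Q(1) by simp
  have "energy w T \<le> (2 * c / e) * energy v0 T"
    if T: "0 \<le> T" and x: "x \<in> loc_L2" and w: "w \<in> loc_L2" and v0: "v0 \<in> loc_L2"
      and xe: "\<forall>t\<ge>0. x t = integral {0..t} (\<lambda>s. A *v x s + B *v vec (w s))"
      and iqc: "0 \<le> \<alpha> * energy (\<lambda>t. ((C *v x t) $ 1 + d * w t) + v0 t) T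
       + 2 * Y * integral {0..T} (\<lambda>t. (((C *v x t) $ 1 + d * w t) + v0 t) * w t) - X * energy w T"
    for x w v0 T
  proof -
    define v where "v = (\<lambda>t. ((C *v x t) $ 1 + d * w t) + v0 t)"
    have v: "v \<in> loc_L2"
      unfolding v_def by (intro loc_L2_add loc_L2_cmult w v0 loc_L2_linear_image[OF x linC])
    define g where "g = (\<lambda>t. A *v x t + B *v (vec (w t) :: real^1))"
    have g: "g \<in> loc_L2"
      unfolding g_def
      by (rule loc_L2_add[OF loc_L2_linear_image[OF x] loc_L2_linear_image[OF w linear_input_matrix]]) simp
    have Qx: "(\<lambda>t. Q *v x t) \<in> loc_L2" by (rule loc_L2_linear_image[OF x]) simp
    define Z where "Z = (\<lambda>t. 2 * ((Q *v x t) \<bullet> g t))"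
    have Zi: "Z integrable_on {0..T}"
      unfolding Z_def by (rule integrable_on_mult_right[OF loc_L2_inner_integrable[OF Qx g order_refl]])
    have ZT: "integral {0..T} Z = x T \<bullet> (Q *v x T)"
      unfolding Z_def by (rule quadratic_form_rate[OF g, where Q = "(*v) Q", symmetric])
        (use Qsym xe T in \<open>auto simp: g_def\<close>)
    note sq = loc_L2_square_integrable[OF _ order_refl, of _ T]
    have vw: "(\<lambda>t. v t * w t) integrable_on {0..T}"
      using loc_L2_inner_integrable[OF v w order_refl] by simp
    note i1 = integrable_on_mult_right[OF sq[OF v], of \<alpha>] and i2 = integrable_on_mult_right[OF vw, of "2 * Y"]
      and i3 = integrable_on_mult_right[OF sq[OF w], of X]
    note j1 = integrable_add[OF sq[OF x] sq[OF w]] and j3 = integrable_on_mult_right[OF sq[OF v0], of c]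
    note j2 = integrable_on_mult_right[OF j1, of "e / 2"]
    have "0 \<le> \<alpha> * energy v T + 2 * Y * integral {0..T} (\<lambda>t. v t * w t) - X * energy w T"
      using iqc by (simp add: v_def)
    also have "\<dots> = integral {0..T} (\<lambda>t. \<alpha> * (norm (v t))\<^sup>2 + 2 * Y * (v t * w t) - X * (norm (w t))\<^sup>2)"
      unfolding energy_def
      by (simp only: integral_diff[OF integrable_add[OF i1 i2] i3] integral_add[OF i1 i2] integral_mult_right)
    also have "\<dots> \<le> integral {0..T} (\<lambda>t. - Z t - e / 2 * ((norm (x t))\<^sup>2 + (norm (w t))\<^sup>2) + c * (norm (v0 t))\<^sup>2)"
    proof (rule integral_le)
      fix t
      show "\<alpha> * (norm (v t))\<^sup>2 + 2 * Y * (v t * w t) - X * (norm (w t))\<^sup>2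
        \<le> - Z t - e / 2 * ((norm (x t))\<^sup>2 + (norm (w t))\<^sup>2) + c * (norm (v0 t))\<^sup>2"
        using dissipation_pointwise[OF diss[of "x t" "w t"] y[of "x t" "w t"] _ e \<kappa>, of "v0 t"]
        by (simp add: v_def Z_def g_def c_def)
    qed (intro integrable_add integrable_diff integrable_neg i1 i2 i3 Zi j2 j3)+
    also have "\<dots> = - integral {0..T} Z - e / 2 * (energy x T + energy w T) + c * energy v0 T"
      unfolding energy_def
      by (simp only: integral_add[OF integrable_diff[OF integrable_neg[OF Zi] j2] j3]
          integral_diff[OF integrable_neg[OF Zi] j2] integral_neg integral_mult_right integral_add[OF sq[OF x] sq[OF w]])
    finally have "e / 2 * (energy x T + energy w T) \<le> c * energy v0 T"
      using Q(2)[of "x T"] ZT by simp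
    moreover have "0 \<le> e / 2 * energy x T" using e energy_nonneg[OF x, of T] by simp
    ultimately have "e / 2 * energy w T \<le> c * energy v0 T" by (simp add: distrib_left)
    then show ?thesis using e by (simp add: field_simps)
  qed
  then show ?thesis using c e by (intro exI[of _ "2 * c / e"]) auto
qed

section \<open>The sampling error as an operator\<close>

locale sampling =
  fixes T Ts \<phi> :: "nat \<Rightarrow> real" and L \<eta> :: real
  assumes T: "admissible T" and grid: "event_grid T \<phi> L \<eta>"
    and held: "\<And>a j t. \<phi> j \<le> t \<Longrightarrow> t < \<phi> (Suc j) \<Longrightarrow> hold Ts (sample Ts (hold T a)) t = a j"
begin

text \<open>The sampling error expressed through the derivative: the integral of \<open>v\<close>
  from zero stands for \<open>F y\<close>, which starts from rest.\<close>

definition E :: sys where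
  "E v t = integral {0..t} v - hold Ts (sample Ts (hold T (\<lambda>k. integral {0..T k} v))) t"

lemma E_eq:
  assumes v: "v \<in> loc_L2" and j: "\<phi> j \<le> t" "t < \<phi> (Suc j)"
  shows "E v t = integral {T j..t} v"
proof -
  have "integral {0..T j} v + integral {T j..t} v = integral {0..t} v"
    using event_grid_nonneg(1)[OF grid, of j] event_gridD(5)[OF grid, of j] j
    by (intro Henstock_Kurzweil_Integration.integral_combine loc_L2_integrable v) auto
  then show ?thesis by (simp add: E_def held[OF j])
qed

lemma E_sampling_error: "v \<in> loc_L2 \<Longrightarrow> sampling_error T \<phi> L \<eta> v (E v)"
  by unfold_locales (auto intro: grid E_eq)

lemma E_loc: "v \<in> loc_L2 \<Longrightarrow> E v \<in> loc_L2"
  by (rule sampling_error.w_loc_L2[OF E_sampling_error])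

text \<open>Equality is pointwise because \<open>E\<close> sees its argument only through
  integrals.\<close>

lemma E_cong: "v =\<^sub>a\<^sub>e v' \<Longrightarrow> E v = E v'"
  by (rule ext) (simp add: E_def integral_sig_eq[of v v'])

lemma E_diff:
  assumes v: "v \<in> loc_L2" "v' \<in> loc_L2" and t: "0 \<le> t"
  shows "E v t - E v' t = E (\<lambda>s. v s - v' s) t"
proof -
  obtain j where j: "\<phi> j \<le> t" "t < \<phi> (Suc j)" by (rule event_grid_index[OF grid t])
  show ?thesis
    unfolding E_eq[OF v(1) j] E_eq[OF v(2) j] E_eq[OF loc_L2_diff[OF v] j]
    by (rule integral_diff[symmetric]; intro loc_L2_integrable v event_grid_nonneg(1)[OF grid])
qed

text \<open>The bound by the energy up to the same time is what makes the loop equation one of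
  Volterra type. The growing factor \<open>t\<close> is harmless on a bounded horizon.\<close>

lemma E_bound:
  assumes v: "v \<in> loc_L2" and t: "0 \<le> t"
  shows "(E v t)\<^sup>2 \<le> t * energy v t"
proof -
  obtain j where j: "\<phi> j \<le> t" "t < \<phi> (Suc j)" by (rule event_grid_index[OF grid t])
  have Tj: "0 \<le> T j" "T j \<le> t"
    using event_grid_nonneg(1)[OF grid, of j] event_gridD(5)[OF grid, of j] j by auto
  have "(E v t)\<^sup>2 \<le> (t - T j) * integral {T j..t} (\<lambda>s. (norm (v s))\<^sup>2)"
    unfolding E_eq[OF v j] using integral_square_le[OF v Tj] by simp
  also have "\<dots> \<le> t * energy v t"
    unfolding energy_def using Tj
    by (intro mult_mono integral_subset_le loc_L2_square_integrable v integral_nonneg) auto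
  finally show ?thesis .
qed

lemma E_local:
  assumes v: "v \<in> loc_L2" "v' \<in> loc_L2" and e: "energy (\<lambda>s. v s - v' s) b \<le> 0" and t: "t \<in> {0..b}"
  shows "E v t = E v' t"
proof -
  have d: "(\<lambda>s. v s - v' s) \<in> loc_L2" by (rule loc_L2_diff[OF v])
  have t0: "0 \<le> t" using t by simp
  have "(E v t - E v' t)\<^sup>2 \<le> t * energy (\<lambda>s. v s - v' s) t"
    unfolding E_diff[OF v t0] by (rule E_bound[OF d t0])
  also have "\<dots> \<le> 0"
    using t0 energy_mono[OF d, of t b] e t by (intro mult_nonneg_nonpos) auto
  finally show ?thesis by simp
qed

end

text \<open>\<open>est\<close> is the a priori bound on solutions of the loop equation, the only
  point at which the matrix inequality and the sampling inequalities enter. Well-posedness and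
  stability follow from it abstractly.\<close>

locale sampled_loop = nominal_loop P F D cD cN + sampling T Ts \<phi> L \<eta>
  for P F D :: sys and cD cN :: real and T Ts \<phi> :: "nat \<Rightarrow> real" and L \<eta> :: real +
  fixes cW :: real
  assumes cW: "0 \<le> cW"
    and est: "\<And>w v0 b. w \<in> loc_L2 \<Longrightarrow> v0 \<in> loc_L2 \<Longrightarrow> (\<forall>t\<ge>0. w t = E (\<lambda>s. H w s + v0 s) t) \<Longrightarrow> 0 < b \<Longrightarrow>
       energy w b \<le> cW * energy v0 b"
begin

definition K :: sys where "K y = hold Ts (sample Ts (hold T (sample T (F y))))"

text \<open>Sampling reads the right-continuous representative, and the integral of
  \<open>D y\<close> is one of \<open>F y\<close>.\<close>

lemma K_eq:
  assumes y: "y \<in> loc_L2"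
  shows "K y t = integral {0..t} (D y) - E (D y) t"
proof -
  let ?f = "\<lambda>t. integral {0..t} (D y)"
  have rc: "right_continuous ?f"
    unfolding right_continuous_def
  proof (intro allI impI)
    fix t :: real assume t: "0 \<le> t"
    have "continuous (at t within {0..}) ?f"
      using indefinite_integral_continuous_halfline[OF D_loc[OF y]] t
      by (simp add: continuous_on_eq_continuous_within)
    then show "continuous (at_right t) ?f" by (rule continuous_within_subset) (use t in auto)
  qed
  have "right_continuous ?f \<and> ?f =\<^sub>a\<^sub>e F y" using rc sig_eq_sym[OF D_int[OF y]] by simp
  then have rep: "right_continuous (right_cont_rep (F y)) \<and> right_cont_rep (F y) =\<^sub>a\<^sub>e F y"
    unfolding right_cont_rep_def by (rule someI[of "\<lambda>g. right_continuous g \<and> g =\<^sub>a\<^sub>e F y"])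
  then have "right_cont_rep (F y) =\<^sub>a\<^sub>e ?f" using sig_eq_trans D_int[OF y] by blast
  then have "sample T (F y) k = ?f (T k)" for k
    using right_continuous_eq[OF _ rc _ admissible_nonneg[OF T, of k]] rep by (simp add: sample_def)
  then have "sample T (F y) = (\<lambda>k. ?f (T k))" by blast
  then show ?thesis by (simp add: K_def E_def)
qed

lemma D_diff_energy_causal:
  "y \<in> loc_L2 \<Longrightarrow> 0 < b \<Longrightarrow> energy (\<lambda>t. D (trunc b y) t - D y t) b \<le> 0"
proof -
  assume y: "y \<in> loc_L2" and b: "0 < b"
  have ty: "trunc b y \<in> loc_L2" by (rule sq_integrable_loc_L2(1)[OF trunc_L2[OF y b]])
  have "energy (\<lambda>t. trunc b y t - y t) b = integral {0..b} (\<lambda>t. 0)"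
    unfolding energy_def by (rule integral_cong) (simp add: trunc_def)
  then show ?thesis using b by (intro D_causal ty y) auto
qed

lemma K_causal: "causal (neg_sys K)"
  unfolding causal_def operator_on_L2e_def L2e_eq_loc_L2
proof (intro conjI ballI allI impI)
  fix y :: signal assume y: "y \<in> loc_L2"
  have "K y = (\<lambda>t. integral {0..t} (D y) - E (D y) t)" by (rule ext) (rule K_eq[OF y])
  then have "K y \<in> loc_L2"
    by (simp only:) (intro loc_L2_diff indefinite_integral_loc_L2 E_loc D_loc y)
  then show "neg_sys K y \<in> loc_L2" unfolding neg_sys_def by (rule loc_L2_minus)
  fix y' :: signal assume y': "y' \<in> loc_L2" and eq: "y =\<^sub>a\<^sub>e y'"
  note Dc = D_cong[OF y y' eq]
  show "neg_sys K y =\<^sub>a\<^sub>e neg_sys K y'"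
    by (rule sig_eq_halfline)
      (simp add: neg_sys_def K_eq[OF y] K_eq[OF y'] E_cong[OF Dc] integral_sig_eq[OF Dc])
next
  fix b :: real and y :: signal assume b: "0 < b" and y: "y \<in> loc_L2"
  let ?z = "trunc b y"
  have z: "?z \<in> loc_L2" by (rule sq_integrable_loc_L2(1)[OF trunc_L2[OF y b]])
  have e: "energy (\<lambda>t. D ?z t - D y t) b \<le> 0" by (rule D_diff_energy_causal[OF y b])
  have neg: "negligible {t \<in> {0..b}. D ?z t - D y t \<noteq> 0}"
    by (rule energy_eq_0_imp_AE[OF loc_L2_diff[OF D_loc[OF z] D_loc[OF y]] e])
  show "trunc b (neg_sys K ?z) =\<^sub>a\<^sub>e trunc b (neg_sys K y)"
  proof (rule sig_eq_halfline)
    fix t :: real assume "0 \<le> t"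
    show "trunc b (neg_sys K ?z) t = trunc b (neg_sys K y) t"
    proof (cases "t \<le> b")
      case True
      have "integral {0..t} (D ?z) = integral {0..t} (D y)"
        by (rule integral_spike[OF neg]) (use True in auto)
      then have "K ?z t = K y t"
        using E_local[OF D_loc[OF z] D_loc[OF y] e, of t] True \<open>0 \<le> t\<close>
        unfolding K_eq[OF z] K_eq[OF y] by simp
      then have "neg_sys K ?z t = neg_sys K y t" by (simp only: neg_sys_def)
      then show ?thesis by (simp only: trunc_def[of b "neg_sys K _"])
    next
      case False
      then show ?thesis by (simp add: trunc_def[of b "neg_sys K _"])
    qed
  qed
qed

text \<open>Loop transformation: since \<open>- K y\<close> equals \<open>- F y + E (D y)\<close>,
  the sampling error acts on the nominal loop as one more disturbance.\<close>

lemma loop_iff_nominal: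
  assumes y: "y \<in> loc_L2"
  shows "loop_solution P (neg_sys K) (dw, dv) (u, y) \<longleftrightarrow>
    loop_solution P (neg_sys F) (\<lambda>t. E (D y) t + dw t, dv) (u, y)"
proof -
  have "AE t in halfline. 0 \<le> t" by (rule AE_I2) (simp add: space_restrict_space)
  then have eq: "AE t in halfline. neg_sys K y t + dw t = neg_sys F y t + (E (D y) t + dw t)"
    using D_int[OF y] unfolding sig_eq_def by eventually_elim (simp add: neg_sys_def K_eq[OF y])
  have "u =\<^sub>a\<^sub>e (\<lambda>t. neg_sys K y t + dw t) \<longleftrightarrow> u =\<^sub>a\<^sub>e (\<lambda>t. neg_sys F y t + (E (D y) t + dw t))"
    using sig_eq_trans[OF _ eq[folded sig_eq_def]] sig_eq_trans[OF _ sig_eq_sym[OF eq[folded sig_eq_def]]]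
    by blast
  then show ?thesis by (simp add: loop_solution_def)
qed

lemma loop_diff:
  assumes s: "loop_solution P (neg_sys K) (dw, dv) (u, y)" "loop_solution P (neg_sys K) (dw', dv') (u', y')"
  shows "loop_solution P (neg_sys K) (\<lambda>t. dw t - dw' t, \<lambda>t. dv t - dv' t) (\<lambda>t. u t - u' t, \<lambda>t. y t - y' t)"
proof -
  have y: "y \<in> loc_L2" "y' \<in> loc_L2" using s by (auto simp: loop_solution_def L2e_eq_loc_L2)
  note D = D_loc[OF y(1)] D_loc[OF y(2)]
  have "loop_solution P (neg_sys F) (\<lambda>t. 1 * (E (D y) t + dw t) + - 1 * (E (D y') t + dw' t), \<lambda>t. 1 * dv t + - 1 * dv' t)
     (\<lambda>t. 1 * u t + - 1 * u' t, \<lambda>t. 1 * y t + - 1 * y' t)"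
    using loop_solution_linear[OF linP neg_sys_linear[OF linF] s(1)[unfolded loop_iff_nominal[OF y(1)]]
        s(2)[unfolded loop_iff_nominal[OF y(2)]], of 1 "- 1"] by (simp only: fst_conv snd_conv)
  moreover have "(\<lambda>t. 1 * f t + - 1 * g t) = (\<lambda>t. f t - g t)" for f g :: signal by simp
  ultimately have L: "loop_solution P (neg_sys F) (\<lambda>t. (E (D y) t + dw t) - (E (D y') t + dw' t), \<lambda>t. dv t - dv' t)
     (\<lambda>t. u t - u' t, \<lambda>t. y t - y' t)"
    by (simp only:)
  have "(\<lambda>t. (E (D y) t + dw t) - (E (D y') t + dw' t))
    =\<^sub>a\<^sub>e (\<lambda>t. E (D (\<lambda>t. y t - y' t)) t + (dw t - dw' t))"
  proof (rule sig_eq_halfline)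
    fix t :: real assume t: "0 \<le> t"
    have "E (D (\<lambda>t. y t - y' t)) t = E (D y) t - E (D y') t"
      unfolding E_cong[OF D_diff[OF y]] E_diff[OF D t] ..
    then show "(E (D y) t + dw t) - (E (D y') t + dw' t) = E (D (\<lambda>t. y t - y' t)) t + (dw t - dw' t)" by simp
  qed
  from loop_solution_input_cong[OF L this]
  show ?thesis unfolding loop_iff_nominal[OF loc_L2_diff[OF y]] .
qed

text \<open>The input \<open>w + dw\<close> of the nominal loop has at most twice the sum of the two
  energies; \<open>cW * (cD * cN)\<close> bounds the energy of \<open>w\<close> by that of the
  disturbances, and the outer \<open>cN\<close> is the nominal gain.\<close>

definition cS :: real where "cS = cN * (2 * (cW * (cD * cN)) + 2)"

lemma cS_nonneg: "0 \<le> cS"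
  unfolding cS_def using cW cD cN by simp

lemma loop_gain:
  assumes d: "dw \<in> loc_L2" "dv \<in> loc_L2" and s: "loop_solution P (neg_sys K) (dw, dv) (u, y)" and b: "0 < b"
  shows "energy u b + energy y b \<le> cS * (energy dw b + energy dv b)"
proof -
  have y: "y \<in> loc_L2" using s by (simp add: loop_solution_def L2e_eq_loc_L2)
  define w where "w = E (D y)"
  have w: "w \<in> loc_L2" unfolding w_def by (rule E_loc[OF D_loc[OF y]])
  define v0 where "v0 = D (snd (N dw dv))"
  have v0: "v0 \<in> loc_L2" unfolding v0_def by (rule D_loc) (use N_loc[OF d] in simp)
  have nom: "loop_solution P (neg_sys F) (\<lambda>t. w t + dw t, dv) (u, y)"
    using s unfolding loop_iff_nominal[OF y] w_def .
  have Dy: "D y =\<^sub>a\<^sub>e (\<lambda>t. H w t + v0 t)" unfolding v0_def by (rule D_solution[OF d w nom])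
  have "w = E (\<lambda>s. H w s + v0 s)" using E_cong[OF Dy] by (simp add: w_def)
  then have ew: "energy w b \<le> cW * energy v0 b" by (intro est w v0 b) metis
  have e0: "energy v0 b \<le> cD * cN * (energy dw b + energy dv b)"
    unfolding v0_def by (rule N_output_gain[OF d b])
  have nn: "0 \<le> energy dw b" "0 \<le> energy dv b" using d energy_nonneg by auto
  have ew': "energy w b \<le> cW * (cD * cN) * (energy dw b + energy dv b)"
    using ew mult_left_mono[OF e0 cW] by (simp add: mult.assoc)
  have wd: "(\<lambda>t. w t + dw t) \<in> loc_L2" by (rule loc_L2_add[OF w d(1)])
  have "energy u b + energy y b = energy (fst (N (\<lambda>t. w t + dw t) dv)) b + energy (snd (N (\<lambda>t. w t + dw t) dv)) b"
    using energy_sig_eq[OF N_unique(1)[OF wd d(2) nom]] energy_sig_eq[OF N_unique(2)[OF wd d(2) nom]] by simp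
  also have "\<dots> \<le> cN * (energy (\<lambda>t. w t + dw t) b + energy dv b)"
    using N_gain[of "(\<lambda>t. w t + dw t, dv)" b] wd d(2) b by simp
  also have "\<dots> \<le> cN * ((2 * (cW * (cD * cN)) + 2) * (energy dw b + energy dv b))"
    using energy_add_le[OF w d(1), of b] ew' nn cN
    by (intro mult_left_mono) (auto simp: algebra_simps)
  finally show ?thesis by (simp add: cS_def mult.assoc)
qed

text \<open>A fixed point \<open>w\<close> of the error equation is found first; the nominal loop
  driven by \<open>w + dw\<close> then has the sampling error \<open>w\<close>, hence solves the
  sampled loop.\<close>

lemma loop_exists:
  assumes d: "dw \<in> loc_L2" "dv \<in> loc_L2"
  shows "\<exists>x. loop_solution P (neg_sys K) (dw, dv) x"
proof -
  define v0 where "v0 = D (snd (N dw dv))"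
  have v0: "v0 \<in> loc_L2" unfolding v0_def by (rule D_loc) (use N_loc[OF d] in simp)
  define \<Phi> where "\<Phi> = (\<lambda>w. E (\<lambda>s. H w s + v0 s))"
  have Hv: "(\<lambda>s. H w s + v0 s) \<in> loc_L2" if "w \<in> loc_L2" for w by (rule loc_L2_add[OF H_loc[OF that] v0])
  have into: "\<Phi> w \<in> loc_L2" if "w \<in> loc_L2" for w unfolding \<Phi>_def by (rule E_loc[OF Hv[OF that]])
  have lip: "\<exists>C>0. \<forall>w\<in>loc_L2. \<forall>w'\<in>loc_L2. \<forall>t\<in>{0..b}.
      (norm (\<Phi> w t - \<Phi> w' t))\<^sup>2 \<le> C * energy (\<lambda>s. w s - w' s) t" if b: "0 \<le> b" for b
  proof (intro exI[of _ "b * (cD * cN) + 1"] conjI ballI)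
    show "0 < b * (cD * cN) + 1" using b cD cN by (simp add: add_nonneg_pos)
    fix w w' :: signal and t assume w: "w \<in> loc_L2" "w' \<in> loc_L2" and t: "t \<in> {0..b}"
    have t0: "0 \<le> t" using t by simp
    have e: "0 \<le> energy (\<lambda>s. w s - w' s) t" by (rule energy_nonneg[OF loc_L2_diff[OF w]])
    have "\<Phi> w t - \<Phi> w' t = E (\<lambda>s. (H w s + v0 s) - (H w' s + v0 s)) t"
      unfolding \<Phi>_def by (rule E_diff[OF Hv[OF w(1)] Hv[OF w(2)] t0])
    then have "(norm (\<Phi> w t - \<Phi> w' t))\<^sup>2 = (E (\<lambda>s. H w s - H w' s) t)\<^sup>2" by simp
    also have "\<dots> \<le> t * energy (\<lambda>s. H w s - H w' s) t"
      by (rule E_bound[OF loc_L2_diff[OF H_loc[OF w(1)] H_loc[OF w(2)]] t0])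
    also have "\<dots> \<le> b * (cD * cN * energy (\<lambda>s. w s - w' s) t)"
      using t by (intro mult_mono H_diff_gain w energy_nonneg loc_L2_diff H_loc) auto
    also have "\<dots> \<le> (b * (cD * cN) + 1) * energy (\<lambda>s. w s - w' s) t"
      using e by (simp add: distrib_right)
    finally show "(norm (\<Phi> w t - \<Phi> w' t))\<^sup>2 \<le> (b * (cD * cN) + 1) * energy (\<lambda>s. w s - w' s) t" .
  qed
  obtain w where w: "w \<in> loc_L2" "\<And>t. 0 \<le> t \<Longrightarrow> w t = \<Phi> w t"
    using volterra_fixed_point[of \<Phi>, OF into lip] by blast
  have wd: "(\<lambda>t. w t + dw t) \<in> loc_L2" by (rule loc_L2_add[OF w(1) d(1)])
  obtain u y where uy: "N (\<lambda>t. w t + dw t) dv = (u, y)" by (cases "N (\<lambda>t. w t + dw t) dv")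
  have nom: "loop_solution P (neg_sys F) (\<lambda>t. w t + dw t, dv) (u, y)"
    using N_solution[OF wd d(2)] by (simp add: uy)
  have y: "y \<in> loc_L2" using nom by (simp add: loop_solution_def L2e_eq_loc_L2)
  have "D y =\<^sub>a\<^sub>e (\<lambda>t. H w t + v0 t)" unfolding v0_def by (rule D_solution[OF d w(1) nom])
  then have Ew: "E (D y) = \<Phi> w" unfolding \<Phi>_def by (rule E_cong)
  have "(\<lambda>t. neg_sys F y t + (w t + dw t)) =\<^sub>a\<^sub>e (\<lambda>t. neg_sys F y t + (E (D y) t + dw t))"
    by (rule sig_eq_halfline) (simp add: Ew w(2)[symmetric])
  then have "u =\<^sub>a\<^sub>e (\<lambda>t. neg_sys F y t + (E (D y) t + dw t))"
    using nom sig_eq_trans by (auto simp: loop_solution_def)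
  then have "loop_solution P (neg_sys F) (\<lambda>t. E (D y) t + dw t, dv) (u, y)"
    using nom by (simp add: loop_solution_def)
  then show ?thesis using loop_iff_nominal[OF y] by blast
qed

text \<open>The gain bound for a difference of solutions. Equal inputs give uniqueness, inputs that
  agree up to \<open>b\<close> give causality.\<close>

lemma loop_diff_gain:
  assumes d: "d \<in> loc_L2 \<times> loc_L2" "d' \<in> loc_L2 \<times> loc_L2"
    and s: "loop_solution P (neg_sys K) d x" "loop_solution P (neg_sys K) d' x'"
    and e: "energy (\<lambda>t. fst d t - fst d' t) b + energy (\<lambda>t. snd d t - snd d' t) b \<le> 0" and b: "0 < b"
  shows "energy (\<lambda>t. fst x t - fst x' t) b \<le> 0" "energy (\<lambda>t. snd x t - snd x' t) b \<le> 0"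
proof -
  have dl: "(\<lambda>t. fst d t - fst d' t) \<in> loc_L2" "(\<lambda>t. snd d t - snd d' t) \<in> loc_L2"
    using d loc_L2_diff[of "fst d" "fst d'"] loc_L2_diff[of "snd d" "snd d'"] by (simp_all add: mem_Times_iff)
  have s': "loop_solution P (neg_sys K) (fst d, snd d) (fst x, snd x)"
    "loop_solution P (neg_sys K) (fst d', snd d') (fst x', snd x')"
    using s by simp_all
  have xl: "fst x \<in> loc_L2" "snd x \<in> loc_L2" "fst x' \<in> loc_L2" "snd x' \<in> loc_L2"
    using s by (auto simp: loop_solution_def L2e_eq_loc_L2)
  have "energy (\<lambda>t. fst x t - fst x' t) b + energy (\<lambda>t. snd x t - snd x' t) b
     \<le> cS * (energy (\<lambda>t. fst d t - fst d' t) b + energy (\<lambda>t. snd d t - snd d' t) b)"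
    by (rule loop_gain[OF dl loop_diff[OF s'] b])
  also have "\<dots> \<le> 0" by (rule mult_nonneg_nonpos[OF cS_nonneg e])
  finally have "energy (\<lambda>t. fst x t - fst x' t) b + energy (\<lambda>t. snd x t - snd x' t) b \<le> 0" .
  moreover have "0 \<le> energy (\<lambda>t. fst x t - fst x' t) b" "0 \<le> energy (\<lambda>t. snd x t - snd x' t) b"
    by (rule energy_nonneg[OF loc_L2_diff[OF xl(1,3)]], rule energy_nonneg[OF loc_L2_diff[OF xl(2,4)]])
  ultimately show "energy (\<lambda>t. fst x t - fst x' t) b \<le> 0" "energy (\<lambda>t. snd x t - snd x' t) b \<le> 0"
    by linarith+
qed

lemma loop_closed_solution:
  "d \<in> loc_L2 \<times> loc_L2 \<Longrightarrow> loop_solution P (neg_sys K) d (closed_loop P (neg_sys K) d)"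
  unfolding closed_loop_def by (rule someI_ex) (use loop_exists in auto)

lemma loop_solution_loc_L2:
  "loop_solution P (neg_sys K) d x \<Longrightarrow> fst x \<in> loc_L2" "loop_solution P (neg_sys K) d x \<Longrightarrow> snd x \<in> loc_L2"
  by (auto simp: loop_solution_def L2e_eq_loc_L2)

lemma loop_unique:
  assumes d: "d \<in> loc_L2 \<times> loc_L2"
    and s: "loop_solution P (neg_sys K) d x" "loop_solution P (neg_sys K) d x'"
  shows "fst x =\<^sub>a\<^sub>e fst x'" "snd x =\<^sub>a\<^sub>e snd x'"
proof -
  have e: "energy (\<lambda>t. fst d t - fst d t) b + energy (\<lambda>t. snd d t - snd d t) b \<le> 0" for b
    by (simp add: energy_def)
  note g = loop_diff_gain[OF d d s e]
  show "fst x =\<^sub>a\<^sub>e fst x'"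
    by (rule sig_eq_if_energy_zero[OF loop_solution_loc_L2(1)[OF s(1)] loop_solution_loc_L2(1)[OF s(2)]])
      (rule g(1))
  show "snd x =\<^sub>a\<^sub>e snd x'"
    by (rule sig_eq_if_energy_zero[OF loop_solution_loc_L2(2)[OF s(1)] loop_solution_loc_L2(2)[OF s(2)]])
      (rule g(2))
qed

lemma loop_causal:
  assumes d: "d \<in> loc_L2 \<times> loc_L2" and b: "0 < b"
  defines "x \<equiv> closed_loop P (neg_sys K) (trunc b (fst d), trunc b (snd d))"
  shows "trunc b (fst x) =\<^sub>a\<^sub>e trunc b (fst (closed_loop P (neg_sys K) d))"
    "trunc b (snd x) =\<^sub>a\<^sub>e trunc b (snd (closed_loop P (neg_sys K) d))"
proof -
  have td: "(trunc b (fst d), trunc b (snd d)) \<in> loc_L2 \<times> loc_L2"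
    using sq_integrable_loc_L2(1)[OF trunc_L2[OF _ b], of "fst d"]
      sq_integrable_loc_L2(1)[OF trunc_L2[OF _ b], of "snd d"] d by (simp add: mem_Times_iff)
  have e0: "energy (\<lambda>t. trunc b f t - f t) b = 0" for f :: signal
  proof -
    have "energy (\<lambda>t. trunc b f t - f t) b = integral {0..b} (\<lambda>t. 0)"
      unfolding energy_def by (rule integral_cong) (simp add: trunc_def)
    then show ?thesis by simp
  qed
  have e: "energy (\<lambda>t. fst (trunc b (fst d), trunc b (snd d)) t - fst d t) b
      + energy (\<lambda>t. snd (trunc b (fst d), trunc b (snd d)) t - snd d t) b \<le> 0"
    unfolding fst_conv snd_conv e0 by simp
  have sx: "loop_solution P (neg_sys K) (trunc b (fst d), trunc b (snd d)) x"
    unfolding x_def by (rule loop_closed_solution[OF td])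
  note sd = loop_closed_solution[OF d]
  note g = loop_diff_gain[OF td d sx sd e b]
  show "trunc b (fst x) =\<^sub>a\<^sub>e trunc b (fst (closed_loop P (neg_sys K) d))"
    by (rule trunc_sig_eq_if_energy_zero[OF loop_solution_loc_L2(1)[OF sx] loop_solution_loc_L2(1)[OF sd] g(1)])
  show "trunc b (snd x) =\<^sub>a\<^sub>e trunc b (snd (closed_loop P (neg_sys K) d))"
    by (rule trunc_sig_eq_if_energy_zero[OF loop_solution_loc_L2(2)[OF sx] loop_solution_loc_L2(2)[OF sd] g(2)])
qed

lemma loop_well_posed: "well_posed P (neg_sys K)"
  unfolding well_posed_def L2e_eq_loc_L2 Let_def
proof (intro conjI)
  show "causal P" by (rule causP)
  show "causal (neg_sys K)" by (rule K_causal)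
  show "\<forall>d\<in>loc_L2 \<times> loc_L2. (\<exists>x. loop_solution P (neg_sys K) d x) \<and>
      (\<forall>x y. loop_solution P (neg_sys K) d x \<and> loop_solution P (neg_sys K) d y \<longrightarrow>
         fst x =\<^sub>a\<^sub>e fst y \<and> snd x =\<^sub>a\<^sub>e snd y)"
    using loop_closed_solution loop_unique by metis
  show "\<forall>\<tau>>0. \<forall>d\<in>loc_L2 \<times> loc_L2.
      trunc \<tau> (fst (closed_loop P (neg_sys K) (trunc \<tau> (fst d), trunc \<tau> (snd d)))) =\<^sub>a\<^sub>e
        trunc \<tau> (fst (closed_loop P (neg_sys K) d)) \<and>
      trunc \<tau> (snd (closed_loop P (neg_sys K) (trunc \<tau> (fst d), trunc \<tau> (snd d)))) =\<^sub>a\<^sub>e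
        trunc \<tau> (snd (closed_loop P (neg_sys K) d))"
    using loop_causal by simp
qed

lemma loop_bounded:
  assumes d: "d \<in> L2 \<times> L2"
  defines "x \<equiv> closed_loop P (neg_sys K) d"
  shows "x \<in> L2 \<times> L2" "pair_norm x \<le> sqrt (2 * cS) * pair_norm d"
proof -
  have ds: "fst d \<in> sq_integrable" "snd d \<in> sq_integrable" using d by (auto simp: L2_eq_sq_integrable)
  note dl = sq_integrable_loc_L2(1)[OF ds(1)] sq_integrable_loc_L2(1)[OF ds(2)]
  have sx: "loop_solution P (neg_sys K) d x"
    unfolding x_def by (rule loop_closed_solution) (use dl in \<open>simp add: mem_Times_iff\<close>)
  then have s: "loop_solution P (neg_sys K) (fst d, snd d) (fst x, snd x)" by simp
  note xl = loop_solution_loc_L2(1)[OF sx] loop_solution_loc_L2(2)[OF sx]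
  have B: "energy (fst x) b + energy (snd x) b \<le> cS * (pair_norm d)\<^sup>2" if "0 < b" for b
  proof -
    have "energy (fst x) b + energy (snd x) b \<le> cS * (energy (fst d) b + energy (snd d) b)"
      by (rule loop_gain[OF dl s that])
    also have "\<dots> \<le> cS * ((L2_norm (fst d))\<^sup>2 + (L2_norm (snd d))\<^sup>2)"
      by (intro mult_left_mono add_mono energy_le_L2_norm ds cS_nonneg)
    finally show ?thesis by (simp add: pair_norm_def)
  qed
  have each: "energy (fst x) b \<le> cS * (pair_norm d)\<^sup>2" "energy (snd x) b \<le> cS * (pair_norm d)\<^sup>2"
    if "0 \<le> b" for b
  proof -
    \<comment> \<open>\<open>loop_gain\<close> concerns positive horizons, whereas
      \<open>b = 0\<close> is allowed here.\<close>
    have "energy (fst x) b \<le> energy (fst x) (b + 1)" "energy (snd x) b \<le> energy (snd x) (b + 1)"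
      by (rule energy_mono[OF xl(1)], simp, rule energy_mono[OF xl(2)], simp)
    then show "energy (fst x) b \<le> cS * (pair_norm d)\<^sup>2" "energy (snd x) b \<le> cS * (pair_norm d)\<^sup>2"
      using B[of "b + 1"] that energy_nonneg[OF xl(1), of "b + 1"] energy_nonneg[OF xl(2), of "b + 1"] by linarith+
  qed
  note r1 = sq_integrable_I[OF xl(1) each(1)] and r2 = sq_integrable_I[OF xl(2) each(2)]
  show "x \<in> L2 \<times> L2" using r1(1) r2(1) by (simp add: L2_eq_sq_integrable mem_Times_iff)
  \<comment> \<open>The two components were bounded separately by the same quantity, which accounts
    for the factor 2.\<close>
  have "pair_norm x \<le> sqrt (2 * cS * (pair_norm d)\<^sup>2)"
    unfolding pair_norm_def[of x] L2_norm_square by (rule real_sqrt_le_mono) (use r1(2) r2(2) in linarith)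
  also have "\<dots> = sqrt (2 * cS) * pair_norm d"
    by (simp add: real_sqrt_mult pair_norm_def)
  finally show "pair_norm x \<le> sqrt (2 * cS) * pair_norm d" .
qed

lemma stable: "stable_interconnection P (neg_sys K)"
  unfolding stable_interconnection_def
  using loop_well_posed loop_bounded by blast

end

theorem theorem2:
  fixes P F :: sys and Ps Fs :: "complex \<Rightarrow> complex"
    and A :: "real^'n^'n" and B_d B_w :: "real^1^'n" and C_z C_v :: "real^'n^1"
    and D_zd D_zw D_vd D_vw :: "real^1^1"
    and h \<delta> \<beta> \<eta> :: real
  assumes P: "causal_LTI P" "has_transfer_function P Ps"
    and F: "stable_low_pass F Fs"
    and nominal: "stable_interconnection P (neg_sys F)"
    and realization: "has_transfer_matrix (generalized_plant F P F)
          (state_space A (beside B_d B_w) (above C_z C_v) (block_matrix D_zd D_zw D_vd D_vw))"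
    and A: "hurwitz A"
    and h: "h > 0" and delta: "\<delta> \<ge> 0"
    and beta: "\<beta> = (2 * (1 + \<delta>) * h / pi + sqrt ((1 + \<delta>) * h\<^sup>2 * min \<delta> 1))\<^sup>2"
    and eta: "\<eta> = h * min \<delta> 1"
    and lmi: "\<exists>(X::real) (Y::real) (Q::real^'n^'n). X \<ge> 0 \<and> Y \<ge> 0 \<and> Q = transpose Q \<and>
          neg_definite
            (transpose (block_matrix A B_w (mat 1) 0)
               ** block_matrix 0 Q Q 0
               ** block_matrix A B_w (mat 1) 0
             + transpose (block_matrix C_v D_vw 0 (mat 1))
               ** block_matrix (mat (\<beta> * X + \<eta> * Y)) (mat Y) (mat Y) (mat (- X))
               ** block_matrix C_v D_vw 0 (mat 1))"
  shows "\<forall>T' Ts. admissible T' \<and> admissible Ts \<and>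
           timing_bounds T' Ts h ((1 + \<delta>) * h) (\<delta> * h) (h * min \<delta> 1) \<longrightarrow>
           stable_interconnection P
             (neg_sys (\<lambda>y. hold Ts (sample Ts (hold T' (sample T' (F y))))))"
proof (intro allI impI)
  fix T' Ts :: "nat \<Rightarrow> real"
  assume TT: "admissible T' \<and> admissible Ts \<and> timing_bounds T' Ts h ((1 + \<delta>) * h) (\<delta> * h) (h * min \<delta> 1)"
  then have adm: "admissible T'" "admissible Ts" "timing_bounds T' Ts h ((1 + \<delta>) * h) (\<delta> * h) \<eta>"
    by (simp_all add: eta)
  obtain X Y :: real and Q :: "real^'n^'n" where X: "0 \<le> X" and Y: "0 \<le> Y" and Q: "transpose Q = Q"
    and neg: "neg_definite
            (transpose (block_matrix A B_w (mat 1) 0)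
               ** block_matrix 0 Q Q 0
               ** block_matrix A B_w (mat 1) 0
             + transpose (block_matrix C_v D_vw 0 (mat 1))
               ** block_matrix (mat (\<beta> * X + \<eta> * Y)) (mat Y) (mat Y) (mat (- X))
               ** block_matrix C_v D_vw 0 (mat 1))"
    using lmi by (elim exE conjE) (rule that, simp_all)
  define \<alpha> where "\<alpha> = \<beta> * X + \<eta> * Y"
  define d where "d = D_vw $ 1 $ 1"
  \<comment> \<open>The gap bound of the event grid: the longest sampling period plus the largest
    delay until the next actuation event.\<close>
  define L where "L = h + \<delta> * h"
  have \<eta>0: "0 \<le> \<eta>" using h delta by (simp add: eta)
  have \<beta>: "\<beta> = (2 * L / pi + sqrt (L * \<eta>))\<^sup>2"
    unfolding beta eta L_def by (simp add: algebra_simps power2_eq_square)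
  have \<alpha>0: "0 \<le> \<alpha>" using X Y \<eta>0 by (simp add: \<alpha>_def \<beta>)
  obtain e where e: "0 < e" and diss: "\<And>x r. 2 * ((Q *v x) \<bullet> (A *v x + B_w *v vec r))
     + \<alpha> * ((C_v *v x) $ 1 + d * r)\<^sup>2 + 2 * Y * (((C_v *v x) $ 1 + d * r) * r) - X * r\<^sup>2
     \<le> - e * ((norm x)\<^sup>2 + r\<^sup>2)"
    using lmi_dissipation[OF Q neg] unfolding \<alpha>_def[symmetric] d_def[symmetric] by (elim exE conjE) (rule that, assumption, simp only:)
  \<comment> \<open>The dissipation inequality with input zero; the output term is nonnegative
    because \<open>\<alpha> \<ge> 0\<close> and may be dropped.\<close>
  have lyap: "(Q *v x) \<bullet> (A *v x) \<le> - (e / 2) * (norm x)\<^sup>2" for x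
  proof -
    have "B_w *v (vec 0 :: real^1) = 0" by (simp add: vec_eq_iff matrix_vector_mult_def)
    then have "2 * ((Q *v x) \<bullet> (A *v x)) + \<alpha> * ((C_v *v x) $ 1)\<^sup>2 \<le> - e * (norm x)\<^sup>2"
      using diss[of x 0] by simp
    moreover have "0 \<le> \<alpha> * ((C_v *v x) $ 1)\<^sup>2" using \<alpha>0 by simp
    ultimately show ?thesis by simp
  qed
  have e2: "0 < e / 2" using e by simp
  note Qpos = lyapunov_positive[OF A Q e2 lyap]
  obtain cW where cW: "0 \<le> cW" and bound: "\<And>x w v0 b. 0 \<le> b \<Longrightarrow> x \<in> loc_L2 \<Longrightarrow> w \<in> loc_L2 \<Longrightarrow> v0 \<in> loc_L2 \<Longrightarrow>
     (\<forall>t\<ge>0. x t = integral {0..t} (\<lambda>s. A *v x s + B_w *v vec (w s))) \<Longrightarrow>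
     0 \<le> \<alpha> * energy (\<lambda>t. ((C_v *v x t) $ 1 + d * w t) + v0 t) b
       + 2 * Y * integral {0..b} (\<lambda>t. (((C_v *v x t) $ 1 + d * w t) + v0 t) * w t) - X * energy w b \<Longrightarrow>
     energy w b \<le> cW * energy v0 b"
    using dissipation_bound[OF Q Qpos e \<alpha>0 diss] by (elim exE conjE) (rule that, assumption, simp only:)
  obtain D cD where D: "0 \<le> cD" "\<forall>y\<in>loc_L2. D y \<in> loc_L2 \<and> (AE t in halfline. F y t = integral {0..t} (D y)) \<and>
     (\<forall>T\<ge>0. energy (D y) T \<le> cD * energy y T)"
    using stable_low_pass_derivative[OF F] by (elim exE conjE) (rule that)
  obtain cN where cN: "0 \<le> cN" "\<forall>d\<in>loc_L2 \<times> loc_L2. \<forall>T>0. energy (fst (closed_loop P (neg_sys F) d)) T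
     + energy (snd (closed_loop P (neg_sys F) d)) T \<le> cN * (energy (fst d) T + energy (snd d) T)"
    using stable_interconnection_gain[OF nominal] by (elim exE conjE) (rule that)
  interpret nl: nominal_loop P F D cD cN
  proof
    show "linear_sys P" "causal P" using P(1) by (simp_all add: causal_LTI_def)
    show "linear_sys F" "causal F" using F by (simp_all add: stable_low_pass_def causal_LTI_def)
    show "well_posed P (neg_sys F)" using nominal by (simp add: stable_interconnection_def)
  qed (use D cN in \<open>auto simp: sig_eq_def\<close>)
  obtain \<phi> where grid: "event_grid T' \<phi> L \<eta>"
    and held: "\<And>a j t. \<phi> j \<le> t \<Longrightarrow> t < \<phi> (Suc j) \<Longrightarrow> hold Ts (sample Ts (hold T' a)) t = a j"
    using resampled_hold[OF adm h mult_nonneg_nonneg[OF delta less_imp_le[OF h]] \<eta>0] unfolding L_def by auto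
  interpret sm: sampling T' Ts \<phi> L \<eta>
    by unfold_locales (use adm grid held in auto)
  obtain \<sigma> where \<sigma>: "0 \<le> \<sigma>" and tf: "\<forall>f\<in>L2 \<times> L2. \<forall>s. Re s > \<sigma> \<longrightarrow>
     integrable halfline (laplace_integrand (fst (generalized_plant F P F f)) s) \<and>
     integrable halfline (laplace_integrand (snd (generalized_plant F P F f)) s) \<and>
     laplace_pair (generalized_plant F P F f) s
       = state_space A (beside B_d B_w) (above C_z C_v) (block_matrix D_zd D_zw D_vd D_vw) s *v laplace_pair f s"
    using realization unfolding has_transfer_matrix_def by (elim exE conjE) (rule that)
  interpret sl: sampled_loop P F D cD cN T' Ts \<phi> L \<eta> cW
  proof
    show "0 \<le> cW" by (rule cW)
    fix w v0 :: signal and b :: real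
    assume w: "w \<in> loc_L2" and v0: "v0 \<in> loc_L2" and b: "0 < b"
      and weq: "\<forall>t\<ge>0. w t = sm.E (\<lambda>s. nl.H w s + v0 s) t"
    \<comment> \<open>The transfer matrix speaks of inputs in \<open>L2\<close> only, while
      \<open>w\<close> is only locally square integrable. Everything below is needed up to time
      \<open>b\<close>, where \<open>z\<close> and \<open>w\<close> agree.\<close>
    define z where "z = trunc b w"
    have z: "z \<in> sq_integrable" unfolding z_def by (rule trunc_L2[OF w b])
    have zl: "z \<in> loc_L2" by (rule sq_integrable_loc_L2(1)[OF z])
    have zw: "z t = w t" if "t \<in> {0..b}" for t using that by (simp add: z_def trunc_def)
    have ez: "energy z b = energy w b" unfolding z_def by (rule energy_trunc)
    have uL: "(\<lambda>s. B_w *v (vec (z s) :: real^1)) \<in> loc_L2"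
      by (rule loc_L2_linear_image[OF zl linear_input_matrix])
    have linA: "linear ((*v) A)" by simp
    obtain x where xc: "continuous_on {0..} x"
      and x: "\<And>t. 0 \<le> t \<Longrightarrow> x t = integral {0..t} (\<lambda>s. A *v x s + B_w *v vec (z s))"
      by (rule linear_ode_exists[OF linA uL]) (rule that)
    have xL: "x \<in> loc_L2" by (rule loc_L2_continuous[OF xc])
    define y where "y = snd (nl.N z (\<lambda>t. 0))"
    have yl: "y \<in> loc_L2" unfolding y_def using nl.N_loc[OF zl loc_L2_zero] by simp
    define p where "p = (\<lambda>t. (C_v *v x t) $ 1 + d * z t)"
    have z2: "(\<lambda>t. 0, z) \<in> L2 \<times> L2" using z by (simp add: L2_eq_sq_integrable) (simp add: sq_integrable_def)
    have gp: "snd (generalized_plant F P F (\<lambda>t. 0, z)) = diff_sys (F y)"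
      by (simp add: generalized_plant_def y_def case_prod_beta)
    have "AE t in halfline. diff_sys (F y) t = (C_v *v x t) $ 1 + D_vw $ 1 $ 1 * z t"
    proof (rule realization_time_domain[OF A Q e2 lyap z xL x \<sigma>])
      fix s assume "\<sigma> < s"
      then have s: "\<sigma> < Re (complex_of_real s)" by simp
      show "integrable halfline (laplace_integrand (diff_sys (F y)) (of_real s))"
        using bspec[OF tf z2] s by (auto simp only: gp)
      have "laplace (snd (generalized_plant F P F (\<lambda>t. 0, z))) (of_real s)
        = laplace_pair (generalized_plant F P F (\<lambda>t. 0, z)) (of_real s) $ Inr 1"
        by (simp add: laplace_pair_def)
      then show "laplace (diff_sys (F y)) (of_real s)
        = (state_space A (beside B_d B_w) (above C_z C_v) (block_matrix D_zd D_zw D_vd D_vw) (of_real s)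
            *v laplace_pair (\<lambda>t. 0, z) (of_real s)) $ Inr 1"
        using bspec[OF tf z2] s by (simp only: gp)
    qed
    then have "diff_sys (F y) =\<^sub>a\<^sub>e p" by (simp add: sig_eq_def p_def d_def)
    then have "nl.H z =\<^sub>a\<^sub>e p"
      unfolding nl.H_def y_def[symmetric] by (rule sig_eq_trans[OF sig_eq_sym[OF nl.diff_sys_eq_D[OF yl]]])
    then have n1: "negligible {t. 0 \<le> t \<and> nl.H z t \<noteq> p t}" by (simp add: sig_eq_def AE_halfline_iff)
    \<comment> \<open>Causality of \<open>H\<close>, via its gain: replacing \<open>w\<close> by its
      truncation does not change the output up to \<open>b\<close>.\<close>
    have "energy (\<lambda>t. nl.H w t - nl.H z t) b \<le> cD * cN * energy (\<lambda>t. w t - z t) b"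
      using b by (intro nl.H_diff_gain w zl) simp
    also have "energy (\<lambda>t. w t - z t) b = 0" unfolding z_def by (rule energy_diff_trunc)
    finally have "energy (\<lambda>t. nl.H w t - nl.H z t) b \<le> 0" by simp
    then have n2: "negligible {t \<in> {0..b}. nl.H w t - nl.H z t \<noteq> 0}"
      by (rule energy_eq_0_imp_AE[OF loc_L2_diff[OF nl.H_loc[OF w] nl.H_loc[OF zl]]])
    define v where "v = (\<lambda>t. nl.H w t + v0 t)"
    have v: "v \<in> loc_L2" unfolding v_def by (rule loc_L2_add[OF nl.H_loc[OF w] v0])
    let ?S = "{t. 0 \<le> t \<and> nl.H z t \<noteq> p t} \<union> {t \<in> {0..b}. nl.H w t - nl.H z t \<noteq> 0}"
    have n: "negligible ?S" by (rule negligible_Un[OF n1 n2])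
    \<comment> \<open>Outside the null set \<open>?S\<close> and up to \<open>b\<close>, the signal
      \<open>v\<close> driving the sampler is the output \<open>p\<close> of the realization plus
      the disturbance response \<open>v0\<close>.\<close>
    have vp: "p t + v0 t = v t" if "t \<in> {0..b} - ?S" for t using that by (auto simp: v_def)
    interpret se: sampling_error T' \<phi> L \<eta> v "sm.E v" by (rule sm.E_sampling_error[OF v])
    have Ew: "sm.E v t = w t" if "0 \<le> t" for t using weq that by (simp add: v_def)
    have "energy (sm.E v) b = energy w b"
      unfolding energy_def by (rule integral_cong) (simp add: Ew)
    then have gain: "energy w b \<le> \<beta> * energy v b" using se.gain[of b] b by (simp add: \<beta>)
    have ev: "energy (\<lambda>t. p t + v0 t) b = energy v b"
      unfolding energy_def by (rule integral_spike[OF n]) (simp add: vp)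
    have "integral {0..b} (\<lambda>t. 2 * (v t * sm.E v t)) = integral {0..b} (\<lambda>t. 2 * ((p t + v0 t) * z t))"
      by (rule integral_spike[OF n]) (simp add: vp zw Ew)
    then have pass: "0 \<le> 2 * integral {0..b} (\<lambda>t. (p t + v0 t) * z t) + \<eta> * energy v b"
      using se.passivity[of b] b by simp
    \<comment> \<open>The gain and passivity inequalities, weighted by the multipliers
      \<open>X\<close> and \<open>Y\<close>, form exactly the supply that occurs in the matrix
      inequality.\<close>
    have "0 \<le> X * (\<beta> * energy v b - energy w b)
        + Y * (2 * integral {0..b} (\<lambda>t. (p t + v0 t) * z t) + \<eta> * energy v b)"
      using X Y gain pass by simp
    then have "0 \<le> \<alpha> * energy (\<lambda>t. p t + v0 t) b
        + 2 * Y * integral {0..b} (\<lambda>t. (p t + v0 t) * z t) - X * energy z b"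
      unfolding ev ez by (simp add: \<alpha>_def algebra_simps)
    then have "energy z b \<le> cW * energy v0 b"
      unfolding p_def by (intro bound[OF less_imp_le[OF b] xL zl v0 allI[OF impI[OF x]]]) simp_all
    then show "energy w b \<le> cW * energy v0 b" by (simp only: ez)
  qed
  have "sl.K = (\<lambda>y. hold Ts (sample Ts (hold T' (sample T' (F y)))))"
    by (rule ext) (rule sl.K_def)
  then show "stable_interconnection P (neg_sys (\<lambda>y. hold Ts (sample Ts (hold T' (sample T' (F y))))))"
    using sl.stable by simp
qed

end
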